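(* Let $d=3$, let $0<\alpha\le 1$, and let $\gamma\in W^{2,\infty}(B,\mathbb{R}_+)$ be a radial conductivity, with $\gamma\ge c$ a.e. in $B$ for some constant $c>0$, such that $\gamma-1$ is supported in $B_\alpha\subseteq B$. Assume that the function $$\widehat{(\gamma_{\mathrm{exp}}-1)}(\xi)=-\pi^{3/2}\sum_{k=1}^\infty\frac{(-1)^k}{k!\,\Gamma(k+3/2)}\left(\frac{|\xi|}{2}\right)^{2k-2}\left(\lambda_k[\gamma]-k\right),\qquad \xi\in\mathbb{R}^3,$$ is a tempered distribution on $\mathbb{R}^3$. Then its inverse Fourier transform $\gamma_{\mathrm{exp}}-1\in\mathcal{S}'(\mathbb{R}^3)$ is supported in $B_\alpha$.
   Context: $B_\alpha\subset\mathbb{R}^3$ is the ball of radius $\alpha$ centered at the origin, $B=B_1$, and $\mathbb{R}_+=(0,\infty)$. "Supported in $B_\alpha$" means vanishing (almost everywhere, or in the sense of distributions) outside the closed ball of radius $\alpha$. The Fourier transform is $\widehat f(\xi)=\int_{\mathbb{R}^3}e^{-ix\cdot\xi}f(x)\,dx$, extended to tempered distributions by duality. The Dirichlet to Neumann map $\Lambda_\gamma:H^{1/2}(\partial B)\to H^{-1/2}(\partial B)$ is $\Lambda_\gamma(f)=\gamma\,\partial_\nu u|_{\partial B}$ (in the usual weak sense), where $\partial_\nu$ is the outward normal derivative and $u\in H^1(B)$ is the unique solution of $\nabla\cdot(\gamma\nabla u)=0$ in $B$, $u=f$ on $\partial B$. When $\gamma$ is radial, $\Lambda_\gamma$ is diagonal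 on spherical harmonics, and $\lambda_k[\gamma]\in\mathbb{R}$ ($k\in\{0,1,2,\dots\}$) denotes its eigenvalue on the spherical harmonics of degree $k$: $\Lambda_\gamma(Y_k)=\lambda_k[\gamma]\,Y_k$ for every spherical harmonic $Y_k$ of degree $k$ on $\mathbb{S}^2=\partial B$. The series above converges absolutely for every $\xi\in\mathbb{R}^3$. The object $\gamma_{\mathrm{exp}}$ (equal to $1$ plus the inverse Fourier transform of the series) is called the Born approximation of $\gamma$. *)

theory Defs
  imports "HOL-Analysis.Analysis"
begin

section \<open>Smooth functions, test functions\<close>

definition partial_deriv :: "3 \<Rightarrow> (real^3 \<Rightarrow> 'b::real_normed_vector) \<Rightarrow> real^3 \<Rightarrow> 'b" where
  "partial_deriv i f x = frechet_derivative f (at x) (axis i 1)"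

primrec partial_derivs :: "3 list \<Rightarrow> (real^3 \<Rightarrow> 'b::real_normed_vector) \<Rightarrow> real^3 \<Rightarrow> 'b" where
  "partial_derivs [] f = f"
| "partial_derivs (j # js) f = partial_deriv j (partial_derivs js f)"

definition grad :: "(real^3 \<Rightarrow> real) \<Rightarrow> real^3 \<Rightarrow> real^3" where
  "grad f x = (\<chi> i. partial_deriv i f x)"

definition laplacian :: "(real^3 \<Rightarrow> real) \<Rightarrow> real^3 \<Rightarrow> real" where
  "laplacian f x = (\<Sum>i\<in>UNIV. partial_derivs [i, i] f x)"

definition smooth :: "(real^3 \<Rightarrow> 'b::real_normed_vector) \<Rightarrow> bool" where
  "smooth f \<longleftrightarrow> (\<forall>js x. partial_derivs js f differentiable (at x))"

definition test_function :: "(real^3) set \<Rightarrow> (real^3 \<Rightarrow> 'b::real_normed_vector) \<Rightarrow> bool" where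
  "test_function S \<phi> \<longleftrightarrow>
     smooth \<phi> \<and> compact (closure {x. \<phi> x \<noteq> 0}) \<and> closure {x. \<phi> x \<noteq> 0} \<subseteq> S"

section \<open>Weak derivatives and Sobolev spaces\<close>

definition locally_integrable ::
    "(real^3) set \<Rightarrow> (real^3 \<Rightarrow> 'b::{banach, second_countable_topology}) \<Rightarrow> bool" where
  "locally_integrable S f \<longleftrightarrow> (\<forall>K. compact K \<and> K \<subseteq> S \<longrightarrow> integrable (lebesgue_on K) f)"

definition weak_partial :: "(real^3) set \<Rightarrow> 3 \<Rightarrow> (real^3 \<Rightarrow> real) \<Rightarrow> (real^3 \<Rightarrow> real) \<Rightarrow> bool" where
  "weak_partial S i u v \<longleftrightarrow> locally_integrable S u \<and> locally_integrable S v \<and>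
     (\<forall>\<phi>. test_function S \<phi> \<longrightarrow>
        (LINT x|lebesgue_on S. u x * partial_deriv i \<phi> x) = - (LINT x|lebesgue_on S. v x * \<phi> x))"

definition L_inf :: "(real^3) set \<Rightarrow> (real^3 \<Rightarrow> real) \<Rightarrow> bool" where
  "L_inf S u \<longleftrightarrow> u \<in> borel_measurable (lebesgue_on S) \<and> (\<exists>C. AE x in lebesgue_on S. \<bar>u x\<bar> \<le> C)"

text \<open>The space \<open>W\<close> with exponents \<open>(m, \<infinity>)\<close>, by recursion on the order \<open>m\<close>.\<close>

primrec sobolev_inf :: "nat \<Rightarrow> (real^3) set \<Rightarrow> (real^3 \<Rightarrow> real) \<Rightarrow> bool" where
  "sobolev_inf 0 S u \<longleftrightarrow> L_inf S u"
| "sobolev_inf (Suc m) S u \<longleftrightarrow>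
     L_inf S u \<and> (\<forall>i. \<exists>v. weak_partial S i u v \<and> sobolev_inf m S v)"

definition square_integrable :: "'a measure \<Rightarrow> ('a \<Rightarrow> real) \<Rightarrow> bool" where
  "square_integrable M f \<longleftrightarrow> f \<in> borel_measurable M \<and> integrable M (\<lambda>x. (f x)\<^sup>2)"

text \<open>\<open>H1 S u G\<close>: the function \<open>u\<close> lies in \<open>H\<^sup>1(S)\<close> and \<open>G\<close> is (a representative of) its weak gradient.\<close>

definition H1 :: "(real^3) set \<Rightarrow> (real^3 \<Rightarrow> real) \<Rightarrow> (real^3 \<Rightarrow> real^3) \<Rightarrow> bool" where
  "H1 S u G \<longleftrightarrow> square_integrable (lebesgue_on S) u \<and>
     (\<forall>i. square_integrable (lebesgue_on S) (\<lambda>x. G x $ i) \<and> weak_partial S i u (\<lambda>x. G x $ i))"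

section \<open>The unit sphere and traces\<close>

abbreviation unit_ball :: "(real^3) set" where
  "unit_ball \<equiv> ball 0 1"

text \<open>Surface measure on the unit sphere: the measure of a set \<open>A\<close> is three times the volume of
  the cone \<open>{x. norm x < 1 \<and> sgn x \<in> A}\<close> over it (here \<open>sgn x = x /\<^sub>R norm x\<close>), since
  \<open>\<integral> r\<^sup>2 dr = 1/3\<close> over the unit interval. The total mass is \<open>4 * pi\<close>.\<close>

definition sphere_measure :: "(real^3) measure" where
  "sphere_measure =
     restrict_space
       (scale_measure 3 (distr (restrict_space lborel unit_ball) borel sgn)) (sphere 0 1)"

text \<open>\<open>has_trace u G f\<close>: the function \<open>f\<close> on the sphere is the trace of \<open>u \<in> H\<^sup>1\<close> of the unit ball
  (with weak gradient \<open>G\<close>), the trace being the continuous extension of the restriction map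
  from the dense subspace of functions that are smooth up to the boundary. The space
  \<open>H\<close> with exponent \<open>1/2\<close> on the sphere is the range of the trace.\<close>

definition has_trace :: "(real^3 \<Rightarrow> real) \<Rightarrow> (real^3 \<Rightarrow> real^3) \<Rightarrow> (real^3 \<Rightarrow> real) \<Rightarrow> bool" where
  "has_trace u G f \<longleftrightarrow> H1 unit_ball u G \<and> square_integrable sphere_measure f \<and>
     (\<exists>w :: nat \<Rightarrow> real^3 \<Rightarrow> real. (\<forall>n. smooth (w n)) \<and>
        (\<lambda>n. LINT x|lebesgue_on unit_ball. (w n x - u x)\<^sup>2) \<longlonglongrightarrow> 0 \<and>
        (\<lambda>n. LINT x|lebesgue_on unit_ball. (norm (grad (w n) x - G x))\<^sup>2) \<longlonglongrightarrow> 0 \<and>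
        (\<lambda>n. LINT x|sphere_measure. (w n x - f x)\<^sup>2) \<longlonglongrightarrow> 0)"

section \<open>The Dirichlet to Neumann map and its eigenvalues\<close>

text \<open>Weak solution \<open>u\<close>, with weak gradient \<open>G\<close>, of \<open>div (\<gamma> grad u) = 0\<close> in the unit ball,
  \<open>u = f\<close> on the sphere.\<close>

definition conductivity_solution ::
    "(real^3 \<Rightarrow> real) \<Rightarrow> (real^3 \<Rightarrow> real) \<Rightarrow> (real^3 \<Rightarrow> real) \<Rightarrow> (real^3 \<Rightarrow> real^3) \<Rightarrow> bool" where
  "conductivity_solution \<gamma> f u G \<longleftrightarrow> has_trace u G f \<and>
     (\<forall>\<phi>. test_function unit_ball \<phi> \<longrightarrow>
        (LINT x|lebesgue_on unit_ball. \<gamma> x * (G x \<bullet> grad \<phi> x)) = 0)"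

text \<open>\<open>DN_map \<gamma> f L\<close>: the functional \<open>L\<close> on the trace space is the image of \<open>f\<close> under the
  Dirichlet to Neumann map, i.e. the weak conormal derivative on the sphere of the solution \<open>u\<close>
  with boundary value \<open>f\<close>, obtained from Green's formula: \<open>L g\<close> is the integral
  of \<open>\<gamma> (grad u \<bullet> grad v)\<close> for every \<open>v\<close> in \<open>H\<^sup>1\<close> with trace \<open>g\<close>.\<close>

definition DN_map ::
    "(real^3 \<Rightarrow> real) \<Rightarrow> (real^3 \<Rightarrow> real) \<Rightarrow> ((real^3 \<Rightarrow> real) \<Rightarrow> real) \<Rightarrow> bool" where
  "DN_map \<gamma> f L \<longleftrightarrow> (\<exists>u G. conductivity_solution \<gamma> f u G \<and>
     (\<forall>v H g. has_trace v H g \<longrightarrow>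
        L g = (LINT x|lebesgue_on unit_ball. \<gamma> x * (G x \<bullet> H x))))"

definition spherical_harmonic :: "nat \<Rightarrow> (real^3 \<Rightarrow> real) \<Rightarrow> bool" where
  "spherical_harmonic k Y \<longleftrightarrow> (\<exists>p. real_polynomial_function p \<and>
     (\<forall>t x. p (t *\<^sub>R x) = t ^ k * p x) \<and> (\<forall>x. laplacian p x = 0) \<and>
     (\<forall>x\<in>sphere 0 1. Y x = p x))"

text \<open>A function \<open>h\<close> on the sphere is identified with the functional \<open>g \<mapsto> \<integral> h g\<close>.\<close>

definition DN_eigenvalue :: "(real^3 \<Rightarrow> real) \<Rightarrow> nat \<Rightarrow> real \<Rightarrow> bool" where
  "DN_eigenvalue \<gamma> k l \<longleftrightarrow> (\<forall>Y. spherical_harmonic k Y \<longrightarrow>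
     DN_map \<gamma> Y (\<lambda>g. LINT x|sphere_measure. (l * Y x) * g x))"

section \<open>Tempered distributions\<close>

definition schwartz :: "(real^3 \<Rightarrow> complex) \<Rightarrow> bool" where
  "schwartz \<phi> \<longleftrightarrow> smooth \<phi> \<and>
     (\<forall>m js. bounded (range (\<lambda>x. norm x ^ m *\<^sub>R partial_derivs js \<phi> x)))"

definition schwartz_norm :: "nat \<Rightarrow> (real^3 \<Rightarrow> complex) \<Rightarrow> real" where
  "schwartz_norm N \<phi> =
     (SUP (js, x)\<in>{js. length js \<le> N} \<times> UNIV. (1 + norm x) ^ N * norm (partial_derivs js \<phi> x))"

text \<open>Distributions are functionals on all functions; only their values on Schwartz functions
  are meaningful.\<close>

definition tempered_distribution :: "((real^3 \<Rightarrow> complex) \<Rightarrow> complex) \<Rightarrow> bool" where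
  "tempered_distribution T \<longleftrightarrow>
     (\<forall>\<phi> \<psi>. schwartz \<phi> \<and> schwartz \<psi> \<longrightarrow> T (\<lambda>x. \<phi> x + \<psi> x) = T \<phi> + T \<psi>) \<and>
     (\<forall>a \<phi>. schwartz \<phi> \<longrightarrow> T (\<lambda>x. a * \<phi> x) = a * T \<phi>) \<and>
     (\<exists>N C. \<forall>\<phi>. schwartz \<phi> \<longrightarrow> norm (T \<phi>) \<le> C * schwartz_norm N \<phi>)"

text \<open>The distribution \<open>T\<close> is the locally integrable function \<open>F\<close>. The pairing formula is required
  only against compactly supported test functions, since \<open>F \<phi>\<close> need not be integrable
  for a general Schwartz function \<open>\<phi>\<close>; for a tempered \<open>T\<close> it determines \<open>T\<close> by density.\<close>

definition distribution_of :: "(real^3 \<Rightarrow> complex) \<Rightarrow> ((real^3 \<Rightarrow> complex) \<Rightarrow> complex) \<Rightarrow> bool" where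
  "distribution_of F T \<longleftrightarrow> locally_integrable UNIV F \<and>
     (\<forall>\<phi>. test_function UNIV \<phi> \<longrightarrow> T \<phi> = (LINT x|lebesgue. F x * \<phi> x))"

definition distribution_supported_in ::
    "(real^3) set \<Rightarrow> ((real^3 \<Rightarrow> complex) \<Rightarrow> complex) \<Rightarrow> bool" where
  "distribution_supported_in A T \<longleftrightarrow> (\<forall>\<phi>. test_function (- A) \<phi> \<longrightarrow> T \<phi> = 0)"

text \<open>Inverse of the Fourier transform normalised as \<open>\<integral> exp (- i x \<bullet> \<xi>) f x dx\<close>.\<close>

definition inverse_fourier :: "(real^3 \<Rightarrow> complex) \<Rightarrow> real^3 \<Rightarrow> complex" where
  "inverse_fourier \<phi> x =
     complex_of_real (1 / (2 * pi) ^ 3) * (LINT \<xi>|lebesgue. cis (x \<bullet> \<xi>) * \<phi> \<xi>)"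

definition inverse_fourier_distribution ::
    "((real^3 \<Rightarrow> complex) \<Rightarrow> complex) \<Rightarrow> (real^3 \<Rightarrow> complex) \<Rightarrow> complex" where
  "inverse_fourier_distribution T \<phi> = T (inverse_fourier \<phi>)"

section \<open>The Born approximation\<close>

text \<open>The Fourier transform of the Born approximation minus one. The summation index is \<open>j = k - 1\<close>,
  so that \<open>2 * k - 2 = 2 * j\<close>.\<close>

definition born_fourier :: "(nat \<Rightarrow> real) \<Rightarrow> real^3 \<Rightarrow> complex" where
  "born_fourier lam \<xi> = complex_of_real (- (pi powr (3/2)) *
     (\<Sum>j. (-1) ^ Suc j / (fact (Suc j) * Gamma (real (Suc j) + 3/2)) *
          (norm \<xi> / 2) ^ (2 * j) * (lam (Suc j) - real (Suc j))))"

end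

theory Submission
  imports Defs "HOL-Complex_Analysis.Conformal_Mappings"
begin

text \<open>The eigenvalue \<open>lam k\<close> is very close to \<open>k\<close>, the eigenvalue for the conductivity \<open>1\<close>. Let
  \<open>p\<close> be a solid harmonic of degree \<open>k\<close>. Its energy \<open>\<integral> \<bar>grad p\<bar>\<^sup>2\<close> over the ball of radius \<open>\<alpha>\<close>
  is the fraction \<open>\<alpha> ^ (2 * k + 1)\<close> of the energy over the unit ball, and a conductivity that
  equals \<open>1\<close> outside the ball of radius \<open>\<alpha>\<close> only acts on that fraction. Comparing \<open>p\<close> with the
  solution that has the same boundary values gives \<open>\<bar>lam k - k\<bar> \<le> K * k * \<alpha> ^ (2 * k + 1)\<close>
  (lemma \<open>DN_eigenvalue_close\<close>). Since \<open>j! * Gamma (j + 5/2) * 4 ^ j\<close> is at least a constant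
  times \<open>(2 * j)!\<close>, the series of the Born approximation is \<open>f \<bar>\<xi>\<bar>\<close> for an even entire function
  \<open>f r = (\<Sum>j. a j * r ^ (2 * j))\<close> with \<open>\<bar>a j\<bar> \<le> A * \<alpha> ^ (2 * j) / (2 * j)!\<close>, that is, of
  exponential type \<open>\<alpha>\<close>.

  It remains to prove a Paley--Wiener--Schwartz theorem for radial functions. Suppose first
  that \<open>f\<close> grows at most polynomially on the real line. At a point \<open>x \<noteq> 0\<close> the inverse Fourier
  transform of \<open>f \<bar>\<xi>\<bar> * exp (- \<epsilon> * \<bar>\<xi>\<bar>)\<close> is a constant times \<open>Im (L (\<epsilon> - \<i> * \<bar>x\<bar>)) / \<bar>x\<bar>\<close>, where
  \<open>L\<close> is the Laplace transform of \<open>r * f r\<close>. Integration term by term shows that, for real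
  \<open>z > \<alpha>\<close>, \<open>L z\<close> equals the Borel transform \<open>B z = (\<Sum>j. (2 * j + 1)! * a j / z ^ (2 * j + 2))\<close>,
  and by the identity theorem this persists on the part of the right half plane with \<open>\<bar>z\<bar> > \<alpha>\<close>.
  But \<open>B\<close> is holomorphic on all of \<open>\<bar>z\<bar> > \<alpha>\<close> and has only even powers with real coefficients, so
  it is real on the imaginary axis: letting \<open>\<epsilon>\<close> tend to \<open>0\<close>, the transform vanishes at every \<open>x\<close>
  with \<open>\<bar>x\<bar> > \<alpha>\<close> (lemma \<open>paley_wiener_radial\<close>).

  That \<open>f\<close> defines a tempered distribution \<open>T\<close> bounds only averages of \<open>f\<close>. So \<open>f\<close> is
  averaged over dilations, to \<open>\<integral> W y * f (r * \<bar>y\<bar>) dy\<close> with a bump \<open>W\<close> on the shell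
  \<open>1 \<le> \<bar>y\<bar> \<le> b\<close>. The average is again an even series, of type \<open>\<alpha> * b\<close>; it does grow
  polynomially, since its value at \<open>r\<close> is, up to the factor \<open>r\<^sup>3\<close>, the value of \<open>T\<close> on a dilated
  copy of \<open>W\<close>; and it differs from \<open>T\<close> by \<open>O(b - 1)\<close>, by continuity of dilations on Schwartz
  space. Letting \<open>b\<close> tend to \<open>1\<close> gives the claim on the support (lemma
  \<open>series_distribution_support\<close>). Temperedness of the inverse transform is the continuity of the
  inverse Fourier transform on Schwartz space (lemma \<open>schwartz_op_inverse_fourier\<close>).\<close>

section \<open>Calculus of smooth functions\<close>

lemma partial_deriv_eq:
  "(f has_derivative f') (at x) \<Longrightarrow> partial_deriv i f x = f' (axis i 1)"
  unfolding partial_deriv_def using frechet_derivative_at by metis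

lemma has_derivative_partial_deriv:
  fixes f :: "real^3 \<Rightarrow> 'b::real_normed_vector"
  assumes "f differentiable (at x)"
  shows "(f has_derivative (\<lambda>h. \<Sum>i\<in>UNIV. (h $ i) *\<^sub>R partial_deriv i f x)) (at x)"
proof -
  let ?D = "frechet_derivative f (at x)"
  have D: "(f has_derivative ?D) (at x)" using assms by (simp add: frechet_derivative_works)
  then interpret D: bounded_linear ?D by (rule has_derivative_bounded_linear)
  have "?D h = (\<Sum>i\<in>UNIV. (h $ i) *\<^sub>R partial_deriv i f x)" for h
  proof -
    have "h = (\<Sum>i\<in>UNIV. (h $ i) *\<^sub>R axis i 1)"
      by (simp add: basis_expansion scalar_mult_eq_scaleR[symmetric])
    then have "?D h = ?D (\<Sum>i\<in>UNIV. (h $ i) *\<^sub>R axis i 1)" by simp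
    then show ?thesis unfolding partial_deriv_def by (simp add: D.sum D.scaleR)
  qed
  then show ?thesis using D by presburger
qed

lemma partial_derivs_append: "partial_derivs (ks @ js) f = partial_derivs ks (partial_derivs js f)"
  by (induction ks) auto

lemma smooth_differentiable: "smooth f \<Longrightarrow> f differentiable (at x)"
  unfolding smooth_def by (metis partial_derivs.simps(1))

lemma smooth_partial_derivs: "smooth f \<Longrightarrow> smooth (partial_derivs js f)"
  unfolding smooth_def by (metis partial_derivs_append)

lemma smooth_partial_deriv: "smooth f \<Longrightarrow> smooth (partial_deriv i f)"
  using smooth_partial_derivs[of f "[i]"] by simp

lemma smooth_has_derivative:
  "smooth f \<Longrightarrow> (f has_derivative (\<lambda>h. \<Sum>i\<in>UNIV. (h $ i) *\<^sub>R partial_deriv i f x)) (at x)"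
  by (simp add: smooth_differentiable has_derivative_partial_deriv)

lemma smooth_continuous_on: "smooth f \<Longrightarrow> continuous_on S f"
  by (meson differentiable_imp_continuous_on differentiable_at_withinI differentiable_on_def smooth_differentiable)

text \<open>Smoothness is the greatest property that implies differentiability and passes to partial
  derivatives. Exhibiting a class of functions with these two closure properties replaces
  explicit formulas for the iterated derivatives.\<close>

lemma smooth_coinduct:
  assumes "f \<in> S" "\<And>f x. f \<in> S \<Longrightarrow> f differentiable (at x)"
    "\<And>f i. f \<in> S \<Longrightarrow> partial_deriv i f \<in> S"
  shows "smooth f"
proof -
  have "partial_derivs js f \<in> S" for js by (induction js) (auto simp: assms)
  then show ?thesis unfolding smooth_def using assms(2) by blast
qed

lemma smooth_const: "smooth (\<lambda>x. c)"
proof (rule smooth_coinduct[where S="range (\<lambda>c x. c)"])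
  fix f :: "real^3 \<Rightarrow> 'a" and i assume "f \<in> range (\<lambda>c x. c)"
  then obtain d where "f = (\<lambda>x. d)" by auto
  then have "partial_deriv i f = (\<lambda>x. 0)" by (intro ext partial_deriv_eq[THEN trans]) auto
  then show "partial_deriv i f \<in> range (\<lambda>c x. c)" by auto
qed auto

lemma partial_deriv_linear:
  assumes "bounded_linear f" shows "partial_deriv i f = (\<lambda>x. f (axis i 1))"
  by (intro ext partial_deriv_eq bounded_linear_imp_has_derivative assms)

lemma smooth_linear: assumes "bounded_linear f" shows "smooth f"
proof (rule smooth_coinduct[where S="insert f (range (\<lambda>c x. c))"])
  fix g :: "real^3 \<Rightarrow> 'a" and i assume "g \<in> insert f (range (\<lambda>c x. c))"
  then show "partial_deriv i g \<in> insert f (range (\<lambda>c x. c))"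
  proof
    assume "g = f" then show ?thesis using partial_deriv_linear[OF assms] by auto
  next
    assume "g \<in> range (\<lambda>c x. c)"
    then obtain d where "g = (\<lambda>x. d)" by auto
    then have "partial_deriv i g = (\<lambda>x. 0)" by (intro ext partial_deriv_eq[THEN trans]) auto
    then show ?thesis by auto
  qed
next
  fix g :: "real^3 \<Rightarrow> 'a" and x assume "g \<in> insert f (range (\<lambda>c x. c))"
  then show "g differentiable at x" using assms
    by (auto simp: bounded_linear_imp_differentiable)
qed auto

lemma partial_deriv_add:
  assumes "f differentiable (at x)" "g differentiable (at x)"
  shows "partial_deriv i (\<lambda>x. f x + g x) x = partial_deriv i f x + partial_deriv i g x"
  by (rule partial_deriv_eq[OF has_derivative_add, THEN trans, OF has_derivative_partial_deriv has_derivative_partial_deriv])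
    (use assms in \<open>auto simp: axis_def if_distrib[of "\<lambda>x. x *\<^sub>R _"] sum.delta cong: if_cong\<close>)

lemma partial_derivs_add:
  assumes "smooth f" "smooth g"
  shows "partial_derivs js (\<lambda>x. f x + g x) = (\<lambda>x. partial_derivs js f x + partial_derivs js g x)"
proof (induction js)
  case (Cons j js)
  then show ?case using assms
    by (auto intro!: ext partial_deriv_add smooth_differentiable smooth_partial_derivs)
qed simp

lemma smooth_add: assumes "smooth f" "smooth g" shows "smooth (\<lambda>x. f x + g x)"
  unfolding smooth_def partial_derivs_add[OF assms] using assms
  by (intro allI differentiable_add smooth_differentiable smooth_partial_derivs)

lemma partial_deriv_compose_linear:
  assumes "bounded_linear L" "f differentiable (at x)"
  shows "partial_deriv i (\<lambda>x. L (f x)) x = L (partial_deriv i f x)"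
proof -
  interpret L: bounded_linear L by fact
  have "(f has_derivative frechet_derivative f (at x)) (at x)"
    using assms by (simp add: frechet_derivative_works)
  from partial_deriv_eq[OF L.has_derivative[OF this]] show ?thesis
    by (simp add: partial_deriv_def)
qed

lemma (in bounded_linear) differentiable:
  assumes "g differentiable F" shows "(\<lambda>x. f (g x)) differentiable F"
proof -
  obtain D where "(g has_derivative D) F" using assms unfolding differentiable_def by auto
  from has_derivative[OF this] show ?thesis unfolding differentiable_def by blast
qed

lemma partial_derivs_compose_linear:
  assumes "bounded_linear L" "smooth f"
  shows "partial_derivs js (\<lambda>x. L (f x)) = (\<lambda>x. L (partial_derivs js f x))"
proof (induction js)
  case (Cons j js)
  then show ?case using assms
    by (auto intro!: ext partial_deriv_compose_linear smooth_differentiable smooth_partial_derivs)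
qed simp

lemma smooth_compose_linear: assumes "bounded_linear L" "smooth f" shows "smooth (\<lambda>x. L (f x))"
  unfolding smooth_def partial_derivs_compose_linear[OF assms] using assms
  by (intro allI bounded_linear.differentiable[OF assms(1)] smooth_differentiable[OF smooth_partial_derivs])

lemma partial_deriv_mult:
  fixes f g :: "real^3 \<Rightarrow> 'a::real_normed_algebra"
  assumes "f differentiable (at x)" "g differentiable (at x)"
  shows "partial_deriv i (\<lambda>x. f x * g x) x = partial_deriv i f x * g x + f x * partial_deriv i g x"
proof -
  have "(f has_derivative frechet_derivative f (at x)) (at x)"
    "(g has_derivative frechet_derivative g (at x)) (at x)"
    using assms by (simp_all add: frechet_derivative_works)
  from partial_deriv_eq[OF has_derivative_mult[OF this]] show ?thesis
    by (simp add: partial_deriv_def add.commute)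
qed

text \<open>The terms of the Leibniz rule: each derivative of a product falls on one factor or the
  other, so a list of \<open>n\<close> derivatives gives \<open>2 ^ n\<close> terms, with repetitions instead of binomial
  coefficients.\<close>

fun list_splits :: "'a list \<Rightarrow> ('a list \<times> 'a list) list" where
  "list_splits [] = [([], [])]"
| "list_splits (j # js) = map (\<lambda>(a, b). (j # a, b)) (list_splits js) @ map (\<lambda>(a, b). (a, j # b)) (list_splits js)"

lemma list_splits_length: "(a, b) \<in> set (list_splits js) \<Longrightarrow> length a + length b = length js"
  by (induction js arbitrary: a b) auto

lemma partial_deriv_sum_list:
  assumes "\<And>y. y \<in> set ys \<Longrightarrow> F y differentiable (at x)"
  shows "partial_deriv i (\<lambda>x. \<Sum>y\<leftarrow>ys. F y x) x = (\<Sum>y\<leftarrow>ys. partial_deriv i (F y) x) \<and>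
    (\<lambda>x. \<Sum>y\<leftarrow>ys. F y x) differentiable (at x)"
  using assms
proof (induction ys)
  case Nil
  have "partial_deriv i (\<lambda>x. 0) x = 0" by (intro partial_deriv_eq[THEN trans]) auto
  then show ?case by simp
next
  case (Cons y ys)
  then show ?case by (simp add: partial_deriv_add)
qed

lemma partial_derivs_mult:
  fixes f g :: "real^3 \<Rightarrow> 'a::real_normed_algebra"
  assumes "smooth f" "smooth g"
  shows "partial_derivs js (\<lambda>x. f x * g x) =
    (\<lambda>x. \<Sum>(a, b)\<leftarrow>list_splits js. partial_derivs a f x * partial_derivs b g x)"
proof (induction js)
  case (Cons j js)
  let ?F = "\<lambda>y x. partial_derivs (fst y) f x * partial_derivs (snd y) g x"
  have df: "?F y differentiable (at x)" for y x
    by (intro differentiable_mult smooth_differentiable smooth_partial_derivs assms)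
  have "partial_derivs (j # js) (\<lambda>x. f x * g x) x = (\<Sum>y\<leftarrow>list_splits (j # js). ?F y x)" for x
  proof -
    have "partial_derivs (j # js) (\<lambda>x. f x * g x) x = (\<Sum>y\<leftarrow>list_splits js. partial_deriv j (?F y) x)"
      using partial_deriv_sum_list[of "list_splits js" ?F x j] df Cons by (simp add: case_prod_unfold)
    also have "\<dots> = (\<Sum>y\<leftarrow>list_splits js. ?F (j # fst y, snd y) x + ?F (fst y, j # snd y) x)"
      by (simp add: partial_deriv_mult assms smooth_differentiable smooth_partial_derivs)
    also have "\<dots> = (\<Sum>y\<leftarrow>list_splits (j # js). ?F y x)"
      by (simp add: sum_list_addf case_prod_unfold comp_def)
    finally show ?thesis .
  qed
  then show ?case by (auto simp: case_prod_unfold)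
qed simp

lemma smooth_mult:
  fixes f g :: "real^3 \<Rightarrow> 'a::real_normed_algebra"
  assumes "smooth f" "smooth g" shows "smooth (\<lambda>x. f x * g x)"
  unfolding smooth_def
proof (intro allI)
  fix js x
  show "partial_derivs js (\<lambda>x. f x * g x) differentiable at x"
    unfolding partial_derivs_mult[OF assms] case_prod_unfold
    by (rule partial_deriv_sum_list[THEN conjunct2])
      (intro differentiable_mult smooth_differentiable smooth_partial_derivs assms)
qed

lemma smooth_cmult: "smooth f \<Longrightarrow> smooth (\<lambda>x. (c::'a::real_normed_algebra) * f x)"
  by (rule smooth_mult[OF smooth_const])

lemma smooth_of_real: "smooth f \<Longrightarrow> smooth (\<lambda>x. complex_of_real (f x))"
  by (rule smooth_compose_linear[OF bounded_linear_of_real])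

lemma smooth_minus: "smooth f \<Longrightarrow> smooth (\<lambda>x. - f x)"
  by (rule smooth_compose_linear[OF bounded_linear_minus[OF bounded_linear_ident]])

lemma smooth_diff: "smooth f \<Longrightarrow> smooth g \<Longrightarrow> smooth (\<lambda>x. f x - g x)"
  using smooth_add[OF _ smooth_minus, of f g] by simp

lemma partial_derivs_minus: "smooth f \<Longrightarrow> partial_derivs js (\<lambda>x. - f x) = (\<lambda>x. - partial_derivs js f x)"
  by (rule partial_derivs_compose_linear[OF bounded_linear_minus[OF bounded_linear_ident]])

lemma partial_derivs_diff:
  "smooth f \<Longrightarrow> smooth g \<Longrightarrow>
   partial_derivs js (\<lambda>x. f x - g x) = (\<lambda>x. partial_derivs js f x - partial_derivs js g x)"
  using partial_derivs_add[OF _ smooth_minus, of f g js] by (simp add: partial_derivs_minus)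

lemma partial_derivs_cmult:
  fixes c :: "'a::real_normed_algebra"
  shows "smooth f \<Longrightarrow> partial_derivs js (\<lambda>x. c * f x) = (\<lambda>x. c * partial_derivs js f x)"
  by (rule partial_derivs_compose_linear[OF bounded_linear_mult_right])

lemma partial_derivs_of_real:
  "smooth f \<Longrightarrow> partial_derivs js (\<lambda>x. complex_of_real (f x)) = (\<lambda>x. complex_of_real (partial_derivs js f x))"
  by (rule partial_derivs_compose_linear[OF bounded_linear_of_real])

lemma smooth_component: "smooth (\<lambda>x::real^3. x $ i)"
  by (intro smooth_linear bounded_linear_vec_nth)

lemma smooth_norm_sq: "smooth (\<lambda>x::real^3. (norm x)\<^sup>2)"
  unfolding power2_norm_eq_inner inner_vec_def sum_3 inner_real_def
  by (intro smooth_add smooth_mult smooth_component)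

lemma partial_deriv_scale:
  assumes "f differentiable (at (c *\<^sub>R x))"
  shows "partial_deriv i (\<lambda>x. f (c *\<^sub>R x)) x = c *\<^sub>R partial_deriv i f (c *\<^sub>R x)"
proof -
  interpret D: bounded_linear "frechet_derivative f (at (c *\<^sub>R x))"
    by (rule has_derivative_bounded_linear) (use assms in \<open>simp add: frechet_derivative_works\<close>)
  have "(f has_derivative frechet_derivative f (at (c *\<^sub>R x))) (at (c *\<^sub>R x))"
    using assms by (simp add: frechet_derivative_works)
  then have "((\<lambda>x. f (c *\<^sub>R x)) has_derivative (\<lambda>h. frechet_derivative f (at (c *\<^sub>R x)) (c *\<^sub>R h))) (at x)"
    by (rule has_derivative_compose[rotated, where f="\<lambda>x. c *\<^sub>R x", unfolded o_def])
      (auto intro!: derivative_eq_intros)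
  from partial_deriv_eq[OF this] show ?thesis
    by (simp add: partial_deriv_def D.scaleR)
qed

lemma partial_derivs_scale:
  assumes "smooth f"
  shows "partial_derivs js (\<lambda>x. f (c *\<^sub>R x)) = (\<lambda>x. c ^ length js *\<^sub>R partial_derivs js f (c *\<^sub>R x))"
proof (induction js)
  case (Cons j js)
  let ?g = "partial_derivs js f"
  have d: "?g differentiable (at y)" for y by (intro smooth_differentiable smooth_partial_derivs assms)
  have "(\<lambda>x. ?g (c *\<^sub>R x)) differentiable (at x)" for x
    by (rule differentiable_compose[OF d]) (auto intro!: derivative_intros)
  then have "partial_deriv j (\<lambda>x. c ^ length js *\<^sub>R ?g (c *\<^sub>R x)) x =
      c ^ length js *\<^sub>R partial_deriv j (\<lambda>x. ?g (c *\<^sub>R x)) x" for x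
    by (rule partial_deriv_compose_linear[OF bounded_linear_scaleR_right])
  then show ?case using Cons by (auto simp: partial_deriv_scale d mult.commute)
qed simp

lemma smooth_scale: assumes "smooth f" shows "smooth (\<lambda>x. f (c *\<^sub>R x))"
  unfolding smooth_def partial_derivs_scale[OF assms]
proof (intro allI)
  fix js x
  have "(\<lambda>x. partial_derivs js f (c *\<^sub>R x)) differentiable (at x)"
    by (rule differentiable_compose[OF smooth_differentiable[OF smooth_partial_derivs[OF assms]]])
       (auto intro!: derivative_intros)
  then show "(\<lambda>x. c ^ length js *\<^sub>R partial_derivs js f (c *\<^sub>R x)) differentiable at x"
    by (intro derivative_intros)
qed

section \<open>Bump functions and test functions\<close>

text \<open>The derivatives of \<open>exp (- (1 / v))\<close> for \<open>v > 0\<close> are polynomials in \<open>1 / v\<close> times the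
  function itself; allowing for an arbitrary polynomial factor makes the family closed under
  differentiation.\<close>

definition bump :: "real poly \<Rightarrow> real \<Rightarrow> real" where
  "bump P v = (if v > 0 then poly P (1 / v) * exp (- (1 / v)) else 0)"

definition bump_deriv :: "real poly \<Rightarrow> real poly" where
  "bump_deriv P = [:0, 0, 1:] * (P - pderiv P)"

lemma poly_times_exp_tendsto_0: "((\<lambda>y::real. poly P y * exp (- y)) \<longlongrightarrow> 0) at_top"
proof -
  have "((\<lambda>y::real. \<Sum>i\<le>degree P. coeff P i * (y ^ i / exp y)) \<longlongrightarrow> (\<Sum>i\<le>degree P. coeff P i * 0)) at_top"
    by (intro tendsto_intros tendsto_power_div_exp_0)
  then show ?thesis
    by (simp add: poly_altdef sum_distrib_right exp_minus divide_inverse mult.assoc)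
qed

text \<open>At \<open>v = 0\<close> the difference quotient from the right is again of the form polynomial in
  \<open>1 / v\<close> times \<open>exp (- (1 / v))\<close>, which tends to \<open>0\<close>.\<close>

lemma bump_has_derivative: "(bump P has_real_derivative bump (bump_deriv P) v) (at v)"
proof (cases v "0::real" rule: linorder_cases)
  case less
  have "((\<lambda>v. 0) has_real_derivative 0) (at v)" by simp
  then have "(bump P has_real_derivative 0) (at v)"
    by (rule has_field_derivative_transform_within_open[where S="{..<0}"]) (use less in \<open>auto simp: bump_def\<close>)
  then show ?thesis using less by (simp add: bump_def)
next
  case greater
  have "((\<lambda>v. poly P (1 / v) * exp (- (1 / v))) has_real_derivative
      poly (bump_deriv P) (1 / v) * exp (- (1 / v))) (at v)"
    using greater
    by (auto intro!: derivative_eq_intros poly_DERIV[THEN DERIV_chain2]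
        simp: bump_deriv_def field_simps power2_eq_square)
  then have "(bump P has_real_derivative poly (bump_deriv P) (1 / v) * exp (- (1 / v))) (at v)"
    by (rule has_field_derivative_transform_within_open[where S="{0<..}"]) (use greater in \<open>auto simp: bump_def\<close>)
  then show ?thesis using greater by (simp add: bump_def)
next
  case equal
  have "((\<lambda>h. bump P h / h) \<longlongrightarrow> 0) (at_left 0)"
    by (rule Lim_transform_eventually[OF tendsto_const])
       (auto simp: bump_def eventually_at_filter intro!: always_eventually)
  moreover have "((\<lambda>h. bump P h / h) \<longlongrightarrow> 0) (at_right 0)"
  proof (rule Lim_transform_eventually)
    show "((\<lambda>h::real. poly ([:0, 1:] * P) (inverse h) * exp (- inverse h)) \<longlongrightarrow> 0) (at_right 0)"
      by (rule filterlim_compose[OF poly_times_exp_tendsto_0 filterlim_inverse_at_top_right])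
    show "\<forall>\<^sub>F h in at_right 0. poly ([:0, 1:] * P) (inverse h) * exp (- inverse h) = bump P h / h"
      by (rule eventually_mono[OF eventually_at_right_less]) (auto simp: bump_def field_simps)
  qed
  ultimately have "((\<lambda>h. bump P h / h) \<longlongrightarrow> 0) (at 0)"
    by (simp add: filterlim_split_at)
  then show ?thesis using equal by (simp add: has_field_derivative_iff bump_def)
qed

lemma bump_nonneg: "0 \<le> bump 1 v" and bump_pos: "0 < v \<Longrightarrow> 0 < bump 1 v"
  and bump_zero: "v \<le> 0 \<Longrightarrow> bump P v = 0"
  by (auto simp: bump_def)

text \<open>A class to which coinduction on smoothness applies: it contains \<open>bump P (q x)\<close> and is
  closed under partial derivatives by the chain and product rules.\<close>

inductive_set bump_span :: "(real^3 \<Rightarrow> real) \<Rightarrow> (real^3 \<Rightarrow> real) set" for q where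
  prod: "smooth g \<Longrightarrow> (\<lambda>x. g x * bump P (q x)) \<in> bump_span q"
| add: "f \<in> bump_span q \<Longrightarrow> g \<in> bump_span q \<Longrightarrow> (\<lambda>x. f x + g x) \<in> bump_span q"

lemma bump_span_deriv:
  assumes q: "smooth q" and "f \<in> bump_span q"
  shows "(\<forall>x. f differentiable (at x)) \<and> partial_deriv i f \<in> bump_span q"
  using assms(2)
proof induction
  case (prod g P)
  have b: "((\<lambda>x. bump P (q x)) has_derivative
      (\<lambda>h. bump (bump_deriv P) (q x) * frechet_derivative q (at x) h)) (at x)" for x
  proof -
    have "(q has_derivative frechet_derivative q (at x)) (at x)"
      using smooth_differentiable[OF q] by (simp add: frechet_derivative_works)
    from has_derivative_compose[OF this bump_has_derivative[unfolded has_field_derivative_def]]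
    show ?thesis .
  qed
  then have bd: "(\<lambda>x. bump P (q x)) differentiable (at x)" for x
    unfolding differentiable_def by blast
  have "partial_deriv i (\<lambda>x. g x * bump P (q x)) x =
    partial_deriv i g x * bump P (q x) + (g x * partial_deriv i q x) * bump (bump_deriv P) (q x)" for x
    using partial_deriv_eq[OF b] partial_deriv_mult[OF smooth_differentiable[OF prod] bd]
    by (simp add: partial_deriv_def)
  then have "partial_deriv i (\<lambda>x. g x * bump P (q x)) =
    (\<lambda>x. partial_deriv i g x * bump P (q x) + (g x * partial_deriv i q x) * bump (bump_deriv P) (q x))"
    by auto
  moreover have "(\<lambda>x. g x * bump P (q x)) differentiable (at x)" for x
    by (intro differentiable_mult smooth_differentiable[OF prod] bd)
  ultimately show ?case using prod q
    by (auto intro!: bump_span.intros smooth_mult smooth_partial_deriv)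
next
  case (add f g)
  then have "partial_deriv i (\<lambda>x. f x + g x) = (\<lambda>x. partial_deriv i f x + partial_deriv i g x)"
    by (auto intro!: ext partial_deriv_add)
  with add show ?case by (auto intro: bump_span.intros)
qed

lemma smooth_bump: assumes "smooth q" shows "smooth (\<lambda>x. bump P (q x))"
proof (rule smooth_coinduct[where S="bump_span q"])
  show "(\<lambda>x. bump P (q x)) \<in> bump_span q"
    using bump_span.prod[OF smooth_const[of 1]] by simp
qed (use bump_span_deriv[OF assms] in blast)+

lemma partial_derivs_zero_outside:
  assumes "closed K" "\<And>x. x \<notin> K \<Longrightarrow> f x = 0" "x \<notin> K"
  shows "partial_derivs js f x = 0"
  using assms(3)
proof (induction js arbitrary: x)
  case (Cons j js)
  have "((\<lambda>x. 0) has_derivative (\<lambda>h. 0)) (at x)" by simp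
  then have "(partial_derivs js f has_derivative (\<lambda>h. 0)) (at x)"
    by (rule has_derivative_transform_within_open[where s="- K"]) (use assms Cons in auto)
  then show ?case using partial_deriv_eq by fastforce
qed (use assms in auto)

lemma test_functionI:
  "smooth \<phi> \<Longrightarrow> compact K \<Longrightarrow> K \<subseteq> S \<Longrightarrow> (\<And>x. x \<notin> K \<Longrightarrow> \<phi> x = 0) \<Longrightarrow> test_function S \<phi>"
proof -
  assume a: "smooth \<phi>" "compact K" "K \<subseteq> S" "\<And>x. x \<notin> K \<Longrightarrow> \<phi> x = 0"
  then have "closure {x. \<phi> x \<noteq> 0} \<subseteq> K"
    by (intro closure_minimal) (auto intro: compact_imp_closed)
  moreover from this a have "compact (closure {x. \<phi> x \<noteq> 0})"
    using compact_closure bounded_subset closure_subset compact_imp_bounded by (meson order_trans)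
  ultimately show ?thesis using a by (auto simp: test_function_def)
qed

lemma test_function_support:
  assumes "test_function S \<phi>"
  obtains K where "compact K" "K \<subseteq> S" "\<And>x. x \<notin> K \<Longrightarrow> \<phi> x = 0"
  using assms closure_subset[of "{x. \<phi> x \<noteq> 0}"] unfolding test_function_def by blast

lemma partial_derivs_const: "partial_derivs js (\<lambda>x. c) = (\<lambda>x. if js = [] then c else 0)"
proof (induction js)
  case (Cons j js)
  have "partial_deriv j (\<lambda>x::real^3. d) = (\<lambda>x. 0)" for d :: 'a
    by (intro ext partial_deriv_eq[THEN trans]) auto
  with Cons show ?case by simp
qed simp

section \<open>Schwartz functions and tempered distributions\<close>

text \<open>The weights \<open>(1 + norm x) ^ m\<close>, unlike \<open>norm x ^ m\<close>, increase with \<open>m\<close>.\<close>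

lemma schwartz_iff: "schwartz \<phi> \<longleftrightarrow>
  smooth \<phi> \<and> (\<forall>m js. \<exists>K. \<forall>x. (1 + norm x) ^ m * norm (partial_derivs js \<phi> x) \<le> K)" (is "_ \<longleftrightarrow> _ \<and> ?R")
proof
  assume L: "schwartz \<phi>"
  have "\<exists>K. \<forall>x. (1 + norm x) ^ m * norm (partial_derivs js \<phi> x) \<le> K" for m js
  proof -
    from L have "bounded (range (\<lambda>x. norm x ^ m *\<^sub>R partial_derivs js \<phi> x))"
        "bounded (range (\<lambda>x. norm x ^ 0 *\<^sub>R partial_derivs js \<phi> x))"
      unfolding schwartz_def by blast+
    then obtain A B where A: "\<And>x. norm x ^ m * norm (partial_derivs js \<phi> x) \<le> A"
        and B: "\<And>x. norm (partial_derivs js \<phi> x) \<le> B"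
      by (auto simp: bounded_iff)
    have "(1 + norm x) ^ m * norm (partial_derivs js \<phi> x) \<le> 2 ^ m * (A + B)" for x
    proof -
      have "(1 + norm x) ^ m \<le> (2 * max 1 (norm x)) ^ m" by (intro power_mono) auto
      also have "\<dots> \<le> 2 ^ m * (norm x ^ m + 1)"
        by (auto simp: power_mult_distrib max_def)
      finally have "(1 + norm x) ^ m * norm (partial_derivs js \<phi> x) \<le>
          2 ^ m * (norm x ^ m + 1) * norm (partial_derivs js \<phi> x)"
        by (intro mult_right_mono) auto
      also have "\<dots> = 2 ^ m * (norm x ^ m * norm (partial_derivs js \<phi> x) + norm (partial_derivs js \<phi> x))"
        by (simp add: algebra_simps)
      also have "\<dots> \<le> 2 ^ m * (A + B)"
        using A[of x] B[of x] by (intro mult_left_mono add_mono) auto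
      finally show ?thesis .
    qed
    then show ?thesis by blast
  qed
  then show "smooth \<phi> \<and> ?R" using L by (auto simp: schwartz_def)
next
  assume R: "smooth \<phi> \<and> ?R"
  have "bounded (range (\<lambda>x. norm x ^ m *\<^sub>R partial_derivs js \<phi> x))" for m js
  proof -
    from R obtain K where K: "\<And>x. (1 + norm x) ^ m * norm (partial_derivs js \<phi> x) \<le> K" by blast
    have "norm x ^ m * norm (partial_derivs js \<phi> x) \<le> K" for x
      by (rule order_trans[OF mult_right_mono[OF power_mono] K]) auto
    then show ?thesis by (auto simp: bounded_iff)
  qed
  with R show "schwartz \<phi>" by (auto simp: schwartz_def)
qed

lemma schwartz_smooth: "schwartz \<phi> \<Longrightarrow> smooth \<phi>"
  by (simp add: schwartz_def)

lemma finite_multi_indices: "finite {js::3 list. length js \<le> N}"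
  using finite_lists_length_le[of "UNIV::3 set" N] by simp

text \<open>The supremum in a Schwartz norm is taken over a bounded set because there are only
  finitely many multi-indices up to a given order; without this it would be an arbitrary default
  value.\<close>

lemma schwartz_norm_upper:
  assumes "schwartz \<phi>" "length js \<le> N"
  shows "(1 + norm x) ^ N * norm (partial_derivs js \<phi> x) \<le> schwartz_norm N \<phi>"
proof -
  have "\<forall>js. \<exists>K. \<forall>x. (1 + norm x) ^ N * norm (partial_derivs js \<phi> x) \<le> K"
    using assms(1) schwartz_iff by blast
  then obtain K where K: "\<And>js x. (1 + norm x) ^ N * norm (partial_derivs js \<phi> x) \<le> K js" by metis
  have "bdd_above ((\<lambda>(js, x). (1 + norm x) ^ N * norm (partial_derivs js \<phi> x)) ` ({js. length js \<le> N} \<times> UNIV))"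
  proof (rule bdd_aboveI2[where M="\<Sum>js\<in>{js. length js \<le> N}. \<bar>K js\<bar>"], clarsimp)
    fix js :: "3 list" and x :: "real^3" assume "length js \<le> N"
    then have "\<bar>K js\<bar> \<le> (\<Sum>js\<in>{js. length js \<le> N}. \<bar>K js\<bar>)"
      by (intro member_le_sum) (auto simp: finite_multi_indices)
    with K[of x js] show "(1 + norm x) ^ N * norm (partial_derivs js \<phi> x) \<le> (\<Sum>js\<in>{js. length js \<le> N}. \<bar>K js\<bar>)"
      by linarith
  qed
  from cSUP_upper[OF _ this, of "(js, x)"] assms(2) show ?thesis
    unfolding schwartz_norm_def by auto
qed

lemma schwartz_norm_le:
  assumes "\<And>js x. length js \<le> N \<Longrightarrow> (1 + norm x) ^ N * norm (partial_derivs js \<phi> x) \<le> K"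
  shows "schwartz_norm N \<phi> \<le> K"
  unfolding schwartz_norm_def
proof (rule cSUP_least)
  show "{js::3 list. length js \<le> N} \<times> (UNIV::(real^3) set) \<noteq> {}"
    by (auto intro: exI[of _ "[]"])
qed (use assms in auto)

lemma schwartz_norm_nonneg: "schwartz \<phi> \<Longrightarrow> 0 \<le> schwartz_norm N \<phi>"
  by (rule order_trans[OF _ schwartz_norm_upper[of \<phi> "[]" N 0]]) auto

lemma schwartzI:
  assumes "smooth \<phi>" "\<And>N. \<exists>K. \<forall>js x. length js \<le> N \<longrightarrow> (1 + norm x) ^ N * norm (partial_derivs js \<phi> x) \<le> K"
  shows "schwartz \<phi>"
  unfolding schwartz_iff
proof (intro conjI allI assms)
  fix m and js :: "3 list"
  from assms(2)[of "max m (length js)"] obtain K where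
    K: "\<And>x. (1 + norm x) ^ max m (length js) * norm (partial_derivs js \<phi> x) \<le> K" by (meson max.cobounded2[of "length js" m])
  have "(1 + norm x) ^ m * norm (partial_derivs js \<phi> x) \<le> K" for x
    by (rule order_trans[OF mult_right_mono[OF power_increasing] K]) auto
  then show "\<exists>K. \<forall>x. (1 + norm x) ^ m * norm (partial_derivs js \<phi> x) \<le> K" by blast
qed

lemma schwartz_add:
  assumes "schwartz \<phi>" "schwartz \<psi>" shows "schwartz (\<lambda>x. \<phi> x + \<psi> x)"
proof (rule schwartzI)
  show "smooth (\<lambda>x. \<phi> x + \<psi> x)" using assms by (simp add: smooth_add schwartz_smooth)
  fix N
  have "(1 + norm x) ^ N * norm (partial_derivs js (\<lambda>x. \<phi> x + \<psi> x) x) \<le> schwartz_norm N \<phi> + schwartz_norm N \<psi>"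
    if "length js \<le> N" for js x
  proof -
    have "(1 + norm x) ^ N * norm (partial_derivs js (\<lambda>x. \<phi> x + \<psi> x) x) \<le>
       (1 + norm x) ^ N * (norm (partial_derivs js \<phi> x) + norm (partial_derivs js \<psi> x))"
      using assms by (intro mult_left_mono) (auto simp: partial_derivs_add schwartz_smooth norm_triangle_ineq)
    with schwartz_norm_upper[OF assms(1) that, of x] schwartz_norm_upper[OF assms(2) that, of x]
    show ?thesis by (simp add: algebra_simps)
  qed
  then show "\<exists>K. \<forall>js x. length js \<le> N \<longrightarrow> (1 + norm x) ^ N * norm (partial_derivs js (\<lambda>x. \<phi> x + \<psi> x) x) \<le> K"
    by blast
qed

lemma schwartz_cmult:
  assumes "schwartz \<phi>" shows "schwartz (\<lambda>x. c * \<phi> x)"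
proof (rule schwartzI)
  show "smooth (\<lambda>x. c * \<phi> x)" using assms by (simp add: smooth_cmult schwartz_smooth)
  fix N
  have "(1 + norm x) ^ N * norm (partial_derivs js (\<lambda>x. c * \<phi> x) x) \<le> norm c * schwartz_norm N \<phi>"
    if "length js \<le> N" for js x
    using mult_left_mono[OF schwartz_norm_upper[OF assms that, of x], of "norm c"] assms
    by (simp add: partial_derivs_cmult schwartz_smooth norm_mult mult_ac)
  then show "\<exists>K. \<forall>js x. length js \<le> N \<longrightarrow> (1 + norm x) ^ N * norm (partial_derivs js (\<lambda>x. c * \<phi> x) x) \<le> K"
    by blast
qed

lemma schwartz_diff: "schwartz \<phi> \<Longrightarrow> schwartz \<psi> \<Longrightarrow> schwartz (\<lambda>x. \<phi> x - \<psi> x)"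
  using schwartz_add[OF _ schwartz_cmult, of \<phi> \<psi> "-1"] by simp

lemma schwartz_partial_deriv:
  assumes "schwartz \<phi>" shows "schwartz (partial_deriv i \<phi>)"
    and "schwartz_norm N (partial_deriv i \<phi>) \<le> schwartz_norm (Suc N) \<phi>"
proof -
  have eq: "partial_derivs js (partial_deriv i \<phi>) = partial_derivs (js @ [i]) \<phi>" for js
    by (simp add: partial_derivs_append)
  show "schwartz (partial_deriv i \<phi>)"
    using assms unfolding schwartz_iff eq by (blast intro: smooth_partial_deriv)
  show "schwartz_norm N (partial_deriv i \<phi>) \<le> schwartz_norm (Suc N) \<phi>"
  proof (rule schwartz_norm_le, unfold eq)
    fix js :: "3 list" and x :: "real^3" assume "length js \<le> N"
    then have "(1 + norm x) ^ Suc N * norm (partial_derivs (js @ [i]) \<phi> x) \<le> schwartz_norm (Suc N) \<phi>"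
      by (intro schwartz_norm_upper assms) auto
    moreover have "(1 + norm x) ^ N * norm (partial_derivs (js @ [i]) \<phi> x) \<le>
        (1 + norm x) ^ Suc N * norm (partial_derivs (js @ [i]) \<phi> x)"
      by (intro mult_right_mono power_increasing) auto
    ultimately show "(1 + norm x) ^ N * norm (partial_derivs (js @ [i]) \<phi> x) \<le> schwartz_norm (Suc N) \<phi>"
      by linarith
  qed
qed

lemma norm_sum_list_le: "norm (\<Sum>(a, b)\<leftarrow>ys. F a b) \<le> (\<Sum>(a, b)\<leftarrow>ys. norm (F a b))"
  by (induction ys) (auto intro: order_trans[OF norm_triangle_ineq])

text \<open>Multiplication by a function whose derivatives grow at most linearly costs one order of
  decay. Linear growth covers the coordinates, the characters \<open>cis (x \<bullet> \<xi>)\<close> and the error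
  \<open>\<eta> (c *\<^sub>R x) - 1\<close> of a cutoff, which is \<open>O(c * norm x)\<close>.\<close>

lemma schwartz_mult_bound:
  assumes g: "smooth g" "\<And>a x. length a \<le> N \<Longrightarrow> norm (partial_derivs a g x) \<le> K * (1 + norm x)"
    and "schwartz \<phi>" and "length js \<le> N"
  shows "(1 + norm x) ^ N * norm (partial_derivs js (\<lambda>x. g x * \<phi> x) x) \<le> 2 ^ N * K * schwartz_norm (Suc N) \<phi>"
proof -
  have "norm (partial_derivs [] g 0) \<le> K * (1 + norm (0::real^3))" by (rule g(2)) simp
  then have K: "0 \<le> K" by (auto intro: order_trans[OF norm_ge_zero])
  note n0 = schwartz_norm_nonneg[OF \<open>schwartz \<phi>\<close>, of "Suc N"]
  have len: "length (list_splits js) = 2 ^ length js" by (induction js) auto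
  have "(1 + norm x) ^ N * norm (partial_derivs js (\<lambda>x. g x * \<phi> x) x) \<le>
     (1 + norm x) ^ N * (\<Sum>(a, b)\<leftarrow>list_splits js. norm (partial_derivs a g x * partial_derivs b \<phi> x))"
    unfolding partial_derivs_mult[OF g(1) schwartz_smooth[OF assms(3)]]
    by (intro mult_left_mono norm_sum_list_le) auto
  also have "\<dots> = (\<Sum>(a, b)\<leftarrow>list_splits js. (1 + norm x) ^ N * norm (partial_derivs a g x * partial_derivs b \<phi> x))"
    by (simp add: sum_list_const_mult case_prod_unfold)
  also have "\<dots> \<le> (\<Sum>(a, b)\<leftarrow>list_splits js. K * schwartz_norm (Suc N) \<phi>)"
  proof (rule sum_list_mono, clarify)
    fix a b assume "(a, b) \<in> set (list_splits js)"
    then have ab: "length a \<le> N" "length b \<le> Suc N" using list_splits_length assms(4) by fastforce+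
    have "(1 + norm x) ^ N * norm (partial_derivs a g x * partial_derivs b \<phi> x) \<le>
       (1 + norm x) ^ N * (K * (1 + norm x) * norm (partial_derivs b \<phi> x))"
      unfolding norm_mult by (intro mult_left_mono mult_right_mono g ab) auto
    also have "\<dots> = K * ((1 + norm x) ^ Suc N * norm (partial_derivs b \<phi> x))" by simp
    also have "\<dots> \<le> K * schwartz_norm (Suc N) \<phi>"
      by (intro mult_left_mono schwartz_norm_upper assms ab K)
    finally show "(1 + norm x) ^ N * norm (partial_derivs a g x * partial_derivs b \<phi> x) \<le> K * schwartz_norm (Suc N) \<phi>" .
  qed
  also have "\<dots> = 2 ^ length js * (K * schwartz_norm (Suc N) \<phi>)"
    by (simp add: case_prod_unfold sum_list_triv len)
  also have "\<dots> \<le> 2 ^ N * (K * schwartz_norm (Suc N) \<phi>)"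
    using assms(4) K n0 by (intro mult_right_mono power_increasing) auto
  finally show ?thesis by simp
qed

lemma schwartz_mult:
  assumes "smooth g" "\<And>N. \<exists>K. \<forall>a x. length a \<le> N \<longrightarrow> norm (partial_derivs a g x) \<le> K * (1 + norm x)"
    and "schwartz \<phi>"
  shows "schwartz (\<lambda>x. g x * \<phi> x)"
proof (rule schwartzI)
  show "smooth (\<lambda>x. g x * \<phi> x)" by (intro smooth_mult assms schwartz_smooth)
  fix N
  from assms(2) obtain K where "\<And>a x. length a \<le> N \<Longrightarrow> norm (partial_derivs a g x) \<le> K * (1 + norm x)" by blast
  from schwartz_mult_bound[OF assms(1) this assms(3)]
  show "\<exists>K. \<forall>js x. length js \<le> N \<longrightarrow> (1 + norm x) ^ N * norm (partial_derivs js (\<lambda>x. g x * \<phi> x) x) \<le> K"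
    by blast
qed

lemma component_deriv_bound:
  "norm (partial_derivs a (\<lambda>x. complex_of_real (x $ i)) x) \<le> 1 * (1 + norm x)"
proof (cases a rule: rev_cases)
  case Nil
  then show ?thesis using component_le_norm_cart[of x i] by auto
next
  case (snoc ks j)
  have "bounded_linear (\<lambda>x::real^3. complex_of_real (x $ i))"
    by (rule bounded_linear_compose[OF bounded_linear_of_real bounded_linear_vec_nth])
  from partial_deriv_linear[OF this] snoc show ?thesis
    by (auto simp: partial_derivs_append partial_derivs_const axis_def)
qed

lemma schwartz_component:
  assumes "schwartz \<phi>"
  shows "schwartz (\<lambda>x. complex_of_real (x $ i) * \<phi> x)"
    and "schwartz_norm N (\<lambda>x. complex_of_real (x $ i) * \<phi> x) \<le> 2 ^ N * schwartz_norm (Suc N) \<phi>"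
proof -
  have s: "smooth (\<lambda>x::real^3. complex_of_real (x $ i))" by (intro smooth_of_real smooth_component)
  show "schwartz (\<lambda>x. complex_of_real (x $ i) * \<phi> x)"
    by (rule schwartz_mult[OF s _ assms]) (use component_deriv_bound in blast)
  show "schwartz_norm N (\<lambda>x. complex_of_real (x $ i) * \<phi> x) \<le> 2 ^ N * schwartz_norm (Suc N) \<phi>"
    by (rule schwartz_norm_le) (use schwartz_mult_bound[OF s component_deriv_bound assms] in simp)
qed

text \<open>For \<open>c \<le> 1\<close> the derivatives do not increase, and \<open>1 + norm x \<le> (1 + norm (c *\<^sub>R x)) / c\<close>
  controls the weight.\<close>

lemma schwartz_dilation:
  assumes "schwartz \<phi>" "0 < c" "c \<le> 1"
  shows "schwartz (\<lambda>x. \<phi> (c *\<^sub>R x))"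
    and "schwartz_norm N (\<lambda>x. \<phi> (c *\<^sub>R x)) \<le> (1 / c) ^ N * schwartz_norm N \<phi>"
proof -
  have b: "(1 + norm x) ^ N * norm (partial_derivs js (\<lambda>x. \<phi> (c *\<^sub>R x)) x) \<le> (1 / c) ^ N * schwartz_norm N \<phi>"
    if "length js \<le> N" for js x N
  proof -
    have "(1 + norm x) ^ N \<le> ((1 / c) * (1 + norm (c *\<^sub>R x))) ^ N"
      using assms by (intro power_mono) (auto simp: field_simps)
    moreover have "norm (partial_derivs js (\<lambda>x. \<phi> (c *\<^sub>R x)) x) \<le> norm (partial_derivs js \<phi> (c *\<^sub>R x))"
      using assms by (simp add: partial_derivs_scale schwartz_smooth mult_left_le_one_le power_le_one)
    ultimately have "(1 + norm x) ^ N * norm (partial_derivs js (\<lambda>x. \<phi> (c *\<^sub>R x)) x) \<le>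
       ((1 / c) * (1 + norm (c *\<^sub>R x))) ^ N * norm (partial_derivs js \<phi> (c *\<^sub>R x))"
      using assms by (intro mult_mono) auto
    also have "\<dots> = (1 / c) ^ N * ((1 + norm (c *\<^sub>R x)) ^ N * norm (partial_derivs js \<phi> (c *\<^sub>R x)))"
      by (simp only: power_mult_distrib mult_ac)
    also have "\<dots> \<le> (1 / c) ^ N * schwartz_norm N \<phi>"
      using assms that by (intro mult_left_mono schwartz_norm_upper) auto
    finally show ?thesis .
  qed
  show "schwartz (\<lambda>x. \<phi> (c *\<^sub>R x))"
    by (rule schwartzI) (use assms b in \<open>auto intro: smooth_scale schwartz_smooth\<close>)
  show "schwartz_norm N (\<lambda>x. \<phi> (c *\<^sub>R x)) \<le> (1 / c) ^ N * schwartz_norm N \<phi>"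
    by (rule schwartz_norm_le) (rule b)
qed

lemma compactly_supported_bounded:
  assumes "smooth \<phi>" "compact K" "\<And>x. x \<notin> K \<Longrightarrow> \<phi> x = 0"
  shows "\<exists>B. \<forall>x. norm (partial_derivs js \<phi> x) \<le> B"
proof -
  have "bounded (partial_derivs js \<phi> ` K)"
    by (intro compact_imp_bounded compact_continuous_image smooth_continuous_on smooth_partial_derivs assms)
  then obtain B where B: "B > 0" "\<And>x. x \<in> K \<Longrightarrow> norm (partial_derivs js \<phi> x) \<le> B"
    by (auto simp: bounded_pos)
  have "norm (partial_derivs js \<phi> x) \<le> B" for x
  proof (cases "x \<in> K")
    case False
    then have "partial_derivs js \<phi> x = 0"
      using partial_derivs_zero_outside[of K \<phi> x js] assms compact_imp_closed by blast
    then show ?thesis using B by simp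
  qed (use B in auto)
  then show ?thesis by blast
qed

lemma test_function_schwartz:
  fixes \<phi> :: "real^3 \<Rightarrow> complex"
  assumes "test_function S \<phi>" shows "schwartz \<phi>"
proof -
  obtain K where K: "compact K" "\<And>x. x \<notin> K \<Longrightarrow> \<phi> x = 0" using test_function_support[OF assms] by metis
  obtain R where R: "R > 0" "\<And>x. x \<in> K \<Longrightarrow> norm x \<le> R"
    using compact_imp_bounded[OF K(1)] by (auto simp: bounded_pos)
  have s: "smooth \<phi>" using assms by (simp add: test_function_def)
  have "\<exists>C. \<forall>x. (1 + norm x) ^ m * norm (partial_derivs js \<phi> x) \<le> C" for m js
  proof -
    obtain B where B: "\<And>x. norm (partial_derivs js \<phi> x) \<le> B"
      using compactly_supported_bounded[OF s K] by blast
    then have B0: "0 \<le> B" using norm_ge_zero order_trans by blast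
    have "(1 + norm x) ^ m * norm (partial_derivs js \<phi> x) \<le> (1 + R) ^ m * B" for x
    proof (cases "x \<in> K")
      case True
      then show ?thesis using R B by (intro mult_mono power_mono) auto
    next
      case False
      then show ?thesis
        using partial_derivs_zero_outside[of K \<phi> x js, OF compact_imp_closed[OF K(1)] K(2)] B0 R by auto
    qed
    then show ?thesis by blast
  qed
  then show ?thesis using s by (simp add: schwartz_iff)
qed

text \<open>The constant \<open>3\<close> is the number of partial derivatives that make up the total derivative.\<close>

lemma smooth_mvt:
  assumes "smooth f" "\<And>i z. z \<in> closed_segment x y \<Longrightarrow> norm (partial_deriv i f z) \<le> B"
  shows "norm (f x - f y) \<le> 3 * B * norm (x - y)"
proof (rule differentiable_bound[OF convex_closed_segment[of x y]])
  fix z assume z: "z \<in> closed_segment x y"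
  show "(f has_derivative (\<lambda>h. \<Sum>i\<in>UNIV. (h $ i) *\<^sub>R partial_deriv i f z)) (at z within closed_segment x y)"
    by (rule has_derivative_at_withinI[OF smooth_has_derivative[OF assms(1)]])
  show "onorm (\<lambda>h. \<Sum>i\<in>UNIV. (h $ i) *\<^sub>R partial_deriv i f z) \<le> 3 * B"
  proof (rule onorm_le)
    fix h :: "real^3"
    have "norm (\<Sum>i\<in>UNIV. (h $ i) *\<^sub>R partial_deriv i f z) \<le> (\<Sum>i\<in>(UNIV::3 set). norm h * B)"
      by (rule order_trans[OF norm_sum sum_mono])
         (auto intro!: mult_mono assms(2) z component_le_norm_cart)
    then show "norm (\<Sum>i\<in>UNIV. (h $ i) *\<^sub>R partial_deriv i f z) \<le> 3 * B * norm h" by (simp add: mult_ac)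
  qed
qed auto

lemma exists_cutoff:
  obtains \<eta> :: "real^3 \<Rightarrow> complex" where
    "smooth \<eta>" "\<eta> 0 = 1" "\<And>x. x \<notin> cball 0 1 \<Longrightarrow> \<eta> x = 0"
proof
  let ?q = "\<lambda>x::real^3. 1 - (norm x)\<^sup>2"
  have q: "smooth ?q" by (intro smooth_diff smooth_const smooth_norm_sq)
  show "smooth (\<lambda>x. complex_of_real ((1 / bump 1 1) * bump 1 (?q x)))"
    by (intro smooth_of_real smooth_cmult smooth_bump q)
  show "complex_of_real ((1 / bump 1 1) * bump 1 (?q 0)) = 1"
    using bump_pos[of 1] by simp
  show "complex_of_real ((1 / bump 1 1) * bump 1 (?q x)) = 0" if "x \<notin> cball 0 1" for x
  proof -
    have "1\<^sup>2 \<le> (norm x)\<^sup>2" using that by (intro power_mono) auto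
    then show ?thesis by (simp add: bump_zero)
  qed
qed

text \<open>Compactly supported functions approximate \<open>\<psi>\<close> at a linear rate in \<open>c\<close>: the function
  \<open>\<eta> (c *\<^sub>R x) - 1\<close> is at most a constant times \<open>c * norm x\<close> by the mean value theorem, and each
  of its derivatives carries a factor \<open>c\<close>.\<close>

lemma schwartz_cutoff:
  fixes \<eta> \<psi> :: "real^3 \<Rightarrow> complex"
  assumes chi: "smooth \<eta>" "\<eta> 0 = 1" "\<And>x. x \<notin> cball 0 1 \<Longrightarrow> \<eta> x = 0" and psi: "schwartz \<psi>"
  shows "\<exists>C. \<forall>c. 0 < c \<and> c \<le> 1 \<longrightarrow> schwartz_norm N (\<lambda>x. \<eta> (c *\<^sub>R x) * \<psi> x - \<psi> x) \<le> C * c"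
proof -
  have "\<forall>js. \<exists>B. \<forall>x. norm (partial_derivs js \<eta> x) \<le> B"
    using compactly_supported_bounded[OF chi(1) compact_cball chi(3)] by blast
  then obtain B where B: "\<And>js x. norm (partial_derivs js \<eta> x) \<le> B js" by metis
  define K where "K = (\<Sum>js\<in>{js. length js \<le> N + 1}. \<bar>B js\<bar>)"
  have K: "norm (partial_derivs js \<eta> x) \<le> K" if "length js \<le> N + 1" for js x
  proof -
    have "\<bar>B js\<bar> \<le> K" unfolding K_def using that by (intro member_le_sum finite_multi_indices) auto
    with B[of js x] show ?thesis by linarith
  qed
  have K0: "0 \<le> K" by (simp add: K_def sum_nonneg)
  have "schwartz_norm N (\<lambda>x. \<eta> (c *\<^sub>R x) * \<psi> x - \<psi> x) \<le> (2 ^ N * (3 * K) * schwartz_norm (Suc N) \<psi>) * c"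
    if c: "0 < c" "c \<le> 1" for c
  proof -
    let ?g = "\<lambda>x. \<eta> (c *\<^sub>R x) - 1"
    have g: "smooth ?g" by (intro smooth_diff smooth_const smooth_scale chi)
    have gb: "norm (partial_derivs a ?g x) \<le> (3 * K * c) * (1 + norm x)" if "length a \<le> N" for a x
    proof (cases a)
      case Nil
      have "norm (partial_deriv i \<eta> z) \<le> K" for i z using K[of "[i]" z] by simp
      from smooth_mvt[OF chi(1) this, of "c *\<^sub>R x" 0]
      have "norm (\<eta> (c *\<^sub>R x) - 1) \<le> 3 * K * (c * norm x)" using chi(2) c by simp
      also have "\<dots> = (3 * K * c) * norm x" by simp
      also have "\<dots> \<le> (3 * K * c) * (1 + norm x)" using K0 c by (intro mult_left_mono) auto
      finally show ?thesis using Nil by simp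
    next
      case (Cons j js)
      have "norm (partial_derivs a ?g x) = c ^ length a * norm (partial_derivs a \<eta> (c *\<^sub>R x))"
        using Cons c by (simp add: partial_derivs_diff[OF smooth_scale[OF chi(1)] smooth_const]
            partial_derivs_const partial_derivs_scale[OF chi(1)] del: partial_derivs.simps)
      also have "\<dots> \<le> c * K"
        using power_decreasing[of 1 "length a" c] c that Cons
        by (intro mult_mono K) (auto simp del: partial_derivs.simps)
      also have "\<dots> \<le> (3 * K * c) * (1 + norm x)"
        using K0 c by (simp add: algebra_simps)
      finally show ?thesis .
    qed
    have eq: "(\<lambda>x. \<eta> (c *\<^sub>R x) * \<psi> x - \<psi> x) = (\<lambda>x. ?g x * \<psi> x)" by (simp add: algebra_simps)
    show ?thesis unfolding eq
      by (rule schwartz_norm_le, rule order_trans[OF schwartz_mult_bound[OF g gb psi]]) (auto simp: algebra_simps)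
  qed
  then show ?thesis by blast
qed

text \<open>The factor \<open>c ^ 3\<close> makes \<open>\<psi>\<close> and its dilation have equal integrals, and is the Jacobian
  when a dilation is moved from a function to a test function. Writing \<open>D\<close> for a derivative of
  order \<open>m\<close> of \<open>\<psi>\<close>, that derivative of the difference at \<open>x\<close> is
  \<open>(c ^ (3 + m) - 1) *\<^sub>R D (c *\<^sub>R x)\<close> plus \<open>D (c *\<^sub>R x) - D x\<close>. The first term is estimated by
  Bernoulli's inequality, the second by the mean value theorem on a segment whose points have
  norm at least half of \<open>norm x\<close>, which is where \<open>1/2 \<le> c\<close> enters.\<close>

lemma schwartz_dilation_continuous:
  fixes \<psi> :: "real^3 \<Rightarrow> complex"
  assumes psi: "schwartz \<psi>"
  shows "\<exists>C. \<forall>c. 1/2 \<le> c \<and> c \<le> 1 \<longrightarrow>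
    schwartz_norm N (\<lambda>x. of_real (c ^ 3) * \<psi> (c *\<^sub>R x) - \<psi> x) \<le> C * (1 - c)"
proof -
  define A where "A = schwartz_norm N \<psi>"
  define A' where "A' = schwartz_norm (Suc N) \<psi>"
  have A: "0 \<le> A" "0 \<le> A'" unfolding A_def A'_def using psi by (auto intro: schwartz_norm_nonneg)
  have "schwartz_norm N (\<lambda>x. of_real (c ^ 3) * \<psi> (c *\<^sub>R x) - \<psi> x) \<le>
      (real (N + 3) * 2 ^ N * A + 3 * 2 ^ Suc N * A') * (1 - c)"
    if c: "1/2 \<le> c" "c \<le> 1" for c
  proof (rule schwartz_norm_le)
    fix js :: "3 list" and x :: "real^3" assume len: "length js \<le> N"
    let ?D = "partial_derivs js \<psi>" and ?m = "3 + length js"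
    have s: "smooth \<psi>" using psi by (rule schwartz_smooth)
    have half: "1 + norm x \<le> 2 * (1 + norm (t *\<^sub>R x))" if "1/2 \<le> t" for t
      using that mult_right_mono[of "1/2" t "norm x"] by simp
    have eq: "partial_derivs js (\<lambda>x. of_real (c ^ 3) * \<psi> (c *\<^sub>R x) - \<psi> x) x =
       (c ^ ?m - 1) *\<^sub>R ?D (c *\<^sub>R x) + (?D (c *\<^sub>R x) - ?D x)"
    proof -
      have "partial_derivs js (\<lambda>x. of_real (c ^ 3) * \<psi> (c *\<^sub>R x) - \<psi> x) x =
          of_real (c ^ 3) * (c ^ length js *\<^sub>R ?D (c *\<^sub>R x)) - ?D x"
        by (simp only: partial_derivs_diff[OF smooth_cmult[OF smooth_scale[OF s]] s]
          partial_derivs_cmult[OF smooth_scale[OF s]] partial_derivs_scale[OF s])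
      then show ?thesis
        by (simp add: scaleR_conv_of_real[where 'a=complex] power_add algebra_simps)
    qed
    have "(1 + norm x) ^ N \<le> 2 ^ N * (1 + norm (c *\<^sub>R x)) ^ N"
      unfolding power_mult_distrib[symmetric] by (intro power_mono half c) auto
    then have "(1 + norm x) ^ N * norm (?D (c *\<^sub>R x)) \<le> 2 ^ N * (1 + norm (c *\<^sub>R x)) ^ N * norm (?D (c *\<^sub>R x))"
      by (intro mult_right_mono) auto
    also have "\<dots> \<le> 2 ^ N * A"
      using schwartz_norm_upper[OF psi len, of "c *\<^sub>R x"] by (simp add: A_def mult.assoc)
    finally have 1: "(1 + norm x) ^ N * norm (?D (c *\<^sub>R x)) \<le> 2 ^ N * A" .
    have "1 + real ?m * (c - 1) \<le> (1 + (c - 1)) ^ ?m"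
      by (rule Bernoulli_inequality) (use c in auto)
    then have "1 - c ^ ?m \<le> real ?m * (1 - c)" by (simp add: algebra_simps)
    moreover have "real ?m * (1 - c) \<le> real (N + 3) * (1 - c)"
      using len c by (intro mult_right_mono) auto
    moreover have "c ^ ?m \<le> 1" using c by (intro power_le_one) auto
    ultimately have 2: "\<bar>c ^ ?m - 1\<bar> \<le> real (N + 3) * (1 - c)" by linarith
    have "norm (partial_deriv i ?D z) \<le> 2 ^ Suc N * A' / (1 + norm x) ^ Suc N" if z: "z \<in> closed_segment (c *\<^sub>R x) x" for i z
    proof -
      obtain u where u: "0 \<le> u" "u \<le> 1" "z = (1 - u) *\<^sub>R c *\<^sub>R x + u *\<^sub>R x"
        using z by (auto simp: in_segment)
      define t where "t = (1 - u) * c + u"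
      have zt: "z = t *\<^sub>R x" using u by (simp add: t_def algebra_simps)
      have "(1 - u) * (1/2) \<le> (1 - u) * c" using u c by (intro mult_left_mono) auto
      then have "1/2 \<le> t" using u(1,2) unfolding t_def by argo
      from power_mono[OF half[OF this], of "Suc N"]
      have "(1 + norm x) ^ Suc N * norm (partial_deriv i ?D z) \<le>
         2 ^ Suc N * (1 + norm z) ^ Suc N * norm (partial_deriv i ?D z)"
        unfolding zt by (intro mult_right_mono) (simp_all only: power_mult_distrib norm_ge_zero, simp)
      also have "\<dots> \<le> 2 ^ Suc N * A'"
        using schwartz_norm_upper[OF psi, of "i # js" "Suc N" z] len by (simp add: A'_def mult.assoc)
      finally show ?thesis
        by (subst pos_le_divide_eq) (auto simp: mult.commute add_pos_nonneg simp del: power_Suc)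
    qed
    from smooth_mvt[OF smooth_partial_derivs[OF s, of js] this]
    have "norm (?D (c *\<^sub>R x) - ?D x) \<le> 3 * (2 ^ Suc N * A' / (1 + norm x) ^ Suc N) * norm (c *\<^sub>R x - x)" .
    also have "norm (c *\<^sub>R x - x) = (1 - c) * norm x"
    proof -
      have "c *\<^sub>R x - x = (c - 1) *\<^sub>R x" by (simp add: algebra_simps)
      then show ?thesis using c by simp
    qed
    finally have "(1 + norm x) ^ N * norm (?D (c *\<^sub>R x) - ?D x) \<le>
       (1 + norm x) ^ N * (3 * (2 ^ Suc N * A' / (1 + norm x) ^ Suc N) * ((1 - c) * norm x))"
      by (intro mult_left_mono) auto
    also have "\<dots> = 3 * 2 ^ Suc N * A' * (1 - c) * (norm x / (1 + norm x))"
    proof -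
      have alg: "p * (3 * (k / (y * p)) * (d * n)) = 3 * k * d * (n / y)" if "p \<noteq> 0" "y \<noteq> 0" for p y k d n :: real
        using that by (simp add: field_simps)
      have "1 + norm x \<noteq> 0" by (simp add: add_nonneg_eq_0_iff)
      then show ?thesis unfolding power_Suc[of "1 + norm x"] by (subst alg) (auto simp: mult.assoc)
    qed
    also have "\<dots> \<le> 3 * 2 ^ Suc N * A' * (1 - c) * 1"
      using A c by (intro mult_left_mono) (simp_all add: divide_le_eq_1_pos add_pos_nonneg)
    finally have 3: "(1 + norm x) ^ N * norm (?D (c *\<^sub>R x) - ?D x) \<le> 3 * 2 ^ Suc N * A' * (1 - c)" by simp
    have "(1 + norm x) ^ N * norm (partial_derivs js (\<lambda>x. of_real (c ^ 3) * \<psi> (c *\<^sub>R x) - \<psi> x) x) \<le>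
       (1 + norm x) ^ N * (\<bar>c ^ ?m - 1\<bar> * norm (?D (c *\<^sub>R x)) + norm (?D (c *\<^sub>R x) - ?D x))"
      unfolding eq by (intro mult_left_mono order_trans[OF norm_triangle_ineq]) auto
    also have "\<dots> = \<bar>c ^ ?m - 1\<bar> * ((1 + norm x) ^ N * norm (?D (c *\<^sub>R x))) + (1 + norm x) ^ N * norm (?D (c *\<^sub>R x) - ?D x)"
      by (simp only: distrib_left mult_ac)
    also have "\<dots> \<le> (real (N + 3) * (1 - c)) * (2 ^ N * A) + 3 * 2 ^ Suc N * A' * (1 - c)"
      using c A by (intro add_mono mult_mono 1 2 3) auto
    finally show "(1 + norm x) ^ N * norm (partial_derivs js (\<lambda>x. of_real (c ^ 3) * \<psi> (c *\<^sub>R x) - \<psi> x) x) \<le>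
      (real (N + 3) * 2 ^ N * A + 3 * 2 ^ Suc N * A') * (1 - c)"
      by (simp add: algebra_simps)
  qed
  then show ?thesis by blast
qed

lemma tempered_distribution_bound:
  assumes "tempered_distribution T"
  obtains N C where "0 \<le> C" "\<And>\<phi>. schwartz \<phi> \<Longrightarrow> norm (T \<phi>) \<le> C * schwartz_norm N \<phi>"
proof -
  obtain N C where C: "\<And>\<phi>. schwartz \<phi> \<Longrightarrow> norm (T \<phi>) \<le> C * schwartz_norm N \<phi>"
    using assms unfolding tempered_distribution_def by blast
  have "norm (T \<phi>) \<le> \<bar>C\<bar> * schwartz_norm N \<phi>" if "schwartz \<phi>" for \<phi>
    using C[OF that] mult_right_mono[of C "\<bar>C\<bar>"] schwartz_norm_nonneg[OF that, of N] by fastforce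
  then show ?thesis using that[of "\<bar>C\<bar>" N] by simp
qed

lemma tempered_distribution_diff:
  assumes "tempered_distribution T" "schwartz \<phi>" "schwartz \<psi>"
  shows "T (\<lambda>x. \<phi> x - \<psi> x) = T \<phi> - T \<psi>"
proof -
  have "T (\<lambda>x. \<phi> x + - 1 * \<psi> x) = T \<phi> + - 1 * T \<psi>"
    using assms schwartz_cmult[OF assms(3), of "- 1"] unfolding tempered_distribution_def by metis
  then show ?thesis by simp
qed

section \<open>Fourier integrals of radial functions\<close>

lemma measure_eq_halflinesI:
  fixes M N :: "real measure"
  assumes s: "sets M = sets borel" "sets N = sets borel"
    and e: "\<And>q. emeasure M {..q} = emeasure N {..q}" and f: "\<And>q. emeasure M {..q} \<noteq> \<infinity>"
  shows "M = N"
proof (rule measure_eqI_generator_eq[where E="range atMost" and A="\<lambda>i. {..real i}" and \<Omega>=UNIV])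
  show "Int_stable (range atMost :: real set set)"
    by (auto simp: Int_stable_def intro!: range_eqI[where x="min _ _"])
  show "sets M = sigma_sets UNIV (range atMost)" "sets N = sigma_sets UNIV (range atMost)"
    using s by (simp_all add: borel_eq_atMost)
  show "(\<Union>i. {..real i}) = UNIV" by (auto intro: real_arch_simple)
qed (use e f in auto)

text \<open>The volume \<open>4 / 3 * pi * q ^ 3\<close> of a ball is the integral of \<open>4 * pi * r\<^sup>2\<close> up to \<open>q\<close>;
  both measures agree on half lines.\<close>

lemma distr_norm_3:
  "distr (lborel :: (real^3) measure) borel norm =
   density lborel (\<lambda>r. ennreal (4 * pi * r\<^sup>2) * indicator {0..} r)"
proof (rule measure_eq_halflinesI)
  fix q :: real
  have L: "emeasure (distr (lborel :: (real^3) measure) borel norm) {..q} =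
      emeasure lborel (cball (0::real^3) q)"
    by (subst emeasure_distr) (auto simp: vimage_def cball_def dist_norm)
  have R: "emeasure (density lborel (\<lambda>r. ennreal (4 * pi * r\<^sup>2) * indicator {0..} r)) {..q} =
      (\<integral>\<^sup>+r. ennreal (4 * pi * r\<^sup>2) * indicator {0..q} r \<partial>lborel)"
    by (subst emeasure_density) (auto simp: indicator_def intro!: nn_integral_cong)
  show eq: "emeasure (distr (lborel :: (real^3) measure) borel norm) {..q} =
     emeasure (density lborel (\<lambda>r. ennreal (4 * pi * r\<^sup>2) * indicator {0..} r)) {..q}"
  proof (cases "0 \<le> q")
    case True
    have "(\<integral>\<^sup>+r. ennreal (4 * pi * r\<^sup>2) * indicator {0..q} r \<partial>lborel) =
        ennreal (4 * pi * q ^ 3 / 3 - 4 * pi * 0 ^ 3 / 3)"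
      by (rule nn_integral_FTC_Icc[OF _ _ _ True])
         (auto intro!: derivative_eq_intros simp: power2_eq_square)
    then show ?thesis unfolding L R using True
      by (simp add: emeasure_cball unit_ball_vol_3 mult_ac)
  next
    case False
    then have "cball (0::real^3) q = {}" "{0..q} = {}" by auto
    then show ?thesis unfolding L R by simp
  qed
  show "emeasure (distr (lborel :: (real^3) measure) borel norm) {..q} \<noteq> \<infinity>"
    unfolding L using emeasure_lborel_cball_finite[of "0::real^3" q] by simp
qed auto

lemma sq_le_iff: "0 \<le> r \<Longrightarrow> r\<^sup>2 \<le> q \<longleftrightarrow> r \<le> sqrt q"
proof
  assume r: "0 \<le> r" "r \<le> sqrt q"
  then have "0 \<le> sqrt q" by linarith
  moreover have "r\<^sup>2 \<le> (sqrt q)\<^sup>2" using r by (rule power_mono[rotated])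
  ultimately show "r\<^sup>2 \<le> q" by simp
qed (rule real_le_rsqrt)

text \<open>The area \<open>pi * q\<close> of a disc of squared radius \<open>q\<close> is linear in \<open>q\<close>.\<close>

lemma distr_norm_sq_2:
  "distr (lborel :: (real \<times> real) measure) borel (\<lambda>p. (norm p)\<^sup>2) =
   density lborel (\<lambda>q. ennreal pi * indicator {0..} q)"
proof (rule measure_eq_halflinesI)
  fix q :: real
  have L: "emeasure (distr (lborel :: (real \<times> real) measure) borel (\<lambda>p. (norm p)\<^sup>2)) {..q} =
      emeasure lborel {p :: real \<times> real. (norm p)\<^sup>2 \<le> q}"
    by (subst emeasure_distr) (auto simp: vimage_def)
  have R: "emeasure (density lborel (\<lambda>q. ennreal pi * indicator {0..} q)) {..q} =
      (\<integral>\<^sup>+r. ennreal pi * indicator {0..q} r \<partial>lborel)"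
    by (subst emeasure_density) (auto simp: indicator_def intro!: nn_integral_cong)
  have eq: "emeasure (distr (lborel :: (real \<times> real) measure) borel (\<lambda>p. (norm p)\<^sup>2)) {..q} =
      ennreal (pi * max 0 q)"
  proof (cases "0 \<le> q")
    case True
    have "{p :: real \<times> real. (norm p)\<^sup>2 \<le> q} = cball 0 (sqrt q)"
      by (auto simp: sq_le_iff)
    then show ?thesis unfolding L using True
      by (simp add: emeasure_cball unit_ball_vol_2 max_def)
  next
    case False
    then have e: "{p :: real \<times> real. (norm p)\<^sup>2 \<le> q} = {}"
      using order_trans zero_le_power2 by blast
    show ?thesis unfolding L e using False by (simp add: max_def)
  qed
  show "emeasure (distr (lborel :: (real \<times> real) measure) borel (\<lambda>p. (norm p)\<^sup>2)) {..q} =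
    emeasure (density lborel (\<lambda>q. ennreal pi * indicator {0..} q)) {..q}"
    unfolding eq R by (subst nn_integral_cmult_indicator) (auto simp: max_def ennreal_mult)
  show "emeasure (distr (lborel :: (real \<times> real) measure) borel (\<lambda>p. (norm p)\<^sup>2)) {..q} \<noteq> \<infinity>"
    unfolding eq by simp
qed auto

lemma distr_square:
  "distr (density lborel (\<lambda>r. ennreal (2 * r) * indicator {0..} r)) borel (\<lambda>r. r\<^sup>2) =
   density lborel (\<lambda>q::real. indicator {0..} q)"
proof (rule measure_eq_halflinesI)
  fix q :: real
  have R: "emeasure (density lborel (\<lambda>q::real. indicator {0..} q)) {..q} = ennreal (max 0 q)"
  proof -
    have "emeasure (density lborel (\<lambda>q::real. indicator {0..} q)) {..q} = (\<integral>\<^sup>+r. indicator {0..q} r \<partial>lborel)"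
      by (subst emeasure_density, simp, simp, rule nn_integral_cong) (auto simp: indicator_def)
    then show ?thesis by (auto simp: max_def)
  qed
  have L: "emeasure (distr (density lborel (\<lambda>r. ennreal (2 * r) * indicator {0..} r)) borel (\<lambda>r. r\<^sup>2)) {..q}
      = (\<integral>\<^sup>+r. ennreal (2 * r) * indicator {0..sqrt q} r \<partial>lborel)"
  proof -
    have m: "{r::real. r\<^sup>2 \<le> q} \<in> sets borel" by simp
    have "emeasure (distr (density lborel (\<lambda>r. ennreal (2 * r) * indicator {0..} r)) borel (\<lambda>r. r\<^sup>2)) {..q}
      = emeasure (density lborel (\<lambda>r. ennreal (2 * r) * indicator {0..} r)) {r. r\<^sup>2 \<le> q}"
      by (subst emeasure_distr) (auto simp: vimage_def)
    also have "\<dots> = (\<integral>\<^sup>+r. ennreal (2 * r) * indicator {0..} r * indicator {r. r\<^sup>2 \<le> q} r \<partial>lborel)"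
      using m by (subst emeasure_density) auto
    also have "\<dots> = (\<integral>\<^sup>+r. ennreal (2 * r) * indicator {0..sqrt q} r \<partial>lborel)"
      by (rule nn_integral_cong) (auto simp: indicator_def sq_le_iff)
    finally show ?thesis .
  qed
  show "emeasure (distr (density lborel (\<lambda>r. ennreal (2 * r) * indicator {0..} r)) borel (\<lambda>r. r\<^sup>2)) {..q} =
    emeasure (density lborel (\<lambda>q::real. indicator {0..} q)) {..q}"
  proof (cases "0 \<le> q")
    case True
    have "(\<integral>\<^sup>+r. ennreal (2 * r) * indicator {0..sqrt q} r \<partial>lborel) = ennreal ((sqrt q)\<^sup>2 - 0\<^sup>2)"
      by (rule nn_integral_FTC_Icc) (use True in \<open>auto intro!: derivative_eq_intros\<close>)
    then show ?thesis unfolding L R using True by (simp add: max_def)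
  next
    case False
    then have "{0..sqrt q} = {}" by auto
    then show ?thesis unfolding L R using False by (simp add: max_def)
  qed
  then show "emeasure (distr (density lborel (\<lambda>r. ennreal (2 * r) * indicator {0..} r)) borel (\<lambda>r. r\<^sup>2)) {..q} \<noteq> \<infinity>"
    unfolding R by simp
qed auto

text \<open>Splitting off the third coordinate, along which the frequency will be pointing, leaves a
  plane on which the remaining integrand is rotation invariant.\<close>

definition vec3 :: "(real \<times> real) \<times> real \<Rightarrow> real^3" where
  "vec3 p = fst (fst p) *\<^sub>R axis 1 1 + snd (fst p) *\<^sub>R axis 2 1 + snd p *\<^sub>R axis 3 1"

lemma vec3_nth [simp]: "vec3 p $ 1 = fst (fst p)" "vec3 p $ 2 = snd (fst p)" "vec3 p $ 3 = snd p"
  by (simp_all add: vec3_def axis_def)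

lemma vec3_measurable [measurable]: "vec3 \<in> borel \<rightarrow>\<^sub>M borel"
  by (rule borel_measurable_continuous_onI)
     (auto simp: vec3_def[abs_def] intro!: continuous_intros)

lemma prod_UNIV_3: "prod f (UNIV :: 3 set) = f 1 * f 2 * (f 3 :: 'a::comm_monoid_mult)"
  unfolding UNIV_3 by (simp add: mult.assoc)

lemma Basis_3: "(Basis :: (real^3) set) = range (\<lambda>i. axis i 1)"
  by (auto simp: Basis_vec_def)

lemma distr_vec3: "distr lborel borel vec3 = lborel"
proof (rule lborel_eqI[symmetric])
  fix l u :: "real^3" assume le: "\<And>b. b \<in> Basis \<Longrightarrow> l \<bullet> b \<le> u \<bullet> b"
  have le': "l $ i \<le> u $ i" for i
    using le[of "axis i 1"] by (auto simp: Basis_3 inner_axis)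
  have box: "vec3 -` box l u = (box (l$1, l$2) (u$1, u$2)) \<times> box (l$3) (u$3)"
    by (auto simp: box_def Basis_3 inner_axis forall_3 Basis_prod_def)
  have "emeasure (distr lborel borel vec3) (box l u) = emeasure (lborel \<Otimes>\<^sub>M lborel)
      ((box (l$1, l$2) (u$1, u$2)) \<times> box (l$3) (u$3))"
    by (subst emeasure_distr) (auto simp: box lborel_prod)
  also have "\<dots> = emeasure lborel (box (l$1, l$2) (u$1, u$2)) * emeasure lborel (box (l$3) (u$3))"
    by (subst lborel.emeasure_pair_measure_Times) auto
  also have "emeasure lborel (box (l$1, l$2) (u$1, u$2)) = emeasure (lborel \<Otimes>\<^sub>M lborel) (box (l$1) (u$1) \<times> box (l$2) (u$2))"
    by (simp add: lborel_prod) (auto simp: box_def Basis_prod_def intro!: arg_cong[where f="emeasure lborel"])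
  also have "\<dots> = emeasure lborel (box (l$1) (u$1)) * emeasure lborel (box (l$2) (u$2))"
    by (subst lborel.emeasure_pair_measure_Times) auto
  also have "\<dots> * emeasure lborel (box (l$3) (u$3)) = ennreal ((u$1 - l$1) * (u$2 - l$2) * (u$3 - l$3))"
    using le' by (simp add: box_real ennreal_mult)
  also have "(u$1 - l$1) * (u$2 - l$2) * (u$3 - l$3) = (\<Prod>b\<in>Basis. (u - l) \<bullet> b)"
  proof -
    have "(\<Prod>b\<in>Basis. (u - l) \<bullet> b) = (\<Prod>i\<in>UNIV. (u - l) \<bullet> axis i 1)"
      unfolding Basis_3 by (subst prod.reindex) (auto simp: inj_on_def axis_eq_axis)
    then show ?thesis unfolding prod_UNIV_3 by (simp add: inner_axis)
  qed
  finally show "emeasure (distr lborel borel vec3) (box l u) = ennreal (\<Prod>b\<in>Basis. (u - l) \<bullet> b)" .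
qed simp

lemma orthogonal_distr_lborel:
  fixes f :: "real^3 \<Rightarrow> real^3"
  assumes f: "orthogonal_transformation f"
  shows "distr lborel borel f = lborel"
proof (rule lborel_eqI[symmetric])
  fix l u :: "real^3" assume le: "\<And>b. b \<in> Basis \<Longrightarrow> l \<bullet> b \<le> u \<bullet> b"
  have lin: "linear f" using f by (rule orthogonal_transformation_linear)
  have fb[measurable]: "f \<in> borel \<rightarrow>\<^sub>M borel"
    by (intro borel_measurable_continuous_onI linear_continuous_on linear_conv_bounded_linear[THEN iffD1] lin)
  have bij: "bij f" using f by (rule orthogonal_transformation_bij)
  then have im: "f ` (f -` box l u) = box l u" by (simp add: bij_is_surj)
  have os: "open (f -` box l u)"
    by (rule continuous_open_vimage)
      (auto intro: linear_continuous_at linear_conv_bounded_linear[THEN iffD1] lin)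
  have bd: "bounded (f -` box l u)"
  proof (rule bounded_subset[of "cball 0 (Sup (norm ` box l u))"])
    obtain B where "\<And>x. x \<in> box l u \<Longrightarrow> norm x \<le> B"
      using bounded_box[of l u] by (auto simp: bounded_iff)
    then have "bdd_above (norm ` box l u)" by (auto simp: bdd_above_def)
    then show "f -` box l u \<subseteq> cball 0 (Sup (norm ` box l u))"
      using orthogonal_transformation_norm[OF f] by (auto intro!: cSUP_upper2)
  qed simp
  have lm: "f -` box l u \<in> lmeasurable"
    using os bd by (rule lmeasurable_open[rotated])
  have "emeasure (distr lborel borel f) (box l u) = emeasure lborel (f -` box l u)"
    by (subst emeasure_distr) auto
  also have "\<dots> = emeasure lebesgue (f -` box l u)" using os by simp
  also have "\<dots> = ennreal (measure lebesgue (f -` box l u))"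
    using fmeasurableD2[OF lm] by (intro emeasure_eq_ennreal_measure) simp
  also have "measure lebesgue (f -` box l u) = measure lebesgue (box l u)"
    using measure_orthogonal_image[OF f lm] im by simp
  also have "ennreal (measure lebesgue (box l u)) = emeasure lebesgue (box l u)"
    using fmeasurableD2[OF lmeasurable_box] by (intro emeasure_eq_ennreal_measure[symmetric]) simp
  also have "\<dots> = ennreal (\<Prod>b\<in>Basis. (u - l) \<bullet> b)"
    using le by (simp add: emeasure_lborel_box)
  finally show "emeasure (distr lborel borel f) (box l u) = ennreal (\<Prod>b\<in>Basis. (u - l) \<bullet> b)" .
qed simp

text \<open>The reference integrable function for Schwartz functions: \<open>4\<close> is the least integer
  exponent above the dimension.\<close>

lemma integrable_inverse_power: "integrable lborel (\<lambda>x::real^3. 1 / (1 + norm x) ^ 4)"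
proof (rule integrableI_bounded)
  have "(\<integral>\<^sup>+x. ennreal (norm (1 / (1 + norm (x::real^3)) ^ 4)) \<partial>lborel) =
     (\<integral>\<^sup>+x. ennreal (1 / (1 + \<bar>norm (x::real^3)\<bar>) ^ 4) \<partial>lborel)" by simp
  also have "\<dots> = (\<integral>\<^sup>+r. ennreal (1 / (1 + \<bar>r\<bar>) ^ 4) \<partial>distr (lborel :: (real^3) measure) borel norm)"
    by (subst nn_integral_distr) auto
  also have "\<dots> = (\<integral>\<^sup>+r. (ennreal (4 * pi * r\<^sup>2) * indicator {0..} r) * ennreal (1 / (1 + \<bar>r\<bar>) ^ 4) \<partial>lborel)"
    unfolding distr_norm_3 by (subst nn_integral_density) auto
  also have "\<dots> \<le> (\<integral>\<^sup>+r. ennreal (4 * pi / (1 + r)\<^sup>2) * indicator {0..} r \<partial>lborel)"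
  proof (rule nn_integral_mono)
    fix r :: real
    have "4 * pi * r\<^sup>2 * (1 / (1 + r) ^ 4) \<le> 4 * pi / (1 + r)\<^sup>2" if "0 \<le> r"
    proof -
      have "r\<^sup>2 * (1 / (1 + r) ^ 4) \<le> (1 + r)\<^sup>2 * (1 / (1 + r) ^ 4)"
        using that by (intro mult_right_mono power_mono) auto
      also have "\<dots> = 1 / (1 + r)\<^sup>2"
      proof -
        have "y\<^sup>2 * (1 / y ^ 4) = 1 / y\<^sup>2" for y :: real
          by (simp add: power2_eq_square power4_eq_xxxx)
        then show ?thesis .
      qed
      finally have "(4 * pi) * (r\<^sup>2 * (1 / (1 + r) ^ 4)) \<le> (4 * pi) * (1 / (1 + r)\<^sup>2)"
        by (intro mult_left_mono) auto
      then show ?thesis by simp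
    qed
    then show "(ennreal (4 * pi * r\<^sup>2) * indicator {0..} r) * ennreal (1 / (1 + \<bar>r\<bar>) ^ 4) \<le>
        ennreal (4 * pi / (1 + r)\<^sup>2) * indicator {0..} r"
      by (auto simp: indicator_def ennreal_mult[symmetric] intro!: ennreal_leI)
  qed
  also have "\<dots> = ennreal (0 - (- 4 * pi / (1 + 0)))"
  proof (rule nn_integral_FTC_atLeast)
    show "((\<lambda>r. - 4 * pi / (1 + r)) \<longlongrightarrow> 0) at_top"
      by (intro tendsto_divide_0[OF tendsto_const] filterlim_at_top_imp_at_infinity
        filterlim_tendsto_add_at_top[OF tendsto_const] filterlim_ident)
  qed (auto intro!: derivative_eq_intros simp: power2_eq_square)
  also have "\<dots> < \<infinity>" by simp
  finally show "(\<integral>\<^sup>+x. ennreal (norm (1 / (1 + norm (x::real^3)) ^ 4)) \<partial>lborel) < \<infinity>" .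
qed simp

lemma norm_vec3: "(norm (vec3 p))\<^sup>2 = (norm (fst p))\<^sup>2 + (snd p)\<^sup>2"
  unfolding power2_norm_eq_inner inner_vec_def sum_3 inner_prod_def
  by (simp add: power2_eq_square inner_prod_def)

text \<open>A form of Archimedes' theorem on the sphere: at height \<open>z\<close> the squared norm is \<open>z\<^sup>2\<close> plus
  the squared norm in the plane, and the latter has constant density \<open>pi\<close>. For fixed
  \<open>\<bar>\<xi>\<bar>\<^sup>2 = v\<close>, the third coordinate is thus uniform on \<open>z\<^sup>2 \<le> v\<close>.\<close>

lemma distr_norm_sq_component:
  "distr (lborel :: (real^3) measure) (lborel \<Otimes>\<^sub>M lborel) (\<lambda>\<xi>. ((norm \<xi>)\<^sup>2, \<xi> $ 3)) =
   density (lborel \<Otimes>\<^sub>M lborel) (\<lambda>(v, z). ennreal (pi * indicator {z\<^sup>2..} v))"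
proof (rule measure_eqI)
  fix A assume "A \<in> sets (distr (lborel :: (real^3) measure) (lborel \<Otimes>\<^sub>M lborel) (\<lambda>\<xi>. ((norm \<xi>)\<^sup>2, \<xi> $ 3)))"
  then have A[measurable]: "A \<in> sets (lborel \<Otimes>\<^sub>M lborel :: (real \<times> real) measure)" by simp
  have [measurable]: "(\<lambda>\<xi>::real^3. \<xi> $ 3) \<in> borel_measurable borel"
    by (rule borel_measurable_continuous_onI) (intro continuous_intros)
  have [measurable]: "(\<lambda>(v::real, z::real). indicator {z\<^sup>2..} v :: real) \<in> borel_measurable (lborel \<Otimes>\<^sub>M lborel)"
  proof -
    have "(\<lambda>(v::real, z::real). indicator {z\<^sup>2..} v :: real) = indicator {p. (snd p)\<^sup>2 \<le> fst p}"
      by (auto simp: indicator_def fun_eq_iff)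
    then show ?thesis by simp
  qed
  have "emeasure (distr (lborel :: (real^3) measure) (lborel \<Otimes>\<^sub>M lborel) (\<lambda>\<xi>. ((norm \<xi>)\<^sup>2, \<xi> $ 3))) A =
      (\<integral>\<^sup>+\<xi>. indicator A ((norm \<xi>)\<^sup>2, \<xi> $ 3) \<partial>(lborel :: (real^3) measure))"
  proof -
    have "emeasure (distr (lborel :: (real^3) measure) (lborel \<Otimes>\<^sub>M lborel) (\<lambda>\<xi>. ((norm \<xi>)\<^sup>2, \<xi> $ 3))) A =
      (\<integral>\<^sup>+p. indicator A p \<partial>distr (lborel :: (real^3) measure) (lborel \<Otimes>\<^sub>M lborel) (\<lambda>\<xi>. ((norm \<xi>)\<^sup>2, \<xi> $ 3)))"
      using A by simp
    then show ?thesis by (subst (asm) nn_integral_distr) auto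
  qed
  also have "\<dots> = (\<integral>\<^sup>+\<xi>. indicator A ((norm \<xi>)\<^sup>2, \<xi> $ 3) \<partial>distr lborel borel vec3)"
    by (simp add: distr_vec3)
  also have "\<dots> = (\<integral>\<^sup>+p. indicator A ((norm (vec3 p))\<^sup>2, vec3 p $ 3) \<partial>lborel)"
    by (subst nn_integral_distr) auto
  also have "\<dots> = (\<integral>\<^sup>+p. indicator A ((norm (fst p))\<^sup>2 + (snd p)\<^sup>2, snd p) \<partial>((lborel :: (real \<times> real) measure) \<Otimes>\<^sub>M lborel))"
    by (simp add: norm_vec3 lborel_prod)
  also have "\<dots> = (\<integral>\<^sup>+z. \<integral>\<^sup>+p. indicator A ((norm p)\<^sup>2 + z\<^sup>2, z) \<partial>(lborel :: (real \<times> real) measure) \<partial>lborel)"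
    by (subst lborel_pair.nn_integral_snd[symmetric]) auto
  also have "\<dots> = (\<integral>\<^sup>+z. \<integral>\<^sup>+v. ennreal (pi * indicator {z\<^sup>2..} v) * indicator A (v, z) \<partial>lborel \<partial>lborel)"
  proof (rule nn_integral_cong)
    fix z :: real
    have "(\<integral>\<^sup>+p. indicator A ((norm p)\<^sup>2 + z\<^sup>2, z) \<partial>(lborel :: (real \<times> real) measure)) =
        (\<integral>\<^sup>+q. indicator A (q + z\<^sup>2, z) \<partial>distr (lborel :: (real \<times> real) measure) borel (\<lambda>p. (norm p)\<^sup>2))"
      by (subst nn_integral_distr) auto
    also have "\<dots> = (\<integral>\<^sup>+q. (ennreal pi * indicator {0..} q) * indicator A (q + z\<^sup>2, z) \<partial>lborel)"
      unfolding distr_norm_sq_2 by (subst nn_integral_density) auto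
    also have "\<dots> = (\<integral>\<^sup>+v. (ennreal pi * indicator {z\<^sup>2..} v) * indicator A (v, z) \<partial>lborel)"
      by (subst nn_integral_real_affine[where c=1 and t="z\<^sup>2"])
         (auto simp: indicator_def add.commute intro!: nn_integral_cong)
    also have "\<dots> = (\<integral>\<^sup>+v. ennreal (pi * indicator {z\<^sup>2..} v) * indicator A (v, z) \<partial>lborel)"
      by (rule nn_integral_cong) (auto simp: indicator_def)
    finally show "(\<integral>\<^sup>+p. indicator A ((norm p)\<^sup>2 + z\<^sup>2, z) \<partial>(lborel :: (real \<times> real) measure)) = \<dots>" .
  qed
  also have "\<dots> = (\<integral>\<^sup>+p. ennreal (pi * (\<lambda>(v, z). indicator {z\<^sup>2..} v) p) * indicator A p \<partial>(lborel \<Otimes>\<^sub>M lborel))"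
    by (subst lborel_pair.nn_integral_snd[symmetric]) auto
  also have "\<dots> = emeasure (density (lborel \<Otimes>\<^sub>M lborel) (\<lambda>(v, z). ennreal (pi * indicator {z\<^sup>2..} v))) A"
    using A by (subst emeasure_density) (auto simp: case_prod_unfold)
  finally show "emeasure (distr (lborel :: (real^3) measure) (lborel \<Otimes>\<^sub>M lborel) (\<lambda>\<xi>. ((norm \<xi>)\<^sup>2, \<xi> $ 3))) A =
     emeasure (density (lborel \<Otimes>\<^sub>M lborel) (\<lambda>(v, z). ennreal (pi * indicator {z\<^sup>2..} v))) A" .
qed simp

lemma integral_cis_symmetric:
  assumes "s \<noteq> 0" "0 \<le> a"
  shows "(LINT z|lborel. indicator {-a..a} z *\<^sub>R cis (s * z)) = complex_of_real (2 * sin (s * a) / s)"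
proof -
  have "(LINT z|lborel. indicator {-a..a} z *\<^sub>R cis (s * z)) =
     cis (s * a) / (\<i> * of_real s) - cis (s * (- a)) / (\<i> * of_real s)"
  proof (rule integral_FTC_atLeastAtMost)
    fix z
    have "((\<lambda>w. exp (\<i> * (of_real s * w))) has_field_derivative
        (\<i> * of_real s) * exp (\<i> * (of_real s * of_real z))) (at (of_real z))"
      by (auto intro!: derivative_eq_intros)
    from has_vector_derivative_real_field[OF this]
    have "((\<lambda>z. exp (\<i> * of_real (s * z)) / (\<i> * of_real s)) has_vector_derivative
       (\<i> * of_real s) * exp (\<i> * of_real (s * z)) / (\<i> * of_real s)) (at z within {-a..a})"
      by (intro bounded_linear.has_vector_derivative[OF bounded_linear_divide]) simp
    moreover have "(\<i> * of_real s) * exp (\<i> * of_real (s * z)) / (\<i> * of_real s) = exp (\<i> * of_real (s * z))"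
      using assms by (intro nonzero_mult_div_cancel_left) simp
    ultimately show "((\<lambda>z. cis (s * z) / (\<i> * of_real s)) has_vector_derivative cis (s * z)) (at z within {-a..a})"
      by (simp only: cis_conv_exp)
  qed (use assms in \<open>auto intro!: continuous_intros\<close>)
  also have "\<dots> = complex_of_real (2 * sin (s * a) / s)"
    using assms by (simp add: complex_eq_iff cis.code Re_divide Im_divide power2_eq_square field_simps)
  finally show ?thesis .
qed

text \<open>A rotation moves \<open>x\<close> to the third axis. Then the joint law of the squared norm and the
  third coordinate makes the inner integral one of \<open>cis (s * z)\<close> over a symmetric interval, and
  \<open>v = r\<^sup>2\<close> produces the one-dimensional sine transform of \<open>k r * r\<close>.\<close>

lemma radial_fourier:
  fixes k :: "real \<Rightarrow> real" and x :: "real^3"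
  assumes k[measurable]: "k \<in> borel_measurable borel"
    and int: "integrable lborel (\<lambda>\<xi>::real^3. k (norm \<xi>))" and x: "x \<noteq> 0"
  shows "(LINT \<xi>|lborel. complex_of_real (k (norm \<xi>)) * cis (x \<bullet> \<xi>)) =
    complex_of_real (4 * pi / norm x * (LINT r|lborel. indicator {0..} r * (k r * r * sin (norm x * r))))"
proof -
  define s where "s = norm x"
  have s: "s > 0" using x by (simp add: s_def)
  have [measurable]: "(\<lambda>\<xi>::real^3. \<xi> $ 3) \<in> borel_measurable borel"
    by (rule borel_measurable_continuous_onI) (intro continuous_intros)
  have [measurable]: "cis \<in> borel_measurable borel"
    by (rule borel_measurable_continuous_onI) (intro continuous_intros)
  have [measurable]: "(\<lambda>(v::real, z::real). indicator {z\<^sup>2..} v :: real) \<in> borel_measurable (lborel \<Otimes>\<^sub>M lborel)"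
  proof -
    have "(\<lambda>(v::real, z::real). indicator {z\<^sup>2..} v :: real) = indicator {p. (snd p)\<^sup>2 \<le> fst p}"
      by (auto simp: indicator_def fun_eq_iff)
    then show ?thesis by simp
  qed
  have "norm (s *\<^sub>R axis 3 1 :: real^3) = norm x" using s by (simp add: s_def)
  from orthogonal_transformation_exists[OF this]
  obtain f :: "real^3 \<Rightarrow> real^3" where f: "orthogonal_transformation f" "f (s *\<^sub>R axis 3 1) = x"
    by blast
  have [measurable]: "f \<in> borel \<rightarrow>\<^sub>M borel"
    by (intro borel_measurable_continuous_onI linear_continuous_on linear_conv_bounded_linear[THEN iffD1]
      orthogonal_transformation_linear f)
  have inner: "x \<bullet> f \<eta> = s * \<eta> $ 3" for \<eta> :: "real^3"
  proof -
    have "x \<bullet> f \<eta> = (s *\<^sub>R axis 3 1) \<bullet> \<eta>"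
      using f unfolding orthogonal_transformation_def by metis
    then show ?thesis by (simp add: inner_axis inner_commute)
  qed
  let ?g = "\<lambda>(v, z). complex_of_real (k (sqrt v)) * cis (s * z)"
  have gm[measurable]: "?g \<in> borel_measurable (lborel \<Otimes>\<^sub>M lborel)" by measurable
  have "(LINT \<xi>|lborel. complex_of_real (k (norm \<xi>)) * cis (x \<bullet> \<xi>)) =
      integral\<^sup>L (distr lborel borel f) (\<lambda>\<xi>. complex_of_real (k (norm \<xi>)) * cis (x \<bullet> \<xi>))"
    by (simp add: orthogonal_distr_lborel[OF f(1)])
  also have "\<dots> = (LINT \<eta>|lborel. complex_of_real (k (norm (\<eta>::real^3))) * cis (s * \<eta> $ 3))"
    by (subst integral_distr) (auto simp: inner orthogonal_transformation_norm[OF f(1)])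
  also have "\<dots> = integral\<^sup>L (distr (lborel :: (real^3) measure) (lborel \<Otimes>\<^sub>M lborel) (\<lambda>\<xi>. ((norm \<xi>)\<^sup>2, \<xi> $ 3))) ?g"
    by (subst integral_distr) (auto simp: case_prod_unfold)
  also have "\<dots> = integral\<^sup>L (lborel \<Otimes>\<^sub>M lborel) (\<lambda>p. (pi * (\<lambda>(v, z). indicator {z\<^sup>2..} v) p) *\<^sub>R ?g p)"
    unfolding distr_norm_sq_component case_prod_unfold
    by (subst integral_density) (auto simp: case_prod_unfold)
  also have "\<dots> = (LINT v|lborel. LINT z|lborel. (pi * indicator {z\<^sup>2..} v) *\<^sub>R ?g (v, z))"
  proof (subst lborel_pair.integral_fst'[symmetric])
    have "integrable (distr (lborel :: (real^3) measure) (lborel \<Otimes>\<^sub>M lborel) (\<lambda>\<xi>. ((norm \<xi>)\<^sup>2, \<xi> $ 3))) ?g"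
    proof (subst integrable_distr_eq)
      show "integrable lborel (\<lambda>\<xi>::real^3. ?g ((norm \<xi>)\<^sup>2, \<xi> $ 3))"
        by (rule Bochner_Integration.integrable_bound[OF int]) (auto simp: norm_mult case_prod_unfold)
    qed auto
    then show "integrable (lborel \<Otimes>\<^sub>M lborel) (\<lambda>p. (pi * (\<lambda>(v, z). indicator {z\<^sup>2..} v) p) *\<^sub>R ?g p)"
      unfolding distr_norm_sq_component case_prod_unfold
      by (subst (asm) integrable_density) (auto simp: case_prod_unfold)
  qed (simp add: case_prod_unfold)
  also have "\<dots> = (LINT v|lborel. indicator {0..} v *\<^sub>R complex_of_real (pi * k (sqrt v) * (2 * sin (s * sqrt v) / s)))"
  proof (rule Bochner_Integration.integral_cong[OF refl])
    fix v :: real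
    show "(LINT z|lborel. (pi * indicator {z\<^sup>2..} v) *\<^sub>R ?g (v, z)) =
       indicator {0..} v *\<^sub>R complex_of_real (pi * k (sqrt v) * (2 * sin (s * sqrt v) / s))"
    proof (cases "0 \<le> v")
      case True
      have ind: "indicator {z\<^sup>2..} v = (indicator {- sqrt v..sqrt v} z :: real)" for z
      proof -
        have "z\<^sup>2 \<le> v \<longleftrightarrow> \<bar>z\<bar> \<le> sqrt v" using sq_le_iff[of "\<bar>z\<bar>" v] by simp
        then show ?thesis by (auto simp: indicator_def)
      qed
      have "(LINT z|lborel. (pi * indicator {z\<^sup>2..} v) *\<^sub>R ?g (v, z)) =
         (LINT z|lborel. complex_of_real (pi * k (sqrt v)) * (indicator {- sqrt v..sqrt v} z *\<^sub>R cis (s * z)))"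
        unfolding ind by (rule Bochner_Integration.integral_cong) (auto simp: scaleR_conv_of_real)
      also have "\<dots> = complex_of_real (pi * k (sqrt v)) * complex_of_real (2 * sin (s * sqrt v) / s)"
        unfolding integral_mult_right_zero using integral_cis_symmetric[of s "sqrt v"] s True by simp
      finally show ?thesis using True by simp
    next
      case False
      then have "indicator {z\<^sup>2..} v = (0::real)" for z using order_trans[OF zero_le_power2[of z], of v] by (auto simp: indicator_def)
      then show ?thesis using False by simp
    qed
  qed
  also have "\<dots> = integral\<^sup>L (density lborel (\<lambda>q::real. indicator {0..} q)) (\<lambda>v. complex_of_real (pi * k (sqrt v) * (2 * sin (s * sqrt v) / s)))"
    by (subst ennreal_indicator[symmetric], subst integral_density) auto
  also have "\<dots> = integral\<^sup>L (density lborel (\<lambda>r. ennreal (2 * r) * indicator {0..} r)) (\<lambda>r.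
      complex_of_real (pi * k (sqrt (r\<^sup>2)) * (2 * sin (s * sqrt (r\<^sup>2)) / s)))"
    unfolding distr_square[symmetric] by (subst integral_distr) auto
  also have "(\<lambda>r. ennreal (2 * r) * indicator {0..} r) = (\<lambda>r. ennreal (2 * r * indicator {0..} r))"
    by (auto simp: indicator_def)
  also have "integral\<^sup>L (density lborel (\<lambda>r. ennreal (2 * r * indicator {0..} r))) (\<lambda>r.
      complex_of_real (pi * k (sqrt (r\<^sup>2)) * (2 * sin (s * sqrt (r\<^sup>2)) / s))) =
     (LINT r|lborel. (2 * r * indicator {0..} r) *\<^sub>R complex_of_real (pi * k (sqrt (r\<^sup>2)) * (2 * sin (s * sqrt (r\<^sup>2)) / s)))"
    by (subst integral_density) (auto simp: indicator_def)
  also have "\<dots> = (LINT r|lborel. complex_of_real ((4 * pi / s) * (indicator {0..} r * (k r * r * sin (s * r)))))"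
    by (rule Bochner_Integration.integral_cong) (auto simp: indicator_def scaleR_conv_of_real)
  also have "\<dots> = complex_of_real ((4 * pi / s) * (LINT r|lborel. indicator {0..} r * (k r * r * sin (s * r))))"
    by (simp only: integral_complex_of_real integral_mult_right_zero)
  finally show ?thesis by (simp add: s_def)
qed

section \<open>Integration by parts\<close>

lemma integral_norm_le:
  fixes f :: "'a \<Rightarrow> 'b::{banach, second_countable_topology}"
  assumes "integrable M f" "integrable M g" "\<And>x. norm (f x) \<le> g x"
  shows "norm (integral\<^sup>L M f) \<le> integral\<^sup>L M g"
  by (rule order_trans[OF integral_norm_bound integral_mono]) (use assms in auto)

lemma integral_lborel_translate:
  fixes h :: "real^3 \<Rightarrow> 'b::{banach, second_countable_topology}"
  assumes "h \<in> borel_measurable borel"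
  shows "(LINT x|lborel. h (a + x)) = (LINT x|lborel. h x)"
proof -
  have "integral\<^sup>L lborel h = integral\<^sup>L (distr lborel borel ((+) a)) h"
    by (simp add: lborel_distr_plus)
  also have "\<dots> = (LINT x|lborel. h (a + x))"
    by (subst integral_distr) (use assms in auto)
  finally show ?thesis by simp
qed

lemma integrable_lborel_translate:
  fixes h :: "real^3 \<Rightarrow> 'b::{banach, second_countable_topology}"
  assumes "integrable lborel h"
  shows "integrable lborel (\<lambda>x. h (a + x))"
proof -
  have "integrable (distr lborel borel ((+) a)) h" using assms by (simp add: lborel_distr_plus)
  from integrable_distr[OF _ this] show ?thesis by simp
qed

text \<open>Difference quotients have integral \<open>0\<close> by translation invariance, and dominated
  convergence passes to the derivative. Only an almost everywhere limit is assumed, so that the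
  lemma applies to Lipschitz functions that are not smooth, such as a function cut off at the
  unit sphere.\<close>

lemma integral_derivative_zero:
  fixes h D :: "real^3 \<Rightarrow> 'b::{banach, second_countable_topology}"
  assumes h: "integrable lborel h" and D: "D \<in> borel_measurable borel"
    and K: "integrable lborel K"
    and lim: "AE x in lborel. ((\<lambda>t. (h (x + t *\<^sub>R e) - h x) /\<^sub>R t) \<longlongrightarrow> D x) (at_right 0)"
    and bd: "\<And>x t. 0 < t \<Longrightarrow> t \<le> 1 \<Longrightarrow> norm (h (x + t *\<^sub>R e) - h x) \<le> t * K x"
  shows "(LINT x|lborel. D x) = 0"
proof -
  define t where "t n = 1 / real (Suc n)" for n
  have t: "0 < t n" "t n \<le> 1" for n by (auto simp: t_def field_simps)
  have t0: "filterlim t (at_right 0) sequentially"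
    unfolding filterlim_at using t LIMSEQ_Suc[OF lim_1_over_n[where 'a=real]]
    by (auto simp: t_def[abs_def] intro!: always_eventually)
  have hm[measurable]: "h \<in> borel_measurable borel" using h by simp
  let ?q = "\<lambda>n x. (h (x + t n *\<^sub>R e) - h x) /\<^sub>R t n"
  have z: "(LINT x|lborel. ?q n x) = 0" for n
  proof -
    have "integrable lborel (\<lambda>x. h (t n *\<^sub>R e + x))" by (rule integrable_lborel_translate[OF h])
    then show ?thesis
      using h integral_lborel_translate[OF hm, of "t n *\<^sub>R e"] by (simp add: add.commute)
  qed
  have "(\<lambda>n. LINT x|lborel. ?q n x) \<longlonglongrightarrow> (LINT x|lborel. D x)"
  proof (rule integral_dominated_convergence[OF _ _ K])
    show "AE x in lborel. (\<lambda>n. ?q n x) \<longlonglongrightarrow> D x"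
      using lim by eventually_elim (rule filterlim_compose[OF _ t0])
    show "AE x in lborel. norm (?q n x) \<le> K x" for n
    proof (rule AE_I2)
      fix x
      have "norm (?q n x) = norm (h (x + t n *\<^sub>R e) - h x) / t n"
        using t(1)[of n] by (simp add: divide_inverse mult.commute)
      then show "norm (?q n x) \<le> K x"
        using bd[OF t(1)[of n] t(2)[of n], of x] t(1)[of n] by (simp add: pos_divide_le_eq mult.commute)
    qed
  qed (use D in auto)
  then show ?thesis unfolding z by (simp add: LIMSEQ_const_iff)
qed

lemma partial_deriv_limit:
  fixes h :: "real^3 \<Rightarrow> 'b::real_normed_vector"
  assumes "h differentiable (at x)"
  shows "((\<lambda>t. (h (x + t *\<^sub>R axis i 1) - h x) /\<^sub>R t) \<longlongrightarrow> partial_deriv i h x) (at_right 0)"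
proof -
  have "(h has_derivative frechet_derivative h (at x)) (at (x + 0 *\<^sub>R axis i 1))"
    using assms by (simp add: frechet_derivative_works)
  then interpret D: bounded_linear "frechet_derivative h (at x)" by (rule has_derivative_bounded_linear)
  have "((\<lambda>t. x + t *\<^sub>R axis i 1) has_derivative (\<lambda>t. t *\<^sub>R axis i 1)) (at 0)"
    by (auto intro!: derivative_eq_intros)
  from has_derivative_compose[OF this \<open>(h has_derivative _) _\<close>]
  have "((\<lambda>t. h (x + t *\<^sub>R axis i 1)) has_vector_derivative partial_deriv i h x) (at 0)"
    by (simp add: has_vector_derivative_def partial_deriv_def D.scaleR)
  then have "((\<lambda>t. h (x + t *\<^sub>R axis i 1)) has_vector_derivative partial_deriv i h x) (at_right 0)"
    by (rule has_vector_derivative_at_within)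
  then have "((\<lambda>t. norm (h (x + t *\<^sub>R axis i 1) - h x - t *\<^sub>R partial_deriv i h x) / norm t) \<longlongrightarrow> 0) (at_right 0)"
    by (simp add: has_vector_derivative_def has_derivative_iff_norm)
  then have "((\<lambda>t. norm ((h (x + t *\<^sub>R axis i 1) - h x) /\<^sub>R t - partial_deriv i h x)) \<longlongrightarrow> 0) (at_right 0)"
  proof (rule Lim_transform_eventually)
    have "norm (u - t *\<^sub>R d) / norm t = norm (u /\<^sub>R t - d)" if "0 < t" for u d :: 'b and t :: real
    proof -
      have "u /\<^sub>R t - d = (u - t *\<^sub>R d) /\<^sub>R t" using that by (simp add: scaleR_diff_right)
      then show ?thesis by (simp add: divide_inverse mult.commute)
    qed
    then show "\<forall>\<^sub>F t in at_right 0. norm (h (x + t *\<^sub>R axis i 1) - h x - t *\<^sub>R partial_deriv i h x) / norm t =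
        norm ((h (x + t *\<^sub>R axis i 1) - h x) /\<^sub>R t - partial_deriv i h x)"
      by (intro eventually_mono[OF eventually_at_right_less]) blast
  qed
  then show ?thesis using Lim_null tendsto_norm_zero_iff by blast
qed

lemma schwartz_bound:
  assumes "schwartz \<phi>"
  shows "norm (\<phi> x) \<le> schwartz_norm N \<phi> / (1 + norm x) ^ N"
    and "norm (partial_deriv i \<phi> x) \<le> schwartz_norm (Suc N) \<phi> / (1 + norm x) ^ Suc N"
  using schwartz_norm_upper[OF assms, of "[]" N x] schwartz_norm_upper[OF assms, of "[i]" "Suc N" x]
  by (auto simp: pos_le_divide_eq mult.commute add_pos_nonneg simp del: power_Suc)

lemma schwartz_measurable: "schwartz \<phi> \<Longrightarrow> \<phi> \<in> borel_measurable borel"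
  by (intro borel_measurable_continuous_onI smooth_continuous_on schwartz_smooth)

lemma schwartz_integrable:
  assumes "schwartz \<phi>" shows "integrable lborel \<phi>"
proof (rule Bochner_Integration.integrable_bound[OF integrable_mult_right[OF integrable_inverse_power, of "schwartz_norm 4 \<phi>"]])
  show "AE x in lborel. norm (\<phi> x) \<le> norm (schwartz_norm 4 \<phi> * (1 / (1 + norm x) ^ 4))"
    using schwartz_bound(1)[OF assms, of _ 4] schwartz_norm_nonneg[OF assms, of 4] by auto
qed (use schwartz_measurable[OF assms] in simp)

text \<open>The difference quotients with steps \<open>t \<le> 1\<close> are dominated by a multiple of
  \<open>1 / (1 + norm x) ^ 4\<close>: on the segment of length \<open>t\<close> from \<open>x\<close>, the weight \<open>1 + norm z\<close> is at
  least half of \<open>1 + norm x\<close>, which accounts for the factor \<open>16 = 2 ^ 4\<close>.\<close>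

lemma schwartz_integral_partial_deriv:
  assumes "schwartz \<phi>" shows "(LINT x|lborel. partial_deriv i \<phi> x) = 0"
proof (rule integral_derivative_zero[where K="\<lambda>x. 3 * (16 * schwartz_norm 4 \<phi>) * (1 / (1 + norm x) ^ 4)"])
  show "integrable lborel \<phi>" "partial_deriv i \<phi> \<in> borel_measurable borel"
    by (intro schwartz_integrable schwartz_measurable schwartz_partial_deriv assms)+
  show "integrable lborel (\<lambda>x::real^3. 3 * (16 * schwartz_norm 4 \<phi>) * (1 / (1 + norm x) ^ 4))"
    by (intro integrable_mult_right integrable_inverse_power)
  show "AE x in lborel. ((\<lambda>t. (\<phi> (x + t *\<^sub>R axis i 1) - \<phi> x) /\<^sub>R t) \<longlongrightarrow> partial_deriv i \<phi> x) (at_right 0)"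
    by (intro AE_I2 partial_deriv_limit smooth_differentiable schwartz_smooth assms)
  fix x and t :: real assume t: "0 < t" "t \<le> 1"
  have "norm (partial_deriv j \<phi> z) \<le> 16 * schwartz_norm 4 \<phi> / (1 + norm x) ^ 4"
    if "z \<in> closed_segment (x + t *\<^sub>R axis i 1) x" for j z
  proof -
    have "dist z x \<le> dist (x + t *\<^sub>R axis i 1) x"
      using that dist_in_closed_segment dist_commute by metis
    then have "norm x \<le> norm z + 1" using t norm_triangle_ineq2[of x z] by (simp add: dist_norm norm_minus_commute)
    moreover have "0 \<le> norm z" by simp
    ultimately have "1 + norm x \<le> 2 * (1 + norm z)" by argo
    then have "(1 + norm x) ^ 4 \<le> (2 * (1 + norm z)) ^ 4" by (intro power_mono) auto
    also have "\<dots> = 16 * (1 + norm z) ^ 4" by (simp only: power_mult_distrib) simp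
    finally have "(1 + norm x) ^ 4 * norm (partial_deriv j \<phi> z) \<le> 16 * (1 + norm z) ^ 4 * norm (partial_deriv j \<phi> z)"
      by (rule mult_right_mono) simp
    also have "\<dots> = 16 * ((1 + norm z) ^ 4 * norm (partial_deriv j \<phi> z))" by simp
    also have "\<dots> \<le> 16 * schwartz_norm 4 \<phi>"
      using schwartz_norm_upper[OF assms, of "[j]" 4 z] by simp
    finally show ?thesis by (subst pos_le_divide_eq) (auto simp: mult.commute add_nonneg_eq_0_iff)
  qed
  from smooth_mvt[OF schwartz_smooth[OF assms], of "x + t *\<^sub>R axis i 1" x, OF this]
  show "norm (\<phi> (x + t *\<^sub>R axis i 1) - \<phi> x) \<le> t * (3 * (16 * schwartz_norm 4 \<phi>) * (1 / (1 + norm x) ^ 4))"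
    using t by (simp add: mult_ac)
qed

section \<open>The inverse Fourier transform on Schwartz space\<close>

definition fourier_const :: complex where "fourier_const = complex_of_real (1 / (2 * pi) ^ 3)"

lemma cis_measurable [measurable]: "cis \<in> borel_measurable borel"
  by (rule borel_measurable_continuous_onI) (intro continuous_intros)

lemma inverse_fourier_lborel:
  assumes "\<phi> \<in> borel_measurable borel"
  shows "inverse_fourier \<phi> x = fourier_const * (LINT \<xi>|lborel. cis (x \<bullet> \<xi>) * \<phi> \<xi>)"
  unfolding inverse_fourier_def fourier_const_def
  by (subst integral_completion) (use assms in auto)

lemma integrable_cis_mult:
  assumes "integrable lborel \<phi>" shows "integrable lborel (\<lambda>\<xi>::real^3. cis (x \<bullet> \<xi>) * \<phi> \<xi>)"
  by (rule Bochner_Integration.integrable_bound[OF assms]) (use assms in \<open>auto simp: norm_mult\<close>)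

lemma cis_remainder: "norm (cis t - 1 - \<i> * of_real t) \<le> t\<^sup>2"
  using Taylor_exp[of "\<i> * of_real t" 1]
  by (simp add: cis_conv_exp norm_mult power2_eq_square diff_diff_eq)

text \<open>Differentiation under the integral sign. The remainder of order two of \<open>cis\<close> bounds the
  error by \<open>(norm h)\<^sup>2\<close> times the second moment of \<open>\<bar>\<phi>\<bar>\<close>.\<close>

lemma inverse_fourier_derivative:
  assumes "schwartz \<phi>"
  shows "inverse_fourier \<phi> differentiable (at x)"
    and "partial_deriv i (inverse_fourier \<phi>) = inverse_fourier (\<lambda>\<xi>. \<i> * (of_real (\<xi> $ i) * \<phi> \<xi>))"
proof -
  let ?I = "\<lambda>\<psi> x. LINT \<xi>|lborel. cis (x \<bullet> \<xi>) * \<psi> \<xi>"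
  let ?c = "\<lambda>i \<xi>. of_real (\<xi> $ i) * \<phi> \<xi>"
  note cs = schwartz_component(1)[OF assms]
  have ci: "integrable lborel (\<lambda>\<xi>. cis (x \<bullet> \<xi>) * (\<i> * ?c i \<xi>))" for x i
    by (intro integrable_cis_mult integrable_mult_right schwartz_integrable cs)
  define M where "M = (LINT \<xi>|lborel. (norm \<xi>)\<^sup>2 * norm (\<phi> \<xi>))"
  have Mi: "integrable lborel (\<lambda>\<xi>. (norm \<xi>)\<^sup>2 * norm (\<phi> \<xi>))"
  proof (rule Bochner_Integration.integrable_bound[OF integrable_mult_right[OF integrable_inverse_power, of "schwartz_norm 6 \<phi>"]])
    have "(norm \<xi>)\<^sup>2 * norm (\<phi> \<xi>) \<le> schwartz_norm 6 \<phi> * (1 / (1 + norm \<xi>) ^ 4)" for \<xi>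
    proof -
      have "(norm \<xi>)\<^sup>2 \<le> (1 + norm \<xi>)\<^sup>2" using power_mono[of "norm \<xi>" "1 + norm \<xi>" 2] by simp
      then have "(norm \<xi>)\<^sup>2 * norm (\<phi> \<xi>) \<le> (1 + norm \<xi>)\<^sup>2 * (schwartz_norm 6 \<phi> / (1 + norm \<xi>) ^ 6)"
        using schwartz_bound(1)[OF assms, of \<xi> 6] by (intro mult_mono) auto
      also have "\<dots> = schwartz_norm 6 \<phi> * (1 / (1 + norm \<xi>) ^ 4)"
      proof -
        have "y\<^sup>2 * (S / y ^ 6) = S * (1 / y ^ 4)" if "y \<noteq> 0" for y S :: real
          using that by (simp add: eval_nat_numeral field_simps)
        moreover have "1 + norm \<xi> \<noteq> 0" by (simp add: add_nonneg_eq_0_iff)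
        ultimately show ?thesis by blast
      qed
      finally show ?thesis .
    qed
    then show "AE \<xi> in lborel. norm ((norm \<xi>)\<^sup>2 * norm (\<phi> \<xi>)) \<le> norm (schwartz_norm 6 \<phi> * (1 / (1 + norm \<xi>) ^ 4))"
      using schwartz_norm_nonneg[OF assms, of 6] by auto
  qed (use schwartz_measurable[OF assms] in simp)
  have hd: "(?I \<phi> has_derivative (\<lambda>h. \<Sum>i\<in>UNIV. of_real (h $ i) * ?I (\<lambda>\<xi>. \<i> * ?c i \<xi>) x)) (at x)" for x
  proof (rule has_derivativeI_sandwich[where e=1 and H="\<lambda>y. norm (y - x) * M"])
    show "bounded_linear (\<lambda>h::real^3. \<Sum>i\<in>UNIV. of_real (h $ i) * ?I (\<lambda>\<xi>. \<i> * ?c i \<xi>) x)"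
      by (intro bounded_linear_sum bounded_linear_mult_left[THEN bounded_linear_compose]
          bounded_linear_of_real[THEN bounded_linear_compose] bounded_linear_vec_nth)
    show "((\<lambda>y. norm (y - x) * M) \<longlongrightarrow> 0) (at x)" by (auto intro!: tendsto_eq_intros)
    fix y assume y: "y \<noteq> x"
    let ?h = "y - x"
    let ?R = "\<lambda>\<xi>. cis (x \<bullet> \<xi>) * ((cis (?h \<bullet> \<xi>) - 1 - \<i> * of_real (?h \<bullet> \<xi>)) * \<phi> \<xi>)"
    have ip: "\<i> * of_real (?h \<bullet> \<xi>) * \<phi> \<xi> = (\<Sum>i\<in>UNIV. of_real (?h $ i) * (\<i> * ?c i \<xi>))" for \<xi>
      by (simp add: inner_vec_def sum_distrib_left sum_distrib_right mult_ac)
    have R: "?R \<xi> = cis (y \<bullet> \<xi>) * \<phi> \<xi> - cis (x \<bullet> \<xi>) * \<phi> \<xi> - (\<Sum>i\<in>UNIV. of_real (?h $ i) * (cis (x \<bullet> \<xi>) * (\<i> * ?c i \<xi>)))" for \<xi>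
    proof -
      have "cis (y \<bullet> \<xi>) = cis (x \<bullet> \<xi>) * cis (?h \<bullet> \<xi>)" by (simp add: cis_mult inner_diff_left)
      moreover have "cis (x \<bullet> \<xi>) * (\<i> * of_real (?h \<bullet> \<xi>) * \<phi> \<xi>) = (\<Sum>i\<in>UNIV. of_real (?h $ i) * (cis (x \<bullet> \<xi>) * (\<i> * ?c i \<xi>)))"
        unfolding ip by (simp add: sum_distrib_left mult_ac)
      ultimately show ?thesis by (simp add: algebra_simps)
    qed
    have "?I \<phi> y - ?I \<phi> x - (\<Sum>i\<in>UNIV. of_real (?h $ i) * ?I (\<lambda>\<xi>. \<i> * ?c i \<xi>) x) = (LINT \<xi>|lborel. ?R \<xi>)"
      unfolding R using ci[of x] integrable_cis_mult[OF schwartz_integrable[OF assms]]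
      by (subst Bochner_Integration.integral_diff, simp, simp, subst Bochner_Integration.integral_diff, simp, simp,
          subst Bochner_Integration.integral_sum) simp_all
    also have "norm \<dots> \<le> (LINT \<xi>|lborel. (norm ?h)\<^sup>2 * ((norm \<xi>)\<^sup>2 * norm (\<phi> \<xi>)))"
    proof (rule integral_norm_le)
      show "integrable lborel (\<lambda>\<xi>. (norm ?h)\<^sup>2 * ((norm \<xi>)\<^sup>2 * norm (\<phi> \<xi>)))"
        by (intro integrable_mult_right Mi)
      show "integrable lborel ?R" unfolding R
        using ci[of x] integrable_cis_mult[OF schwartz_integrable[OF assms]] by (intro Bochner_Integration.integrable_diff integrable_sum integrable_mult_right) auto
      fix \<xi>
      have "norm (?R \<xi>) \<le> (?h \<bullet> \<xi>)\<^sup>2 * norm (\<phi> \<xi>)"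
        using mult_right_mono[OF cis_remainder[of "?h \<bullet> \<xi>"], of "norm (\<phi> \<xi>)"] by (simp add: norm_mult)
      also have "(?h \<bullet> \<xi>)\<^sup>2 \<le> (norm ?h * norm \<xi>)\<^sup>2"
        using power_mono[OF Cauchy_Schwarz_ineq2[of ?h \<xi>], of 2] by simp
      then have "(?h \<bullet> \<xi>)\<^sup>2 * norm (\<phi> \<xi>) \<le> (norm ?h * norm \<xi>)\<^sup>2 * norm (\<phi> \<xi>)"
        by (intro mult_right_mono) auto
      finally show "norm (?R \<xi>) \<le> (norm ?h)\<^sup>2 * ((norm \<xi>)\<^sup>2 * norm (\<phi> \<xi>))"
        by (simp add: power_mult_distrib)
    qed
    also have "\<dots> = (norm ?h)\<^sup>2 * M" by (simp add: M_def)
    finally show "norm (?I \<phi> y - ?I \<phi> x - (\<Sum>i\<in>UNIV. of_real (?h $ i) * ?I (\<lambda>\<xi>. \<i> * ?c i \<xi>) x)) / norm ?h \<le> norm (y - x) * M"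
      using y by (simp add: divide_le_eq power2_eq_square mult_ac)
  qed simp
  have eq: "inverse_fourier \<phi> = (\<lambda>x. fourier_const * ?I \<phi> x)"
    "inverse_fourier (\<lambda>\<xi>. \<i> * ?c i \<xi>) = (\<lambda>x. fourier_const * ?I (\<lambda>\<xi>. \<i> * ?c i \<xi>) x)"
    using schwartz_measurable[OF assms] schwartz_measurable[OF cs, of i]
    by (auto simp: fun_eq_iff inverse_fourier_lborel)
  have hd': "(inverse_fourier \<phi> has_derivative (\<lambda>h. fourier_const * (\<Sum>i\<in>UNIV. of_real (h $ i) * ?I (\<lambda>\<xi>. \<i> * ?c i \<xi>) x))) (at x)" for x
    unfolding eq(1) by (rule has_derivative_mult_right[OF hd])
  then show "inverse_fourier \<phi> differentiable (at x)" unfolding differentiable_def by blast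
  show "partial_deriv i (inverse_fourier \<phi>) = inverse_fourier (\<lambda>\<xi>. \<i> * ?c i \<xi>)"
    unfolding eq(2) using partial_deriv_eq[OF hd']
    by (auto simp: fun_eq_iff axis_def if_distrib[of of_real] if_distrib[of "\<lambda>x. x * _"] cong: if_cong)
qed

lemma schwartz_cis_mult:
  assumes "schwartz \<phi>" shows "schwartz (\<lambda>\<xi>. cis (x \<bullet> \<xi>) * \<phi> \<xi>)"
    and "partial_deriv i (\<lambda>\<xi>. cis (x \<bullet> \<xi>) * \<phi> \<xi>) =
      (\<lambda>\<xi>. \<i> * of_real (x $ i) * (cis (x \<bullet> \<xi>) * \<phi> \<xi>) + cis (x \<bullet> \<xi>) * partial_deriv i \<phi> \<xi>)"
proof -
  let ?g = "\<lambda>\<xi>::real^3. cis (x \<bullet> \<xi>)"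
  have gd: "(?g has_derivative (\<lambda>h. of_real (x \<bullet> h) * (\<i> * ?g \<xi>))) (at \<xi>)" for \<xi>
  proof -
    have "bounded_linear (\<lambda>\<xi>. \<i> * complex_of_real (x \<bullet> \<xi>))"
      by (intro bounded_linear_mult_right[THEN bounded_linear_compose]
        bounded_linear_of_real[THEN bounded_linear_compose] bounded_linear_inner_right)
    from has_derivative_compose[OF bounded_linear_imp_has_derivative[OF this]
        DERIV_exp[unfolded has_field_derivative_def]]
    show ?thesis by (simp add: cis_conv_exp mult_ac)
  qed
  have d: "(\<lambda>\<xi>. c * ?g \<xi>) differentiable (at \<xi>)" for c \<xi>
    using has_derivative_mult_right[OF gd] unfolding differentiable_def by blast
  have pd: "partial_deriv j (\<lambda>\<xi>. c * ?g \<xi>) = (\<lambda>\<xi>. (c * \<i> * of_real (x $ j)) * ?g \<xi>)" for c j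
    using partial_deriv_eq[OF has_derivative_mult_right[OF gd]] by (auto simp: fun_eq_iff inner_axis mult_ac)
  have sm: "smooth ?g"
  proof (rule smooth_coinduct[where S="range (\<lambda>c \<xi>. c * ?g \<xi>)"])
    show "?g \<in> range (\<lambda>c \<xi>. c * ?g \<xi>)" by (rule range_eqI[where x=1]) simp
  qed (use d pd in auto)
  have "\<exists>c. partial_derivs js ?g = (\<lambda>\<xi>. c * ?g \<xi>)" for js
  proof (induction js)
    case Nil then show ?case by (intro exI[of _ 1]) simp
  next
    case (Cons j js) then show ?case using pd by auto
  qed
  then obtain c where c: "\<And>js. partial_derivs js ?g = (\<lambda>\<xi>. c js * ?g \<xi>)" by metis
  show "schwartz (\<lambda>\<xi>. ?g \<xi> * \<phi> \<xi>)"
  proof (rule schwartz_mult[OF sm _ assms])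
    fix N :: nat
    let ?K = "\<Sum>js\<in>{js. length js \<le> N}. norm (c js)"
    have "norm (partial_derivs a ?g \<xi>) \<le> ?K * (1 + norm \<xi>)" if "length a \<le> N" for a \<xi>
    proof -
      have "norm (c a) \<le> ?K" using that by (intro member_le_sum finite_multi_indices) auto
      moreover have "?K * 1 \<le> ?K * (1 + norm \<xi>)" by (intro mult_left_mono sum_nonneg) auto
      ultimately show ?thesis by (simp add: c norm_mult)
    qed
    then show "\<exists>K. \<forall>a \<xi>. length a \<le> N \<longrightarrow> norm (partial_derivs a ?g \<xi>) \<le> K * (1 + norm \<xi>)" by blast
  qed
  have "partial_deriv i ?g = (\<lambda>\<xi>. (\<i> * of_real (x $ i)) * ?g \<xi>)"
    using pd[of i 1] by simp
  then show "partial_deriv i (\<lambda>\<xi>. ?g \<xi> * \<phi> \<xi>) =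
      (\<lambda>\<xi>. \<i> * of_real (x $ i) * (?g \<xi> * \<phi> \<xi>) + ?g \<xi> * partial_deriv i \<phi> \<xi>)"
    using partial_deriv_mult[OF smooth_differentiable[OF sm] smooth_differentiable[OF schwartz_smooth[OF assms]]]
    by (simp add: fun_eq_iff mult_ac)
qed

text \<open>Integration by parts, applied to the Schwartz function \<open>cis (x \<bullet> \<xi>) * \<phi> \<xi>\<close>.\<close>

lemma inverse_fourier_component:
  assumes "schwartz \<phi>"
  shows "of_real (x $ i) * inverse_fourier \<phi> x = inverse_fourier (\<lambda>\<xi>. \<i> * partial_deriv i \<phi> \<xi>) x"
proof -
  note d = schwartz_partial_deriv(1)[OF assms]
  have "0 = (LINT \<xi>|lborel. \<i> * of_real (x $ i) * (cis (x \<bullet> \<xi>) * \<phi> \<xi>) + cis (x \<bullet> \<xi>) * partial_deriv i \<phi> \<xi>)"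
    using schwartz_integral_partial_deriv[OF schwartz_cis_mult(1)[OF assms, of x], of i]
    unfolding schwartz_cis_mult(2)[OF assms] by simp
  also have "\<dots> = \<i> * of_real (x $ i) * (LINT \<xi>|lborel. cis (x \<bullet> \<xi>) * \<phi> \<xi>) + (LINT \<xi>|lborel. cis (x \<bullet> \<xi>) * partial_deriv i \<phi> \<xi>)"
    by (subst Bochner_Integration.integral_add)
       (intro integrable_mult_right integrable_cis_mult schwartz_integrable assms d | simp)+
  finally have "of_real (x $ i) * (LINT \<xi>|lborel. cis (x \<bullet> \<xi>) * \<phi> \<xi>) = \<i> * (LINT \<xi>|lborel. cis (x \<bullet> \<xi>) * partial_deriv i \<phi> \<xi>)"
    (is "_ * ?A = \<i> * ?B")
  proof -
    assume "0 = \<i> * of_real (x $ i) * ?A + ?B"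
    then have "\<i> * (\<i> * of_real (x $ i) * ?A + ?B) = 0" by simp
    then show ?thesis by (simp add: algebra_simps)
  qed
  also have "\<dots> = (LINT \<xi>|lborel. cis (x \<bullet> \<xi>) * (\<i> * partial_deriv i \<phi> \<xi>))"
    by (simp add: mult.left_commute[of _ \<i>])
  finally show ?thesis
    using schwartz_measurable[OF assms] schwartz_measurable[OF d, of i]
    by (simp add: inverse_fourier_lborel mult.left_commute)
qed

text \<open>Continuity on Schwartz space, in terms of the defining norms.\<close>

definition schwartz_op :: "((real^3 \<Rightarrow> complex) \<Rightarrow> real^3 \<Rightarrow> complex) \<Rightarrow> bool" where
  "schwartz_op A \<longleftrightarrow> (\<forall>\<phi>. schwartz \<phi> \<longrightarrow> schwartz (A \<phi>)) \<and>
     (\<forall>N. \<exists>M C. 0 \<le> C \<and> (\<forall>\<phi>. schwartz \<phi> \<longrightarrow> schwartz_norm N (A \<phi>) \<le> C * schwartz_norm M \<phi>))"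

lemma schwartz_opD: "schwartz_op A \<Longrightarrow> schwartz \<phi> \<Longrightarrow> schwartz (A \<phi>)"
  by (simp add: schwartz_op_def)

lemma schwartz_op_bound:
  assumes "schwartz_op A"
  obtains M C where "0 \<le> C" "\<And>\<phi>. schwartz \<phi> \<Longrightarrow> schwartz_norm N (A \<phi>) \<le> C * schwartz_norm M \<phi>"
  using assms unfolding schwartz_op_def by blast

lemma schwartz_op_compose:
  assumes "schwartz_op A" "schwartz_op B" shows "schwartz_op (\<lambda>\<phi>. A (B \<phi>))"
  unfolding schwartz_op_def
proof (intro conjI allI impI)
  fix N
  obtain M C where A: "0 \<le> C" "\<And>\<phi>. schwartz \<phi> \<Longrightarrow> schwartz_norm N (A \<phi>) \<le> C * schwartz_norm M \<phi>"
    using schwartz_op_bound[OF assms(1)] by metis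
  obtain M' C' where B: "0 \<le> C'" "\<And>\<phi>. schwartz \<phi> \<Longrightarrow> schwartz_norm M (B \<phi>) \<le> C' * schwartz_norm M' \<phi>"
    using schwartz_op_bound[OF assms(2)] by metis
  have "schwartz_norm N (A (B \<phi>)) \<le> (C * C') * schwartz_norm M' \<phi>" if "schwartz \<phi>" for \<phi>
    using order_trans[OF A(2)[OF schwartz_opD[OF assms(2) that]] mult_left_mono[OF B(2)[OF that] A(1)]]
    by (simp add: mult.assoc)
  then show "\<exists>M C. 0 \<le> C \<and> (\<forall>\<phi>. schwartz \<phi> \<longrightarrow> schwartz_norm N (A (B \<phi>)) \<le> C * schwartz_norm M \<phi>)"
    using A(1) B(1) mult_nonneg_nonneg by blast
qed (use assms in \<open>auto intro: schwartz_opD\<close>)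

lemma schwartz_op_id: "schwartz_op (\<lambda>\<phi>. \<phi>)"
  unfolding schwartz_op_def
proof (intro conjI allI impI)
  fix N
  show "\<exists>M C. 0 \<le> C \<and> (\<forall>\<phi>. schwartz \<phi> \<longrightarrow> schwartz_norm N \<phi> \<le> C * schwartz_norm M \<phi>)"
    by (intro exI[of _ N] exI[of _ 1]) simp
qed

lemma schwartz_op_partial_deriv: "schwartz_op (partial_deriv i)"
  unfolding schwartz_op_def
proof (intro conjI allI impI)
  fix N
  show "\<exists>M C. 0 \<le> C \<and> (\<forall>\<phi>. schwartz \<phi> \<longrightarrow> schwartz_norm N (partial_deriv i \<phi>) \<le> C * schwartz_norm M \<phi>)"
    by (rule exI[of _ "Suc N"], rule exI[of _ 1]) (simp add: schwartz_partial_deriv)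
qed (rule schwartz_partial_deriv)

lemma schwartz_op_component: "schwartz_op (\<lambda>\<phi> \<xi>. of_real (\<xi> $ i) * \<phi> \<xi>)"
  unfolding schwartz_op_def
proof (intro conjI allI impI)
  fix N
  show "\<exists>M C. 0 \<le> C \<and> (\<forall>\<phi>. schwartz \<phi> \<longrightarrow> schwartz_norm N (\<lambda>\<xi>. of_real (\<xi> $ i) * \<phi> \<xi>) \<le> C * schwartz_norm M \<phi>)"
    by (rule exI[of _ "Suc N"], rule exI[of _ "2 ^ N"]) (simp add: schwartz_component)
qed (rule schwartz_component)

lemma schwartz_op_cmult: "schwartz_op (\<lambda>\<phi> \<xi>. c * \<phi> \<xi>)"
  unfolding schwartz_op_def
proof (intro conjI allI impI)
  fix N
  have "schwartz_norm N (\<lambda>\<xi>. c * \<phi> \<xi>) \<le> norm c * schwartz_norm N \<phi>" if "schwartz \<phi>" for \<phi>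
  proof (rule schwartz_norm_le)
    fix js :: "3 list" and x :: "real^3" assume "length js \<le> N"
    from mult_left_mono[OF schwartz_norm_upper[OF that this, of x], of "norm c"]
    show "(1 + norm x) ^ N * norm (partial_derivs js (\<lambda>\<xi>. c * \<phi> \<xi>) x) \<le> norm c * schwartz_norm N \<phi>"
      by (simp add: partial_derivs_cmult[OF schwartz_smooth[OF that]] norm_mult mult_ac)
  qed
  then show "\<exists>M C. 0 \<le> C \<and> (\<forall>\<phi>. schwartz \<phi> \<longrightarrow> schwartz_norm N (\<lambda>\<xi>. c * \<phi> \<xi>) \<le> C * schwartz_norm M \<phi>)"
    by (intro exI[of _ N] exI[of _ "norm c"]) auto
qed (rule schwartz_cmult)

lemma schwartz_norm_mono:
  assumes "schwartz \<phi>" "N \<le> M" shows "schwartz_norm N \<phi> \<le> schwartz_norm M \<phi>"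
proof (rule schwartz_norm_le)
  fix js :: "3 list" and x :: "real^3" assume "length js \<le> N"
  then have "(1 + norm x) ^ M * norm (partial_derivs js \<phi> x) \<le> schwartz_norm M \<phi>"
    using assms by (intro schwartz_norm_upper) auto
  moreover have "(1 + norm x) ^ N * norm (partial_derivs js \<phi> x) \<le> (1 + norm x) ^ M * norm (partial_derivs js \<phi> x)"
    using assms by (intro mult_right_mono power_increasing) auto
  ultimately show "(1 + norm x) ^ N * norm (partial_derivs js \<phi> x) \<le> schwartz_norm M \<phi>" by linarith
qed

lemma inverse_fourier_sup_bound:
  obtains C where "0 \<le> C" "\<And>\<phi> x. schwartz \<phi> \<Longrightarrow> norm (inverse_fourier \<phi> x) \<le> C * schwartz_norm 4 \<phi>"
proof -
  let ?J = "LINT \<xi>|lborel. 1 / (1 + norm (\<xi>::real^3)) ^ 4"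
  have J: "0 \<le> ?J" by (intro integral_nonneg_AE) auto
  have "norm (inverse_fourier \<phi> x) \<le> (norm fourier_const * ?J) * schwartz_norm 4 \<phi>" if "schwartz \<phi>" for \<phi> x
  proof -
    have "norm (LINT \<xi>|lborel. cis (x \<bullet> \<xi>) * \<phi> \<xi>) \<le> (LINT \<xi>|lborel. schwartz_norm 4 \<phi> * (1 / (1 + norm (\<xi>::real^3)) ^ 4))"
      by (rule integral_norm_le[OF integrable_cis_mult[OF schwartz_integrable[OF that]]
            integrable_mult_right[OF integrable_inverse_power]])
         (use schwartz_bound(1)[OF that, of _ 4] in \<open>simp add: norm_mult\<close>)
    then have "norm (LINT \<xi>|lborel. cis (x \<bullet> \<xi>) * \<phi> \<xi>) \<le> schwartz_norm 4 \<phi> * ?J"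
      by (simp only: integral_mult_right_zero)
    from mult_left_mono[OF this, of "norm fourier_const"] show ?thesis
      by (simp add: inverse_fourier_lborel[OF schwartz_measurable[OF that]] norm_mult mult_ac)
  qed
  then show ?thesis using that[of "norm fourier_const * ?J"] J by simp
qed

text \<open>A polynomial weight is bounded by powers of the coordinates. Multiplication by these
  corresponds to differentiation under the Fourier transform, which is not the case for
  \<open>norm x\<close>.\<close>

lemma weight_bound: "(1 + norm (x::real^3)) ^ N \<le> 4 ^ N * (1 + (\<Sum>i\<in>UNIV. \<bar>x $ i\<bar> ^ N))"
proof -
  define m where "m = Max (insert 1 (range (\<lambda>i. \<bar>x $ i\<bar>)))"
  have m: "1 \<le> m" "\<bar>x $ i\<bar> \<le> m" for i unfolding m_def by (rule Max_ge; simp)+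
  have "m \<in> insert 1 (range (\<lambda>i. \<bar>x $ i\<bar>))" unfolding m_def by (intro Max_in) auto
  then have mN: "m ^ N \<le> 1 + (\<Sum>i\<in>UNIV. \<bar>x $ i\<bar> ^ N)"
  proof
    assume "m = 1" then show ?thesis by (simp add: sum_nonneg)
  next
    assume "m \<in> range (\<lambda>i. \<bar>x $ i\<bar>)"
    then obtain i where i: "m = \<bar>x $ i\<bar>" by auto
    have "\<bar>x $ i\<bar> ^ N \<le> (\<Sum>i\<in>UNIV. \<bar>x $ i\<bar> ^ N)" by (intro member_le_sum) auto
    with i show ?thesis by simp
  qed
  have "norm x \<le> (\<Sum>i\<in>UNIV. \<bar>x $ i\<bar>)" by (rule norm_le_l1_cart)
  also have "\<dots> \<le> (\<Sum>i\<in>(UNIV::3 set). m)" by (intro sum_mono m)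
  finally have "1 + norm x \<le> 4 * m" using m(1) by simp
  then have "(1 + norm x) ^ N \<le> (4 * m) ^ N" by (intro power_mono) auto
  also have "\<dots> \<le> 4 ^ N * (1 + (\<Sum>i\<in>UNIV. \<bar>x $ i\<bar> ^ N))"
    unfolding power_mult_distrib by (intro mult_left_mono mN) auto
  finally show ?thesis .
qed

text \<open>Derivatives and coordinate multiplications of the inverse transform are inverse transforms
  of continuous images of \<open>\<phi>\<close>, and an inverse transform is bounded by the norm of order \<open>4\<close>.
  There are finitely many derivatives up to a given order, so the sum of the resulting orders
  and the sum of the constants serve for all of them.\<close>

lemma schwartz_op_inverse_fourier: "schwartz_op inverse_fourier"
proof -
  have "\<exists>A. schwartz_op A \<and> (\<forall>\<phi>. schwartz \<phi> \<longrightarrow> partial_derivs js (inverse_fourier \<phi>) = inverse_fourier (A \<phi>))" for js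
  proof (induction js)
    case Nil show ?case using schwartz_op_id by (intro exI[of _ "\<lambda>\<phi>. \<phi>"]) simp
  next
    case (Cons j js)
    then obtain A where A: "schwartz_op A" "\<And>\<phi>. schwartz \<phi> \<Longrightarrow> partial_derivs js (inverse_fourier \<phi>) = inverse_fourier (A \<phi>)"
      by blast
    have "schwartz_op (\<lambda>\<phi> \<xi>. \<i> * (of_real (\<xi> $ j) * A \<phi> \<xi>))"
      using schwartz_op_compose[OF schwartz_op_compose[OF schwartz_op_cmult schwartz_op_component] A(1)] .
    with A show ?case
      by (intro exI[of _ "\<lambda>\<phi> \<xi>. \<i> * (of_real (\<xi> $ j) * A \<phi> \<xi>)"])
         (auto simp: inverse_fourier_derivative(2) schwartz_opD)
  qed
  then obtain A where A: "\<And>js. schwartz_op (A js)"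
    "\<And>js \<phi>. schwartz \<phi> \<Longrightarrow> partial_derivs js (inverse_fourier \<phi>) = inverse_fourier (A js \<phi>)" by metis
  have "\<exists>B. schwartz_op B \<and> (\<forall>\<phi> x. schwartz \<phi> \<longrightarrow> of_real (x $ i) ^ n * inverse_fourier \<phi> x = inverse_fourier (B \<phi>) x)" for i n
  proof (induction n)
    case 0 show ?case using schwartz_op_id by (intro exI[of _ "\<lambda>\<phi>. \<phi>"]) simp
  next
    case (Suc n)
    then obtain B where B: "schwartz_op B" "\<And>\<phi> x. schwartz \<phi> \<Longrightarrow> of_real (x $ i) ^ n * inverse_fourier \<phi> x = inverse_fourier (B \<phi>) x"
      by blast
    have "schwartz_op (\<lambda>\<phi> \<xi>. \<i> * partial_deriv i (B \<phi>) \<xi>)"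
      using schwartz_op_compose[OF schwartz_op_compose[OF schwartz_op_cmult schwartz_op_partial_deriv] B(1)] .
    with B show ?case
      by (intro exI[of _ "\<lambda>\<phi> \<xi>. \<i> * partial_deriv i (B \<phi>) \<xi>"])
         (auto simp: mult.assoc inverse_fourier_component[symmetric] schwartz_opD)
  qed
  then obtain B where B: "\<And>i n. schwartz_op (B i n)"
    "\<And>i n \<phi> x. schwartz \<phi> \<Longrightarrow> of_real (x $ i) ^ n * inverse_fourier \<phi> x = inverse_fourier (B i n \<phi>) x" by metis
  obtain C0 where C0: "0 \<le> C0" "\<And>\<phi> x. schwartz \<phi> \<Longrightarrow> norm (inverse_fourier \<phi> x) \<le> C0 * schwartz_norm 4 \<phi>"
    using inverse_fourier_sup_bound by metis
  have key: "\<exists>M C. 0 \<le> C \<and> (\<forall>\<phi> x. schwartz \<phi> \<longrightarrow>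
      (1 + norm x) ^ N * norm (partial_derivs js (inverse_fourier \<phi>) x) \<le> C * schwartz_norm M \<phi>)" for N js
  proof -
    obtain M C where MC: "0 \<le> C" "\<And>\<phi>. schwartz \<phi> \<Longrightarrow> schwartz_norm 4 (A js \<phi>) \<le> C * schwartz_norm M \<phi>"
      using schwartz_op_bound[OF A(1)] by metis
    have "\<forall>i. \<exists>M C. 0 \<le> C \<and> (\<forall>\<phi>. schwartz \<phi> \<longrightarrow> schwartz_norm 4 (B i N (A js \<phi>)) \<le> C * schwartz_norm M \<phi>)"
      using schwartz_op_compose[OF B(1) A(1)] unfolding schwartz_op_def by blast
    then obtain Mi Ci where Mi: "\<And>i. 0 \<le> Ci i"
      "\<And>i \<phi>. schwartz \<phi> \<Longrightarrow> schwartz_norm 4 (B i N (A js \<phi>)) \<le> Ci i * schwartz_norm (Mi i) \<phi>" by metis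
    define M' where "M' = M + (\<Sum>i\<in>UNIV. Mi i)"
    have "(1 + norm x) ^ N * norm (partial_derivs js (inverse_fourier \<phi>) x) \<le>
        (4 ^ N * C0 * (C + (\<Sum>i\<in>UNIV. Ci i))) * schwartz_norm M' \<phi>" if "schwartz \<phi>" for \<phi> x
    proof -
      let ?u = "inverse_fourier (A js \<phi>) x"
      note sA = schwartz_opD[OF A(1) that]
      have u: "norm ?u \<le> C0 * (C * schwartz_norm M' \<phi>)"
      proof -
        have "schwartz_norm 4 (A js \<phi>) \<le> C * schwartz_norm M' \<phi>"
          by (rule order_trans[OF MC(2)[OF that] mult_left_mono[OF schwartz_norm_mono[OF that] MC(1)]])
             (simp add: M'_def)
        then show ?thesis using order_trans[OF C0(2)[OF sA] mult_left_mono[OF _ C0(1)]] by blast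
      qed
      have ui: "\<bar>x $ i\<bar> ^ N * norm ?u \<le> C0 * (Ci i * schwartz_norm M' \<phi>)" for i
      proof -
        have "Mi i \<le> (\<Sum>i\<in>UNIV. Mi i)" by (intro member_le_sum) auto
        then have "schwartz_norm 4 (B i N (A js \<phi>)) \<le> Ci i * schwartz_norm M' \<phi>"
          by (intro order_trans[OF Mi(2)[OF that] mult_left_mono[OF schwartz_norm_mono[OF that] Mi(1)]])
             (simp add: M'_def)
        then have "norm (inverse_fourier (B i N (A js \<phi>)) x) \<le> C0 * (Ci i * schwartz_norm M' \<phi>)"
          using order_trans[OF C0(2)[OF schwartz_opD[OF B(1) sA]] mult_left_mono[OF _ C0(1)]] by blast
        then show ?thesis unfolding B(2)[OF sA, symmetric] by (simp add: norm_mult norm_power)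
      qed
      have "(1 + norm x) ^ N * norm ?u \<le> 4 ^ N * (1 + (\<Sum>i\<in>UNIV. \<bar>x $ i\<bar> ^ N)) * norm ?u"
        by (intro mult_right_mono weight_bound) auto
      also have "\<dots> = 4 ^ N * (norm ?u + (\<Sum>i\<in>UNIV. \<bar>x $ i\<bar> ^ N * norm ?u))"
        by (simp add: distrib_left distrib_right sum_distrib_right)
      also have "\<dots> \<le> 4 ^ N * (C0 * (C * schwartz_norm M' \<phi>) + (\<Sum>i\<in>UNIV. C0 * (Ci i * schwartz_norm M' \<phi>)))"
        by (intro mult_left_mono add_mono u ui sum_mono) auto
      also have "\<dots> = (4 ^ N * C0 * (C + (\<Sum>i\<in>UNIV. Ci i))) * schwartz_norm M' \<phi>"
        by (simp add: sum_distrib_left sum_distrib_right distrib_left distrib_right mult_ac)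
      finally show ?thesis by (simp add: A(2)[OF that])
    qed
    moreover have "0 \<le> 4 ^ N * C0 * (C + (\<Sum>i\<in>UNIV. Ci i))"
      using C0 MC Mi by (intro mult_nonneg_nonneg add_nonneg_nonneg sum_nonneg) auto
    ultimately show ?thesis by blast
  qed
  have sm: "smooth (inverse_fourier \<phi>)" if "schwartz \<phi>" for \<phi>
    unfolding smooth_def using A inverse_fourier_derivative(1) that schwartz_opD by metis
  have sch: "schwartz (inverse_fourier \<phi>)" if "schwartz \<phi>" for \<phi>
    unfolding schwartz_iff using sm[OF that] key that by meson
  have "\<exists>M C. 0 \<le> C \<and> (\<forall>\<phi>. schwartz \<phi> \<longrightarrow> schwartz_norm N (inverse_fourier \<phi>) \<le> C * schwartz_norm M \<phi>)" for N
  proof -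
    from key[of N] obtain M C where MC: "\<And>js. 0 \<le> C js"
      "\<And>js \<phi> x. schwartz \<phi> \<Longrightarrow> (1 + norm x) ^ N * norm (partial_derivs js (inverse_fourier \<phi>) x) \<le> C js * schwartz_norm (M js) \<phi>"
      by metis
    let ?S = "{js::3 list. length js \<le> N}"
    define M' where "M' = sum M ?S"
    define C' where "C' = sum C ?S"
    have "schwartz_norm N (inverse_fourier \<phi>) \<le> C' * schwartz_norm M' \<phi>" if s: "schwartz \<phi>" for \<phi>
    proof (rule schwartz_norm_le)
      fix js :: "3 list" and x :: "real^3" assume js: "length js \<le> N"
      have "M js \<le> M'" "C js \<le> C'" unfolding M'_def C'_def
        using js MC(1) by (auto intro!: member_le_sum finite_multi_indices)
      then have "C js * schwartz_norm (M js) \<phi> \<le> C' * schwartz_norm M' \<phi>"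
        using MC(1)[of js] by (intro mult_mono schwartz_norm_mono s schwartz_norm_nonneg) auto
      with MC(2)[OF s, of x js] show "(1 + norm x) ^ N * norm (partial_derivs js (inverse_fourier \<phi>) x) \<le> C' * schwartz_norm M' \<phi>"
        by linarith
    qed
    moreover have "0 \<le> C'" unfolding C'_def by (intro sum_nonneg MC)
    ultimately show ?thesis by blast
  qed
  with sch show ?thesis unfolding schwartz_op_def by blast
qed

lemma tempered_inverse_fourier_distribution:
  assumes T: "tempered_distribution T" shows "tempered_distribution (inverse_fourier_distribution T)"
proof -
  note IF = schwartz_opD[OF schwartz_op_inverse_fourier]
  have add: "inverse_fourier (\<lambda>x. \<phi> x + \<psi> x) = (\<lambda>x. inverse_fourier \<phi> x + inverse_fourier \<psi> x)"
    if "schwartz \<phi>" "schwartz \<psi>" for \<phi> \<psi>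
    using that by (auto simp: fun_eq_iff inverse_fourier_lborel schwartz_measurable schwartz_add distrib_left
       Bochner_Integration.integral_add integrable_cis_mult schwartz_integrable)
  have cm: "inverse_fourier (\<lambda>x. a * \<phi> x) = (\<lambda>x. a * inverse_fourier \<phi> x)" if "schwartz \<phi>" for a \<phi>
    using that by (auto simp: fun_eq_iff inverse_fourier_lborel schwartz_measurable schwartz_cmult mult.left_commute[of _ a])
  obtain N C where C: "0 \<le> C" "\<And>\<phi>. schwartz \<phi> \<Longrightarrow> norm (T \<phi>) \<le> C * schwartz_norm N \<phi>"
    using tempered_distribution_bound[OF T] by metis
  obtain M C' where C': "0 \<le> C'" "\<And>\<phi>. schwartz \<phi> \<Longrightarrow> schwartz_norm N (inverse_fourier \<phi>) \<le> C' * schwartz_norm M \<phi>"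
    using schwartz_op_bound[OF schwartz_op_inverse_fourier] by metis
  have "norm (T (inverse_fourier \<phi>)) \<le> (C * C') * schwartz_norm M \<phi>" if "schwartz \<phi>" for \<phi>
    using order_trans[OF C(2)[OF IF[OF that]] mult_left_mono[OF C'(2)[OF that] C(1)]] by (simp add: mult.assoc)
  then show ?thesis
    using T unfolding tempered_distribution_def inverse_fourier_distribution_def
    by (auto simp: add cm IF)
qed

section \<open>The surface measure and the divergence theorem on the ball\<close>

lemma integral_scale:
  fixes f :: "real^3 \<Rightarrow> 'b::{banach, second_countable_topology}"
  assumes [measurable]: "f \<in> borel_measurable borel" and c: "0 < c"
  shows "(LINT x|lborel. f x) = c ^ 3 *\<^sub>R (LINT x|lborel. f (c *\<^sub>R x))"
proof -
  have "integral\<^sup>L lborel f = integral\<^sup>L (density (distr lborel borel (\<lambda>x. 0 + c *\<^sub>R x)) (\<lambda>_. ennreal (\<bar>c\<bar> ^ 3))) f"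
    using lborel_affine[of c "0::real^3"] c by simp
  also have "\<dots> = integral\<^sup>L (distr lborel borel (\<lambda>x. 0 + c *\<^sub>R x)) (\<lambda>x. \<bar>c\<bar> ^ 3 *\<^sub>R f x)"
    by (subst integral_density) auto
  also have "\<dots> = (LINT x|lborel. \<bar>c\<bar> ^ 3 *\<^sub>R f (c *\<^sub>R x))"
    by (subst integral_distr) auto
  finally show ?thesis using c by simp
qed

lemma sgn_measurable [measurable]: "sgn \<in> borel_measurable (borel :: (real^3) measure)"
  unfolding sgn_div_norm by measurable

text \<open>A function of the direction \<open>sgn x\<close> is invariant under dilation, so its integral over a
  ball is proportional to the volume.\<close>

lemma integral_degree_zero_ball:
  fixes f :: "real^3 \<Rightarrow> real"
  assumes [measurable]: "f \<in> borel_measurable borel" and r: "0 < r"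
  shows "(LINT x|lborel. indicator (ball 0 r) x * f (sgn x)) =
    r ^ 3 * (LINT x|lborel. indicator unit_ball x * f (sgn x))"
proof -
  have "(LINT x|lborel. indicator (ball 0 r) x * f (sgn x)) =
     r ^ 3 *\<^sub>R (LINT x|lborel. indicator (ball 0 r) (r *\<^sub>R x) * f (sgn (r *\<^sub>R x)))"
    by (intro integral_scale[OF _ r] borel_measurable_times borel_measurable_indicator
          measurable_compose[OF sgn_measurable assms(1)]) auto
  also have "(\<lambda>x::real^3. indicator (ball 0 r) (r *\<^sub>R x) * f (sgn (r *\<^sub>R x))) = (\<lambda>x. indicator unit_ball x * f (sgn x))"
    using r by (auto simp: indicator_def fun_eq_iff sgn_scaleR)
  finally show ?thesis by simp
qed

lemma scale_measure_density: "scale_measure r M = density M (\<lambda>_. r)"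
  by (rule measure_eqI) (auto simp: emeasure_density_const)

lemma AE_nonzero: "AE x in lborel. x \<noteq> (0 :: real^3)"
  by (rule AE_lborel_singleton)

lemma sphere_integral:
  fixes f :: "real^3 \<Rightarrow> real"
  assumes [measurable]: "f \<in> borel_measurable borel"
  shows "(LINT x|sphere_measure. f x) = 3 * (LINT x|lborel. indicator unit_ball x * f (sgn x))"
proof -
  have ball: "unit_ball \<inter> space lborel \<in> sets lborel" by simp
  have [measurable]: "sphere (0::real^3) 1 \<in> sets borel" by (intro borel_closed) auto
  have [measurable]: "sgn \<in> measurable (restrict_space lborel unit_ball) (borel :: (real^3) measure)"
    by (rule measurable_restrict_space1) simp
  have "(LINT x|sphere_measure. f x) =
    integral\<^sup>L (scale_measure 3 (distr (restrict_space lborel unit_ball) borel sgn)) (\<lambda>x. indicator (sphere 0 1) x *\<^sub>R f x)"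
    unfolding sphere_measure_def by (subst integral_restrict_space) auto
  also have "\<dots> = integral\<^sup>L (density (distr (restrict_space lborel unit_ball) borel sgn) (\<lambda>_. ennreal 3)) (\<lambda>x. indicator (sphere 0 1) x *\<^sub>R f x)"
    by (simp add: scale_measure_density)
  also have "\<dots> = 3 * integral\<^sup>L (distr (restrict_space lborel unit_ball) borel sgn) (\<lambda>x. indicator (sphere 0 1) x *\<^sub>R f x)"
    by (subst integral_density) auto
  also have "\<dots> = 3 * (LINT x|restrict_space lborel unit_ball. indicator (sphere 0 1) (sgn x) *\<^sub>R f (sgn x))"
    by (subst integral_distr) auto
  also have "\<dots> = 3 * (LINT x|lborel. indicator unit_ball x *\<^sub>R (indicator (sphere 0 1) (sgn x) *\<^sub>R f (sgn x)))"
    by (subst integral_restrict_space[OF ball]) auto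
  also have "\<dots> = 3 * (LINT x|lborel. indicator unit_ball x * f (sgn x))"
  proof -
    have "AE x in lborel. indicator unit_ball x *\<^sub>R (indicator (sphere 0 1) (sgn x) *\<^sub>R f (sgn x)) = indicator unit_ball x * f (sgn (x::real^3))"
      using AE_nonzero by eventually_elim (auto simp: indicator_def norm_sgn)
    moreover have m: "(\<lambda>x. indicator unit_ball x *\<^sub>R (indicator (sphere 0 1) (sgn x) *\<^sub>R f (sgn x))) \<in> borel_measurable lborel"
      "(\<lambda>x. indicator unit_ball x * f (sgn x)) \<in> borel_measurable lborel"
      unfolding measurable_lborel1 real_scaleR_def
      by (intro borel_measurable_times borel_measurable_indicator measurable_compose[OF sgn_measurable assms]
          measurable_compose[OF sgn_measurable borel_measurable_indicator]; simp)+
    ultimately show ?thesis using integral_cong_AE[OF m] by (simp only:)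
  qed
  finally show ?thesis .
qed

text \<open>The total mass is that of three unit balls.\<close>

lemma emeasure_sphere_measure: "emeasure sphere_measure (space sphere_measure) < \<infinity>"
proof -
  have [measurable]: "sgn \<in> measurable (restrict_space lborel unit_ball) (borel :: (real^3) measure)"
    by (rule measurable_restrict_space1) simp
  have "emeasure sphere_measure (space sphere_measure) \<le>
     emeasure (scale_measure 3 (distr (restrict_space lborel unit_ball) borel sgn)) (sphere (0::real^3) 1)"
    unfolding sphere_measure_def by (subst emeasure_restrict_space) (auto simp: space_restrict_space)
  also have "\<dots> \<le> 3 * emeasure (restrict_space lborel unit_ball) (space (restrict_space lborel unit_ball) :: (real^3) set)"
    using sets.top[of "restrict_space lborel (unit_ball)"]
    by (auto simp: emeasure_distr space_restrict_space intro!: mult_left_mono emeasure_mono)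
  also have "\<dots> = 3 * emeasure lborel unit_ball"
    by (subst emeasure_restrict_space) (auto simp: space_restrict_space)
  also have "\<dots> < \<infinity>"
    using emeasure_lborel_ball_finite[of "0::real^3" 1] by (auto simp: ennreal_mult_less_top)
  finally show ?thesis .
qed

interpretation sphere: finite_measure sphere_measure
  by standard (use emeasure_sphere_measure in simp)

lemma space_sphere_measure [simp]: "space sphere_measure = sphere 0 1"
  by (simp add: sphere_measure_def space_restrict_space)

lemma sphere_measurable:
  assumes [measurable]: "f \<in> borel_measurable borel" shows "f \<in> borel_measurable sphere_measure"
  unfolding sphere_measure_def by (rule measurable_restrict_space1) simp

lemma sphere_integrable:
  fixes f :: "real^3 \<Rightarrow> real"
  assumes "continuous_on UNIV f" shows "integrable sphere_measure f"
proof -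
  have "compact (f ` sphere 0 1)"
    by (intro compact_continuous_image continuous_on_subset[OF assms]) auto
  then obtain B where "\<And>x. x \<in> sphere 0 1 \<Longrightarrow> norm (f x) \<le> B"
    using compact_imp_bounded bounded_iff by (metis imageI)
  then show ?thesis
    by (intro sphere.integrable_const_bound[where B=B] AE_I2 sphere_measurable borel_measurable_continuous_onI assms) auto
qed

lemma sphere_null: "sphere 0 r \<in> null_sets (lborel :: (real^3) measure)"
proof -
  have "sphere (0::real^3) r \<in> null_sets lebesgue"
    using negligible_sphere negligible_iff_null_sets by blast
  then show ?thesis by (subst (asm) null_sets_completion_iff) auto
qed

lemma continuous_bounded_cball:
  fixes f :: "real^3 \<Rightarrow> real"
  assumes "continuous_on UNIV f"
  shows "\<exists>B. \<forall>x. norm x \<le> R \<longrightarrow> \<bar>f x\<bar> \<le> B"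
proof -
  have "bounded (f ` cball 0 R)"
    by (intro compact_imp_bounded compact_continuous_image continuous_on_subset[OF assms]) auto
  then obtain B where "\<forall>x\<in>cball 0 R. norm (f x) \<le> B" by (auto simp: bounded_iff)
  then show ?thesis by (intro exI[of _ B]) auto
qed

text \<open>A Lipschitz approximation of the indicator of the unit ball that decreases from \<open>1\<close> on the
  ball of radius \<open>r\<close> to \<open>0\<close> on the unit sphere. Interpolating in the squared norm makes its
  gradient \<open>- 2 / (1 - r\<^sup>2)\<close> times \<open>x\<close> in between.\<close>

definition ball_cutoff :: "real \<Rightarrow> real^3 \<Rightarrow> real" where
  "ball_cutoff r x = max 0 (min 1 ((1 - (norm x)\<^sup>2) / (1 - r\<^sup>2)))"

lemma ball_cutoff_cases:
  assumes r: "0 < r" "r < 1"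
  shows "norm x \<le> r \<Longrightarrow> ball_cutoff r x = 1"
    and "r \<le> norm x \<Longrightarrow> norm x \<le> 1 \<Longrightarrow> ball_cutoff r x = (1 - (norm x)\<^sup>2) / (1 - r\<^sup>2)"
    and "1 \<le> norm x \<Longrightarrow> ball_cutoff r x = 0"
proof -
  have p: "0 < 1 - r\<^sup>2" using r by (simp add: power_less_one_iff)
  show "ball_cutoff r x = 1" if "norm x \<le> r"
    using power_mono[OF that, of 2] p by (simp add: ball_cutoff_def min_def max_def divide_le_eq le_divide_eq)
  show "ball_cutoff r x = (1 - (norm x)\<^sup>2) / (1 - r\<^sup>2)" if "r \<le> norm x" "norm x \<le> 1"
    using power_mono[OF that(1), of 2] power_mono[OF that(2), of 2] p r
    by (simp add: ball_cutoff_def min_def max_def divide_le_eq le_divide_eq)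
  show "ball_cutoff r x = 0" if "1 \<le> norm x"
    using power_mono[OF that, of 2] p by (simp add: ball_cutoff_def min_def max_def divide_le_eq le_divide_eq)
qed

lemma ball_cutoff_range: "0 \<le> ball_cutoff r x" "ball_cutoff r x \<le> 1"
  by (auto simp: ball_cutoff_def)

lemma ball_cutoff_lipschitz:
  assumes r: "0 < r" "r < 1"
  shows "\<bar>ball_cutoff r x - ball_cutoff r y\<bar> \<le> (norm x + norm y) / (1 - r\<^sup>2) * norm (x - y)"
proof -
  have p: "0 < 1 - r\<^sup>2" using r by (simp add: power_less_one_iff)
  have "\<bar>ball_cutoff r x - ball_cutoff r y\<bar> \<le> \<bar>(1 - (norm x)\<^sup>2) / (1 - r\<^sup>2) - (1 - (norm y)\<^sup>2) / (1 - r\<^sup>2)\<bar>"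
    unfolding ball_cutoff_def by (auto simp: max_def min_def abs_if)
  also have "\<dots> = \<bar>((norm y)\<^sup>2 - (norm x)\<^sup>2) / (1 - r\<^sup>2)\<bar>"
    by (simp flip: diff_divide_distrib)
  also have "\<dots> = (norm x + norm y) * \<bar>norm y - norm x\<bar> / (1 - r\<^sup>2)"
    using p by (simp add: power2_eq_square square_diff_square_factored abs_mult add.commute)
  also have "\<dots> \<le> (norm x + norm y) * norm (x - y) / (1 - r\<^sup>2)"
    using norm_triangle_ineq3[of x y] p by (intro divide_right_mono mult_left_mono) (auto simp: abs_minus_commute)
  finally show ?thesis by simp
qed

lemma partial_deriv_norm_sq: "partial_deriv i (\<lambda>x::real^3. (norm x)\<^sup>2) x = 2 * x $ i"
proof -
  have "((\<lambda>x::real^3. x \<bullet> x) has_derivative (\<lambda>h. x \<bullet> h + h \<bullet> x)) (at x)"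
    by (auto intro!: derivative_eq_intros)
  from partial_deriv_eq[OF this] show ?thesis
    by (simp add: power2_norm_eq_inner inner_axis inner_commute)
qed

text \<open>Integration by parts: the product of the cutoff with \<open>V\<close> is Lipschitz with compact
  support, and it is differentiable off the two spheres of radius \<open>r\<close> and \<open>1\<close>, which are null
  sets.\<close>

lemma integral_cutoff_partial_deriv:
  fixes V :: "real^3 \<Rightarrow> real"
  assumes V: "smooth V" and r: "0 < r" "r < 1"
  shows "(LINT x|lborel. ball_cutoff r x * partial_deriv i V x) =
    2 / (1 - r\<^sup>2) * (LINT x|lborel. indicator (unit_ball - ball 0 r) x * (x $ i * V x))"
    (is "?L = _")
proof -
  have p: "0 < 1 - r\<^sup>2" using r by (simp add: power_less_one_iff)
  let ?h = "\<lambda>x. ball_cutoff r x * V x"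
  let ?S = "unit_ball - ball (0::real^3) r"
  let ?D = "\<lambda>x. ball_cutoff r x * partial_deriv i V x - indicator ?S x * (2 / (1 - r\<^sup>2) * (x $ i * V x))"
  have [measurable]: "V \<in> borel_measurable borel" "partial_deriv i V \<in> borel_measurable borel"
    "(\<lambda>x::real^3. x $ i) \<in> borel_measurable borel"
    by (intro borel_measurable_continuous_onI smooth_continuous_on V smooth_partial_deriv smooth_component)+
  have [measurable]: "?S \<in> sets borel" by simp
  have [measurable]: "ball_cutoff r \<in> borel_measurable borel"
    unfolding ball_cutoff_def[abs_def] by measurable
  have intb: "integrable lborel (\<lambda>x::real^3. B * indicator (cball 0 2) x :: real)" for B
    by (intro integrable_mult_right integrable_real_indicator) (auto simp: emeasure_lborel_cball_finite[unfolded infinity_ennreal_def])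
  obtain A where A: "\<And>x. norm x \<le> 3 \<Longrightarrow> \<bar>V x\<bar> \<le> A"
    using continuous_bounded_cball[OF smooth_continuous_on[OF V]] by blast
  have "\<forall>j. \<exists>B. \<forall>x. norm x \<le> 3 \<longrightarrow> \<bar>partial_deriv j V x\<bar> \<le> B"
    using continuous_bounded_cball[OF smooth_continuous_on[OF smooth_partial_deriv[OF V]]] by blast
  then obtain B' where B': "\<And>j x. norm x \<le> 3 \<Longrightarrow> \<bar>partial_deriv j V x\<bar> \<le> B' j" by metis
  define B where "B = (\<Sum>j\<in>UNIV. \<bar>B' j\<bar>)"
  have B: "\<bar>partial_deriv j V x\<bar> \<le> B" if "norm x \<le> 3" for j x
  proof -
    have "\<bar>B' j\<bar> \<le> B" unfolding B_def by (intro member_le_sum) auto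
    with B'[OF that, of j] show ?thesis by linarith
  qed
  have A0: "0 \<le> A" and B0: "0 \<le> B" using A[of 0] B[of 0] by (auto intro: order_trans[OF abs_ge_zero])
  have cz: "ball_cutoff r x = 0" if "1 \<le> norm x" for x using ball_cutoff_cases(3)[OF r that] .
  have hint: "integrable lborel ?h"
  proof (rule Bochner_Integration.integrable_bound[OF intb[of A]])
    have "\<bar>?h x\<bar> \<le> A * indicator (cball 0 2) x" for x
    proof (cases "norm x \<le> 1")
      case True
      then show ?thesis using mult_mono[of "ball_cutoff r x" 1 "\<bar>V x\<bar>" A] A[of x] ball_cutoff_range[of r x]
        by (simp add: abs_mult)
    qed (use cz A0 in simp)
    then show "AE x in lborel. norm (?h x) \<le> norm (A * indicator (cball 0 2) x :: real)"
      using A0 by (intro AE_I2) (simp add: abs_mult)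
  qed simp
  have dint: "integrable lborel (\<lambda>x. ball_cutoff r x * partial_deriv i V x)"
  proof (rule Bochner_Integration.integrable_bound[OF intb[of B]])
    have "\<bar>ball_cutoff r x * partial_deriv i V x\<bar> \<le> B * indicator (cball 0 2) x" for x
    proof (cases "norm x \<le> 1")
      case True
      then show ?thesis using mult_mono[of "ball_cutoff r x" 1 "\<bar>partial_deriv i V x\<bar>" B] B[of x] ball_cutoff_range[of r x]
        by (simp add: abs_mult)
    qed (use cz B0 in simp)
    then show "AE x in lborel. norm (ball_cutoff r x * partial_deriv i V x) \<le> norm (B * indicator (cball 0 2) x :: real)"
      using B0 by (intro AE_I2) (simp add: abs_mult)
  qed simp
  have sint: "integrable lborel (\<lambda>x. indicator ?S x * (2 / (1 - r\<^sup>2) * (x $ i * V x)))"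
  proof (rule Bochner_Integration.integrable_bound[OF intb[of "2 / (1 - r\<^sup>2) * A"]])
    have "\<bar>indicator ?S x * (2 / (1 - r\<^sup>2) * (x $ i * V x))\<bar> \<le> 2 / (1 - r\<^sup>2) * A * indicator (cball 0 2) x" for x
    proof (cases "norm x \<le> 1")
      case True
      have "\<bar>x $ i\<bar> * \<bar>V x\<bar> \<le> 1 * A"
        using True A[of x] component_le_norm_cart[of x i] by (intro mult_mono) auto
      then have "2 / (1 - r\<^sup>2) * (\<bar>x $ i\<bar> * \<bar>V x\<bar>) \<le> 2 / (1 - r\<^sup>2) * A" using p by (intro mult_left_mono) auto
      then show ?thesis using True p A0 by (auto simp: indicator_def abs_mult)
    qed (use A0 p in \<open>auto simp: indicator_def\<close>)
    then show "AE x in lborel. norm (indicator ?S x * (2 / (1 - r\<^sup>2) * (x $ i * V x))) \<le> norm (2 / (1 - r\<^sup>2) * A * indicator (cball 0 2) x :: real)"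
      using A0 p by (intro AE_I2) (simp add: abs_mult)
  qed simp
  have "(LINT x|lborel. ?D x) = 0"
  proof (rule integral_derivative_zero[OF hint])
    show "?D \<in> borel_measurable borel" by measurable
    show "integrable lborel (\<lambda>x::real^3. (5 / (1 - r\<^sup>2) * A + 3 * B) * indicator (cball 0 2) x)" by (rule intb)
    have "AE x in lborel. x \<notin> sphere 0 r \<and> x \<notin> sphere (0::real^3) 1"
      using AE_not_in[OF sphere_null] AE_not_in[OF sphere_null] by eventually_elim auto
    then show "AE x in lborel. ((\<lambda>t. (?h (x + t *\<^sub>R axis i 1) - ?h x) /\<^sub>R t) \<longlongrightarrow> ?D x) (at_right 0)"
    proof eventually_elim
      case (elim x)
      have lim: "((\<lambda>t. (?h (x + t *\<^sub>R axis i 1) - ?h x) /\<^sub>R t) \<longlongrightarrow> d) (at_right 0)"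
        if g: "smooth g" "open X" "x \<in> X" "\<And>y. y \<in> X \<Longrightarrow> g y = ?h y" "partial_deriv i g x = d" for g X d
      proof -
        have gd: "(g has_derivative (\<lambda>h. \<Sum>i\<in>UNIV. (h $ i) *\<^sub>R partial_deriv i g x)) (at x)"
          by (rule smooth_has_derivative[OF g(1)])
        have hd: "(?h has_derivative (\<lambda>h. \<Sum>i\<in>UNIV. (h $ i) *\<^sub>R partial_deriv i g x)) (at x)"
          by (rule has_derivative_transform_within_open[OF gd g(2,3)]) (use g(4) in auto)
        have "partial_deriv i ?h x = d"
          by (rule trans[OF partial_deriv_eq[OF hd] trans[OF partial_deriv_eq[OF gd, symmetric] g(5)]])
        moreover have "?h differentiable (at x)" using hd by (rule differentiableI)
        ultimately show ?thesis using partial_deriv_limit[of ?h x i] by (simp only:)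
      qed
      consider "norm x < r" | "r < norm x" "norm x < 1" | "1 < norm x" using elim by force
      then show ?case
      proof cases
        case 1
        have "?D x = partial_deriv i V x" using 1 ball_cutoff_cases(1)[OF r, of x] by simp
        then show ?thesis using 1 ball_cutoff_cases(1)[OF r]
          by (intro lim[of V "ball 0 r"] V) auto
      next
        case 2
        let ?q = "\<lambda>y::real^3. (1 / (1 - r\<^sup>2)) * (1 - (norm y)\<^sup>2)"
        have q: "smooth ?q" by (intro smooth_cmult smooth_diff smooth_const smooth_norm_sq)
        have "partial_deriv i ?q x = (1 / (1 - r\<^sup>2)) * (0 - 2 * x $ i)"
          using partial_derivs_cmult[OF smooth_diff[OF smooth_const[of 1] smooth_norm_sq], of "[i]" "1 / (1 - r\<^sup>2)"]
            partial_derivs_diff[OF smooth_const[of 1] smooth_norm_sq, of "[i]"] partial_derivs_const[of "[i]" "1::real"]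
          by (simp add: partial_deriv_norm_sq fun_eq_iff)
        then have "partial_deriv i (\<lambda>y. ?q y * V y) x = ?D x"
          using 2 ball_cutoff_cases(2)[OF r, of x] partial_deriv_mult[OF smooth_differentiable[OF q] smooth_differentiable[OF V], of i x]
          by (simp add: field_simps)
        moreover have "open (unit_ball - cball (0::real^3) r)" by (intro open_Diff) auto
        ultimately show ?thesis using 2 ball_cutoff_cases(2)[OF r]
          by (intro lim[of "\<lambda>y. ?q y * V y" "unit_ball - cball 0 r"] smooth_mult q V) auto
      next
        case 3
        have "?D x = 0" using 3 cz by simp
        moreover have "partial_deriv i (\<lambda>x. 0::real) x = 0" using partial_derivs_const[of "[i]" "0::real"] by (simp add: fun_eq_iff)
        ultimately show ?thesis using 3 cz
          by (intro lim[of "\<lambda>x. 0" "- cball 0 1"] smooth_const) auto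
      qed
    qed
    fix x :: "real^3" and t :: real assume t: "0 < t" "t \<le> 1"
    let ?y = "x + t *\<^sub>R axis i 1"
    have yx: "norm (?y - x) = t" using t by simp
    have ny: "norm ?y \<le> norm x + t" using norm_triangle_ineq[of x "t *\<^sub>R axis i 1"] t by simp
    have nx: "norm x \<le> norm ?y + t" using norm_triangle_ineq4[of ?y "t *\<^sub>R axis i 1"] t by simp
    show "norm (?h ?y - ?h x) \<le> t * ((5 / (1 - r\<^sup>2) * A + 3 * B) * indicator (cball 0 2) x)"
    proof (cases "norm x \<le> 2")
      case True
      have c1: "\<bar>ball_cutoff r ?y - ball_cutoff r x\<bar> \<le> 5 / (1 - r\<^sup>2) * t"
      proof -
        have "(norm ?y + norm x) / (1 - r\<^sup>2) * norm (?y - x) \<le> 5 / (1 - r\<^sup>2) * t"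
          unfolding yx using True ny t p by (intro mult_right_mono divide_right_mono) auto
        with ball_cutoff_lipschitz[OF r, of ?y x] show ?thesis by linarith
      qed
      have c2: "\<bar>V ?y - V x\<bar> \<le> 3 * B * t"
      proof -
        have "norm (partial_deriv j V z) \<le> B" if "z \<in> closed_segment ?y x" for j z
        proof -
          have "dist z x \<le> dist ?y x" using that dist_in_closed_segment dist_commute by metis
          then have "norm z \<le> norm x + t" using yx norm_triangle_sub[of z x] by (simp add: dist_norm)
          then show ?thesis using B[of z j] True t by simp
        qed
        from smooth_mvt[OF V, of ?y x, OF this] yx show ?thesis by simp
      qed
      have "?h ?y - ?h x = (ball_cutoff r ?y - ball_cutoff r x) * V ?y + ball_cutoff r x * (V ?y - V x)" by (simp add: algebra_simps)
      then have "\<bar>?h ?y - ?h x\<bar> \<le> \<bar>ball_cutoff r ?y - ball_cutoff r x\<bar> * \<bar>V ?y\<bar> + ball_cutoff r x * \<bar>V ?y - V x\<bar>"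
        using ball_cutoff_range[of r x] by (metis abs_mult abs_of_nonneg abs_triangle_ineq)
      also have "\<dots> \<le> (5 / (1 - r\<^sup>2) * t) * A + 1 * (3 * B * t)"
        using c1 c2 ball_cutoff_range[of r x] A[of ?y] True ny t p by (intro add_mono mult_mono) auto
      finally show ?thesis using True by (simp add: algebra_simps)
    next
      case False
      then have "ball_cutoff r x = 0" "ball_cutoff r ?y = 0" using nx t by (auto intro!: cz)
      then show ?thesis using False by simp
    qed
  qed
  then have "?L - (LINT x|lborel. indicator ?S x * (2 / (1 - r\<^sup>2) * (x $ i * V x))) = 0"
    using dint sint by simp
  moreover have "(LINT x|lborel. indicator ?S x * (2 / (1 - r\<^sup>2) * (x $ i * V x))) =
      2 / (1 - r\<^sup>2) * (LINT x|lborel. indicator ?S x * (x $ i * V x))"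
    by (subst integral_mult_right_zero[symmetric]) (simp only: mult.left_commute)
  ultimately show ?thesis by simp
qed

text \<open>The shell \<open>r \<le> norm x < 1\<close> concentrates on the sphere. Replacing \<open>u x\<close> by \<open>u (sgn x)\<close>
  changes the normalised integral by a quantity that tends to \<open>0\<close>, by uniform continuity. For a
  function of the direction, the integral over the shell is \<open>1 - r ^ 3\<close> times the one over the
  ball, and \<open>2 * (1 - r ^ 3) / (1 - r\<^sup>2)\<close> tends to \<open>3\<close>, the factor in the definition of the
  surface measure.\<close>

lemma shell_limit:
  fixes u :: "real^3 \<Rightarrow> real"
  assumes u: "continuous_on UNIV u" and r: "\<And>n. 0 < r n" "\<And>n. r n < 1" "r \<longlonglongrightarrow> (1::real)"
  shows "(\<lambda>n. 2 / (1 - (r n)\<^sup>2) * (LINT x|lborel. indicator (unit_ball - ball 0 (r n)) x * u x))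
    \<longlonglongrightarrow> (LINT x|sphere_measure. u x)"
proof -
  have um[measurable]: "u \<in> borel_measurable borel" by (rule borel_measurable_continuous_onI[OF u])
  have usm: "(\<lambda>x. u (sgn x)) \<in> borel_measurable borel" by (rule measurable_compose[OF sgn_measurable um])
  obtain B where B: "\<And>x. norm x \<le> 1 \<Longrightarrow> \<bar>u x\<bar> \<le> B"
    using continuous_bounded_cball[OF u] by blast
  have B0: "0 \<le> B" using B[of 0] by auto
  have nsgn: "norm (sgn x) \<le> 1" for x :: "real^3" by (simp add: norm_sgn)
  have fin: "emeasure lborel A < \<infinity>" if "A \<subseteq> cball (0::real^3) 1" for A
    using order_le_less_trans[OF emeasure_mono[OF that] emeasure_lborel_cball_finite] by simp
  have int: "integrable lborel (\<lambda>x. indicator A x * f x)"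
    if A: "A \<in> sets borel" "A \<subseteq> cball (0::real^3) 1" and f: "f \<in> borel_measurable borel" "\<And>x. x \<in> A \<Longrightarrow> \<bar>f x\<bar> \<le> K" for A f and K :: real
  proof (rule Bochner_Integration.integrable_bound)
    show "integrable lborel (\<lambda>x. K * indicator A x)"
      using A fin[OF A(2)] by (intro integrable_mult_right integrable_real_indicator) auto
    show "AE x in lborel. norm (indicator A x * f x) \<le> norm (K * indicator A x)"
    proof (rule AE_I2)
      fix x show "norm (indicator A x * f x) \<le> norm (K * indicator A x)"
        using order_trans[OF f(2) abs_ge_self] by (auto simp: indicator_def)
    qed
  qed (use A f in auto)
  define Sh where "Sh n = unit_ball - ball (0::real^3) (r n)" for n
  have Sh: "Sh n \<in> sets borel" "Sh n \<subseteq> cball 0 1" for n by (auto simp: Sh_def)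
  have shell: "(LINT x|lborel. indicator (Sh n) x * f (sgn x)) = (1 - r n ^ 3) * (LINT x|lborel. indicator unit_ball x * f (sgn x))"
    if f: "f \<in> borel_measurable borel" "\<And>x. norm x \<le> 1 \<Longrightarrow> \<bar>f x\<bar> \<le> K" for f K n
  proof -
    have fs: "(\<lambda>x. f (sgn x)) \<in> borel_measurable borel" by (rule measurable_compose[OF sgn_measurable f(1)])
    have "(LINT x|lborel. indicator (Sh n) x * f (sgn x)) =
       (LINT x|lborel. indicator unit_ball x * f (sgn x) - indicator (ball 0 (r n)) x * f (sgn x))"
      using r(2)[of n] by (intro Bochner_Integration.integral_cong) (auto simp: Sh_def indicator_def)
    also have "\<dots> = (LINT x|lborel. indicator unit_ball x * f (sgn x)) - (LINT x|lborel. indicator (ball 0 (r n)) x * f (sgn x))"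
      using r(2)[of n] by (intro Bochner_Integration.integral_diff int[where K=K] fs f(2) nsgn) auto
    finally show ?thesis using integral_degree_zero_ball[OF f(1) r(1)[of n]] by (simp add: algebra_simps)
  qed
  define I where "I = (LINT x|lborel. indicator unit_ball x * u (sgn x))"
  define V where "V = (LINT x|lborel. indicator unit_ball (x::real^3) * (1::real))"
  have V0: "0 \<le> V" unfolding V_def by (intro integral_nonneg_AE) auto
  define a where "a n = 2 * (1 + r n + (r n)\<^sup>2) / (1 + r n)" for n
  have a: "2 / (1 - (r n)\<^sup>2) * (1 - r n ^ 3) = a n" for n
  proof -
    have "1 - (r n)\<^sup>2 = (1 - r n) * (1 + r n)" "1 - r n ^ 3 = (1 - r n) * (1 + r n + (r n)\<^sup>2)"
      by (simp_all add: power2_eq_square power3_eq_cube algebra_simps)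
    then show ?thesis using r(1)[of n] r(2)[of n] by (simp add: a_def)
  qed
  have alim: "a \<longlonglongrightarrow> 3"
  proof -
    have "(\<lambda>n. 2 * (1 + r n + (r n)\<^sup>2) / (1 + r n)) \<longlonglongrightarrow> 2 * (1 + 1 + 1\<^sup>2) / (1 + 1)"
      by (intro tendsto_intros r(3)) auto
    then show ?thesis by (simp add: a_def[abs_def])
  qed
  let ?q = "\<lambda>n. 2 / (1 - (r n)\<^sup>2)"
  have q0: "0 < ?q n" for n using r(1)[of n] r(2)[of n] by (simp add: power_less_one_iff)
  define E where "E n = ?q n * (LINT x|lborel. indicator (Sh n) x * (u x - u (sgn x)))" for n
  have dec: "?q n * (LINT x|lborel. indicator (Sh n) x * u x) = a n * I + E n" for n
  proof -
    have "(LINT x|lborel. indicator (Sh n) x * u x) =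
        (LINT x|lborel. indicator (Sh n) x * u (sgn x) + indicator (Sh n) x * (u x - u (sgn x)))"
      by (intro Bochner_Integration.integral_cong) (auto simp: algebra_simps)
    also have "\<dots> = (LINT x|lborel. indicator (Sh n) x * u (sgn x)) + (LINT x|lborel. indicator (Sh n) x * (u x - u (sgn x)))"
    proof (rule Bochner_Integration.integral_add)
      show "integrable lborel (\<lambda>x. indicator (Sh n) x * u (sgn x))"
        by (rule int[OF Sh usm, where K=B]) (use B nsgn in auto)
      have "\<bar>u x - u (sgn x)\<bar> \<le> 2 * B" if "x \<in> Sh n" for x
        using B[of x] B[OF nsgn[of x]] that by (auto simp: Sh_def)
      then show "integrable lborel (\<lambda>x. indicator (Sh n) x * (u x - u (sgn x)))"
        by (intro int[OF Sh] borel_measurable_diff um usm) auto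
    qed
    finally show ?thesis
      using shell[OF um B, of n] a[of n] by (simp add: E_def I_def distrib_left mult.assoc[symmetric])
  qed
  have "E \<longlonglongrightarrow> 0"
  proof (rule LIMSEQ_I)
    fix e :: real assume e: "0 < e"
    define d where "d = e / (6 * (V + 1))"
    have d: "0 < d" using e V0 by (simp add: d_def)
    have "uniformly_continuous_on (cball 0 1) u"
      by (intro compact_uniformly_continuous continuous_on_subset[OF u]) auto
    then have "\<exists>s>0. \<forall>x\<in>cball 0 1. \<forall>y\<in>cball 0 1. dist y x < s \<longrightarrow> dist (u y) (u x) < d"
      using d unfolding uniformly_continuous_on_def by blast
    then obtain s where s': "0 < s" "\<forall>x\<in>cball 0 1. \<forall>y\<in>cball 0 1. dist y x < s \<longrightarrow> dist (u y) (u x) < d" by blast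
    have s: "0 < s" "\<And>x y. norm x \<le> 1 \<Longrightarrow> norm y \<le> 1 \<Longrightarrow> dist x y < s \<Longrightarrow> dist (u x) (u y) < d"
      using s' by auto
    have ev: "\<forall>\<^sub>F n in sequentially. 1 - r n < s"
    proof -
      have "\<forall>\<^sub>F n in sequentially. 1 - s < r n" using order_tendstoD(1)[OF r(3), of "1 - s"] s(1) by simp
      then show ?thesis by eventually_elim linarith
    qed
    moreover have "\<forall>\<^sub>F n in sequentially. a n < 4" using order_tendstoD(2)[OF alim, of 4] by simp
    ultimately have "\<forall>\<^sub>F n in sequentially. \<bar>E n\<bar> < e"
    proof eventually_elim
      case (elim n)
      have pt: "\<bar>u x - u (sgn x)\<bar> \<le> d" if "x \<in> Sh n" for x
      proof -
        have x: "r n \<le> norm x" "norm x < 1" "x \<noteq> 0" using that r(1)[of n] by (auto simp: Sh_def)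
        have "x - sgn x = (1 - 1 / norm x) *\<^sub>R x" by (simp add: sgn_div_norm algebra_simps divide_inverse)
        then have "norm (x - sgn x) = \<bar>1 - 1 / norm x\<bar> * norm x" by simp
        also have "\<dots> = \<bar>(1 - 1 / norm x) * norm x\<bar>" by (simp add: abs_mult)
        also have "(1 - 1 / norm x) * norm x = norm x - 1" using x by (simp add: algebra_simps)
        finally have "dist x (sgn x) < s" using x elim by (simp add: dist_norm)
        then show ?thesis using s(2)[of x "sgn x"] x nsgn by (auto simp: dist_real_def intro: less_imp_le)
      qed
      have "\<bar>LINT x|lborel. indicator (Sh n) x * (u x - u (sgn x))\<bar> \<le> (LINT x|lborel. indicator (Sh n) x * d)"
        unfolding real_norm_def[symmetric]
      proof (rule integral_norm_le)
        show "integrable lborel (\<lambda>x. indicator (Sh n) x * (u x - u (sgn x)))"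
          by (rule int[OF Sh, where K=d]) (use um usm pt in auto)
        show "integrable lborel (\<lambda>x. indicator (Sh n) x * d)" by (rule int[OF Sh, where K=d]) (use d in auto)
      qed (use pt d in \<open>auto simp: indicator_def\<close>)
      also have "\<dots> = (1 - r n ^ 3) * V * d"
        using shell[of "\<lambda>_. 1" 1 n] by (simp add: V_def)
      finally have "\<bar>E n\<bar> \<le> ?q n * ((1 - r n ^ 3) * V * d)"
        using q0[of n] unfolding E_def abs_mult by (intro mult_mono) auto
      also have "\<dots> = a n * V * d" using a[of n] by (simp add: mult.assoc[symmetric])
      also have "\<dots> \<le> 4 * V * d" using elim V0 d by (intro mult_right_mono) auto
      also have "\<dots> < e" using e V0 by (simp add: d_def field_simps add_pos_nonneg)
      finally show ?case .
    qed
    then show "\<exists>no. \<forall>n\<ge>no. norm (E n - 0) < e" by (simp add: eventually_sequentially)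
  qed
  then have "(\<lambda>n. a n * I + E n) \<longlonglongrightarrow> 3 * I + 0" by (intro tendsto_intros alim)
  then show ?thesis
    using dec sphere_integral[OF um] by (simp add: I_def Sh_def)
qed

text \<open>The divergence is first integrated against the cutoff, where integration by parts yields
  the flux through a thin shell; then \<open>r\<close> tends to \<open>1\<close>.\<close>

lemma divergence_ball:
  fixes V :: "3 \<Rightarrow> real^3 \<Rightarrow> real"
  assumes V: "\<And>i. smooth (V i)"
  shows "(LINT x|lborel. indicator unit_ball x * (\<Sum>i\<in>UNIV. partial_deriv i (V i) x)) =
    (LINT x|sphere_measure. (\<Sum>i\<in>UNIV. x $ i * V i x))"
proof -
  define r where "r n = 1 - 1 / real (n + 2)" for n
  have r: "0 < r n" "r n < 1" for n by (auto simp: r_def field_simps)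
  have r1: "r \<longlonglongrightarrow> 1"
  proof -
    have "(\<lambda>n. 1 - 1 / real (n + 2)) \<longlonglongrightarrow> 1 - 0"
      using LIMSEQ_ignore_initial_segment[OF lim_1_over_n[where 'a=real], of 2]
      by (intro tendsto_intros) simp
    then show ?thesis by (simp add: r_def[abs_def])
  qed
  let ?D = "\<lambda>x. \<Sum>i\<in>UNIV. partial_deriv i (V i) x" and ?u = "\<lambda>x. \<Sum>i\<in>UNIV. x $ i * V i x"
  have cD: "continuous_on X (partial_deriv i (V i))" and cV: "continuous_on X (\<lambda>x. x $ i * V i x)" for i X
    by (intro smooth_continuous_on smooth_partial_deriv smooth_mult smooth_component V)+
  have cDs: "continuous_on X ?D" and cu: "continuous_on X ?u" for X by (intro continuous_on_sum cD cV)+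
  have cutm: "ball_cutoff s \<in> borel_measurable borel" for s unfolding ball_cutoff_def[abs_def] by measurable
  have finb: "integrable lborel (\<lambda>x::real^3. K * indicator unit_ball x)" for K :: real
    using emeasure_lborel_ball_finite[of "0::real^3" 1]
    by (intro integrable_mult_right integrable_real_indicator) auto
  have int: "integrable lborel (\<lambda>x. g x * f x)"
    if g: "g \<in> borel_measurable borel" "\<And>x. \<bar>g x\<bar> \<le> indicator unit_ball x" and f: "continuous_on UNIV f" for f g :: "real^3 \<Rightarrow> real"
  proof -
    obtain B where B: "\<And>x. norm x \<le> 1 \<Longrightarrow> \<bar>f x\<bar> \<le> B" using continuous_bounded_cball[OF f] by blast
    have "0 \<le> B" using B[of 0] by auto
    show ?thesis
    proof (rule Bochner_Integration.integrable_bound[OF finb[of B]])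
      have "\<bar>g x * f x\<bar> \<le> B * indicator unit_ball x" for x
        using g(2)[of x] B[of x] \<open>0 \<le> B\<close> mult_mono[of "\<bar>g x\<bar>" 1 "\<bar>f x\<bar>" B]
        by (auto simp: indicator_def abs_mult split: if_splits)
      then show "AE x in lborel. norm (g x * f x) \<le> norm (B * indicator unit_ball x)"
        using \<open>0 \<le> B\<close> by (auto simp: abs_mult)
    qed (use g borel_measurable_continuous_onI[OF f] in auto)
  qed
  have cb: "\<bar>ball_cutoff (r n) x\<bar> \<le> indicator unit_ball x" for n x
    using ball_cutoff_range[of "r n" x] ball_cutoff_cases(3)[OF r, of x n] by (auto simp: indicator_def not_less)
  have eq: "(LINT x|lborel. ball_cutoff (r n) x * ?D x) =
     2 / (1 - (r n)\<^sup>2) * (LINT x|lborel. indicator (unit_ball - ball 0 (r n)) x * ?u x)" for n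
  proof -
    have "(LINT x|lborel. ball_cutoff (r n) x * ?D x) = (\<Sum>i\<in>UNIV. LINT x|lborel. ball_cutoff (r n) x * partial_deriv i (V i) x)"
      unfolding sum_distrib_left by (intro Bochner_Integration.integral_sum int cutm cb cD)
    also have "\<dots> = 2 / (1 - (r n)\<^sup>2) * (\<Sum>i\<in>UNIV. LINT x|lborel. indicator (unit_ball - ball 0 (r n)) x * (x $ i * V i x))"
      by (simp add: integral_cutoff_partial_deriv[OF V r] sum_distrib_left)
    also have "(\<Sum>i\<in>UNIV. LINT x|lborel. indicator (unit_ball - ball 0 (r n)) x * (x $ i * V i x)) =
       (LINT x|lborel. indicator (unit_ball - ball 0 (r n)) x * ?u x)"
      unfolding sum_distrib_left
      by (intro Bochner_Integration.integral_sum[symmetric] int cV borel_measurable_indicator) (auto simp: indicator_def)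
    finally show ?thesis .
  qed
  have "(\<lambda>n. LINT x|lborel. ball_cutoff (r n) x * ?D x) \<longlonglongrightarrow> (LINT x|lborel. indicator unit_ball x * ?D x)"
  proof (rule integral_dominated_convergence)
    show "integrable lborel (\<lambda>x. \<bar>indicator unit_ball x * ?D x\<bar>)"
      by (intro integrable_abs int cDs borel_measurable_indicator) auto
    show "AE x in lborel. norm (ball_cutoff (r n) x * ?D x) \<le> \<bar>indicator unit_ball x * ?D x\<bar>" for n
    proof (rule AE_I2)
      fix x show "norm (ball_cutoff (r n) x * ?D x) \<le> \<bar>indicator unit_ball x * ?D x\<bar>"
        using mult_right_mono[OF cb[of n x], of "\<bar>?D x\<bar>"] by (simp add: abs_mult)
    qed
    show "AE x in lborel. (\<lambda>n. ball_cutoff (r n) x * ?D x) \<longlonglongrightarrow> indicator unit_ball x * ?D x"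
    proof (rule AE_I2)
      fix x
      have "(\<lambda>n. ball_cutoff (r n) x) \<longlonglongrightarrow> indicator unit_ball x"
      proof (cases "norm x < 1")
        case True
        have "\<forall>\<^sub>F n in sequentially. norm x < r n" using order_tendstoD(1)[OF r1 True] .
        then have "\<forall>\<^sub>F n in sequentially. 1 = ball_cutoff (r n) x"
          by eventually_elim (use ball_cutoff_cases(1)[OF r] in auto)
        then show ?thesis using True by (intro Lim_transform_eventually[OF tendsto_const]) auto
      next
        case False
        then show ?thesis using ball_cutoff_cases(3)[OF r] by simp
      qed
      then show "(\<lambda>n. ball_cutoff (r n) x * ?D x) \<longlonglongrightarrow> indicator unit_ball x * ?D x" by (intro tendsto_intros)
    qed
  qed (auto intro!: borel_measurable_times borel_measurable_indicator borel_measurable_continuous_onI[OF cDs] cutm)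
  moreover have "(\<lambda>n. LINT x|lborel. ball_cutoff (r n) x * ?D x) \<longlonglongrightarrow> (LINT x|sphere_measure. ?u x)"
    unfolding eq by (rule shell_limit[OF cu r r1])
  ultimately show ?thesis by (rule LIMSEQ_unique)
qed

section \<open>Traces and energies of solid harmonics\<close>

text \<open>The Cauchy--Schwarz inequality in the form \<open>\<bar>a\<bar> * \<bar>g\<bar> \<le> a\<^sup>2 / (2 * s) + s / 2 * g\<^sup>2\<close>, with
  \<open>s\<close> small enough for the second term.\<close>

lemma L2_limit:
  fixes a b :: "nat \<Rightarrow> 'a \<Rightarrow> real"
  assumes a: "\<And>n. integrable M (\<lambda>x. (a n x)\<^sup>2)" "(\<lambda>n. LINT x|M. (a n x)\<^sup>2) \<longlonglongrightarrow> 0"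
    and b: "integrable M (\<lambda>x. (g x)\<^sup>2)"
    and f: "\<And>n. integrable M (f n)" "\<And>n x. \<bar>f n x\<bar> \<le> \<bar>a n x\<bar> * \<bar>g x\<bar>"
  shows "(\<lambda>n. LINT x|M. f n x) \<longlonglongrightarrow> (0::real)"
proof (rule LIMSEQ_I)
  fix e :: real assume e: "0 < e"
  define B where "B = (LINT x|M. (g x)\<^sup>2)"
  have B0: "0 \<le> B" unfolding B_def by (intro integral_nonneg_AE) auto
  define s where "s = e / (B + 1)"
  have s: "0 < s" using e B0 by (simp add: s_def)
  have sB: "s / 2 * B < e / 2"
    using e B0 by (simp add: s_def field_simps)
  have "\<forall>\<^sub>F n in sequentially. (LINT x|M. (a n x)\<^sup>2) < e * s"
    using order_tendstoD(2)[OF a(2), of "e * s"] e s by simp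
  then have "\<forall>\<^sub>F n in sequentially. norm ((LINT x|M. f n x) - 0) < e"
  proof eventually_elim
    case (elim n)
    have "norm (LINT x|M. f n x) \<le> (LINT x|M. 1 / (2 * s) * (a n x)\<^sup>2 + s / 2 * (g x)\<^sup>2)"
    proof (rule integral_norm_le[OF f(1)])
      show "integrable M (\<lambda>x. 1 / (2 * s) * (a n x)\<^sup>2 + s / 2 * (g x)\<^sup>2)"
        by (intro Bochner_Integration.integrable_add integrable_mult_right a b)
      fix x
      have "0 \<le> (\<bar>a n x\<bar> - s * \<bar>g x\<bar>)\<^sup>2 / (2 * s)" using s by simp
      also have "\<dots> = 1 / (2 * s) * (a n x)\<^sup>2 + s / 2 * (g x)\<^sup>2 - \<bar>a n x\<bar> * \<bar>g x\<bar>"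
        using s by (simp add: power2_diff power_mult_distrib field_simps power2_eq_square)
      finally show "norm (f n x) \<le> 1 / (2 * s) * (a n x)\<^sup>2 + s / 2 * (g x)\<^sup>2" using f(2)[of n x] by simp
    qed
    also have "\<dots> = 1 / (2 * s) * (LINT x|M. (a n x)\<^sup>2) + s / 2 * B"
      unfolding B_def by (subst Bochner_Integration.integral_add) (use a b in \<open>auto intro!: integrable_divide\<close>)
    also have "\<dots> < e / 2 + e / 2"
    proof (rule add_less_le_mono[OF _ less_imp_le[OF sB]])
      show "1 / (2 * s) * (LINT x|M. (a n x)\<^sup>2) < e / 2"
        using elim s by (simp add: field_simps)
    qed
    finally show ?case by simp
  qed
  then show "\<exists>no. \<forall>n\<ge>no. norm ((LINT x|M. f n x) - 0) < e" by (simp add: eventually_sequentially)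
qed

abbreviation ball_measure :: "(real^3) measure" where "ball_measure \<equiv> lebesgue_on unit_ball"

interpretation ball: finite_measure ball_measure
  by (rule finite_measure_lebesgue_on) simp

lemma ball_measurable:
  assumes "f \<in> borel_measurable borel" shows "f \<in> borel_measurable ball_measure"
  by (intro measurable_restrict_space1 measurable_completion) (use assms in simp)

lemma ball_integral:
  fixes f :: "real^3 \<Rightarrow> real"
  assumes [measurable]: "f \<in> borel_measurable borel"
  shows "(LINT x|ball_measure. f x) = (LINT x|lborel. indicator unit_ball x * f x)"
proof -
  have "(LINT x|ball_measure. f x) = (LINT x|lebesgue. indicator unit_ball x *\<^sub>R f x)"
    by (subst integral_restrict_space) auto
  also have "\<dots> = (LINT x|lborel. indicator unit_ball x *\<^sub>R f x)"
    by (subst integral_completion) (auto intro!: borel_measurable_times borel_measurable_indicator assms)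
  finally show ?thesis by simp
qed

lemma ball_integrable:
  fixes f :: "real^3 \<Rightarrow> real"
  assumes "continuous_on UNIV f" shows "integrable ball_measure f"
proof -
  obtain B where "\<And>x. norm x \<le> 1 \<Longrightarrow> \<bar>f x\<bar> \<le> B"
    using continuous_bounded_cball[OF assms] by blast
  then show ?thesis
    by (intro ball.integrable_const_bound[where B=B] AE_I2 ball_measurable borel_measurable_continuous_onI assms)
       (auto simp: space_restrict_space)
qed

lemma continuous_integrable_compact:
  fixes f :: "real^3 \<Rightarrow> real"
  assumes "continuous_on UNIV f" "compact K" shows "integrable (lebesgue_on K) f"
proof -
  have K: "K \<in> sets borel" by (rule borel_closed[OF compact_imp_closed[OF assms(2)]])
  have "integrable lborel (\<lambda>x. indicator K x *\<^sub>R f x)"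
    by (rule borel_integrable_compact[OF assms(2) continuous_on_subset[OF assms(1)]]) simp
  then have "integrable lebesgue (\<lambda>x. indicator K x *\<^sub>R f x)"
    using K borel_measurable_continuous_onI[OF assms(1)] by (subst integrable_completion) auto
  then show ?thesis using K by (subst integrable_restrict_space) auto
qed

lemma compactly_supported_integral_partial_deriv:
  fixes h :: "real^3 \<Rightarrow> real"
  assumes "smooth h" "compact K" "\<And>x. x \<notin> K \<Longrightarrow> h x = 0"
  shows "(LINT x|lborel. partial_deriv i h x) = 0"
proof -
  have s: "smooth (\<lambda>x. complex_of_real (h x))" by (rule smooth_of_real[OF assms(1)])
  have "schwartz (\<lambda>x. complex_of_real (h x))"
    by (rule test_function_schwartz[OF test_functionI[OF s assms(2)]]) (use assms(3) in auto)
  from schwartz_integral_partial_deriv[OF this, of i]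
  have "(LINT x|lborel. complex_of_real (partial_deriv i h x)) = 0"
    using partial_derivs_of_real[OF assms(1), of "[i]"] by simp
  then show ?thesis by (simp only: integral_complex_of_real of_real_eq_0_iff)
qed

lemma grad_nth [simp]: "grad p x $ i = partial_deriv i p x"
  by (simp add: grad_def)

lemma weak_partial_smooth:
  assumes p: "smooth p"
  shows "weak_partial unit_ball i p (\<lambda>x. grad p x $ i)"
  unfolding weak_partial_def grad_nth
proof (intro conjI allI impI)
  show "locally_integrable unit_ball p" "locally_integrable unit_ball (partial_deriv i p)"
    unfolding locally_integrable_def using p
    by (auto intro!: continuous_integrable_compact smooth_continuous_on smooth_partial_deriv)
  fix \<phi> :: "real^3 \<Rightarrow> real" assume t: "test_function unit_ball \<phi>"
  then have s: "smooth \<phi>" by (simp add: test_function_def)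
  obtain K where K: "compact K" "K \<subseteq> unit_ball" "\<And>x. x \<notin> K \<Longrightarrow> \<phi> x = 0"
    using test_function_support[OF t] by metis
  have K': "partial_deriv i \<phi> x = 0" if "x \<notin> K" for x
    using partial_derivs_zero_outside[of K \<phi> x "[i]"] K that compact_imp_closed by auto
  have m: "p \<in> borel_measurable borel" "\<phi> \<in> borel_measurable borel" "partial_deriv i p \<in> borel_measurable borel"
     "partial_deriv i \<phi> \<in> borel_measurable borel"
    by (intro borel_measurable_continuous_onI smooth_continuous_on smooth_partial_deriv p s)+
  have int: "integrable lborel (\<lambda>x. f x * g x)" if "continuous_on UNIV f" "continuous_on UNIV g" "\<And>x. x \<notin> K \<Longrightarrow> g x = 0" for f g :: "real^3 \<Rightarrow> real"
  proof -
    have "integrable lborel (\<lambda>x. indicator K x *\<^sub>R (f x * g x))"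
      by (rule borel_integrable_compact[OF K(1)]) (intro continuous_intros continuous_on_subset[OF that(1)] continuous_on_subset[OF that(2)]; simp)
    moreover have "(\<lambda>x. indicator K x *\<^sub>R (f x * g x)) = (\<lambda>x. f x * g x)"
      using that(3) by (auto simp: indicator_def fun_eq_iff)
    ultimately show ?thesis by simp
  qed
  have "(LINT x|lborel. partial_deriv i (\<lambda>x. p x * \<phi> x) x) = 0"
    by (rule compactly_supported_integral_partial_deriv[OF smooth_mult[OF p s] K(1)]) (use K(3) in auto)
  then have "(LINT x|lborel. partial_deriv i p x * \<phi> x + p x * partial_deriv i \<phi> x) = 0"
    by (simp add: partial_deriv_mult[OF smooth_differentiable[OF p] smooth_differentiable[OF s]])
  then have "(LINT x|lborel. partial_deriv i p x * \<phi> x) + (LINT x|lborel. p x * partial_deriv i \<phi> x) = 0"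
    by (subst (asm) Bochner_Integration.integral_add)
       (intro int smooth_continuous_on smooth_partial_deriv p s K(3) K' | assumption)+
  moreover have "(LINT x|ball_measure. f x) = (LINT x|lborel. f x)"
    if "f \<in> borel_measurable borel" "\<And>x. x \<notin> K \<Longrightarrow> f x = 0" for f :: "real^3 \<Rightarrow> real"
    unfolding ball_integral[OF that(1)]
  proof (intro Bochner_Integration.integral_cong refl)
    fix x show "indicator unit_ball x * f x = f x"
      using that(2)[of x] subsetD[OF K(2), of x] by (cases "x \<in> K") auto
  qed
  ultimately show "(LINT x|ball_measure. p x * partial_deriv i \<phi> x) = - (LINT x|ball_measure. partial_deriv i p x * \<phi> x)"
    using m K(3) K' by simp
qed

lemma has_trace_smooth:
  assumes p: "smooth p"
  shows "has_trace p (grad p) p"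
proof -
  have c: "continuous_on UNIV p" "continuous_on UNIV (partial_deriv i p)" for i
    by (intro smooth_continuous_on smooth_partial_deriv p)+
  have sq: "square_integrable ball_measure f" if "continuous_on UNIV f" for f
    unfolding square_integrable_def
    using that by (auto intro!: ball_integrable ball_measurable borel_measurable_continuous_onI continuous_intros)
  have "H1 unit_ball p (grad p)"
    unfolding H1_def using sq[OF c(1)] sq[OF c(2)] weak_partial_smooth[OF p] by simp
  moreover have "square_integrable sphere_measure p"
    unfolding square_integrable_def
    using c(1) by (auto intro!: sphere_integrable sphere_measurable borel_measurable_continuous_onI continuous_intros)
  ultimately show ?thesis
    unfolding has_trace_def using p by (auto intro!: exI[of _ "\<lambda>n. p"])
qed

lemma euler_homogeneous:
  assumes p: "smooth p" and hom: "\<And>t x. p (t *\<^sub>R x) = t ^ k * p x"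
  shows "(\<Sum>i\<in>UNIV. x $ i * partial_deriv i p x) = real k * (p x :: real)"
proof -
  have "((\<lambda>t. p (t *\<^sub>R x)) has_derivative (\<lambda>h. \<Sum>i\<in>UNIV. ((h *\<^sub>R x) $ i) *\<^sub>R partial_deriv i p (1 *\<^sub>R x))) (at 1)"
    by (rule has_derivative_compose[OF _ smooth_has_derivative[OF p], of "\<lambda>t. t *\<^sub>R x" "\<lambda>h. h *\<^sub>R x"])
       (auto intro!: derivative_eq_intros)
  moreover have "((\<lambda>t. p (t *\<^sub>R x)) has_derivative (\<lambda>h. h * (real k * p x))) (at 1)"
    unfolding hom by (auto intro!: derivative_eq_intros simp: mult_ac)
  ultimately have "(\<lambda>h. \<Sum>i\<in>UNIV. ((h *\<^sub>R x) $ i) *\<^sub>R partial_deriv i p (1 *\<^sub>R x)) = (\<lambda>h. h * (real k * p x))"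
    by (rule has_derivative_unique)
  from fun_cong[OF this, of 1] show ?thesis by simp
qed

text \<open>The divergence of \<open>w * grad p\<close> is \<open>grad w \<bullet> grad p\<close> as \<open>p\<close> is harmonic, and its flux
  through the unit sphere is \<open>k * w * p\<close> by Euler's relation. With a conductivity equal to \<open>1\<close>,
  this says that the degree \<open>k\<close> is the Dirichlet to Neumann eigenvalue.\<close>

lemma green_ball:
  assumes w: "smooth w" and p: "smooth p" and hom: "\<And>t x. p (t *\<^sub>R x) = t ^ k * p x"
    and harm: "\<And>x. laplacian p x = 0"
  shows "(LINT x|ball_measure. grad w x \<bullet> grad p x) = real k * (LINT x|sphere_measure. w x * p x)"
proof -
  let ?V = "\<lambda>i x. w x * partial_deriv i p x"
  have pp: "smooth (partial_deriv i p)" for i by (rule smooth_partial_deriv[OF p])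
  have V: "smooth (?V i)" for i by (intro smooth_mult w pp)
  have "partial_deriv i (?V i) x = partial_deriv i w x * partial_deriv i p x + w x * partial_derivs [i, i] p x" for i x
    by (simp add: partial_deriv_mult[OF smooth_differentiable[OF w] smooth_differentiable[OF pp]])
  then have D: "(\<Sum>i\<in>UNIV. partial_deriv i (?V i) x) = grad w x \<bullet> grad p x" for x
    using harm[of x] by (simp add: sum.distrib inner_vec_def laplacian_def sum_distrib_left[symmetric] del: partial_derivs.simps)
  have S: "(\<Sum>i\<in>UNIV. x $ i * ?V i x) = real k * (w x * p x)" for x
  proof -
    have "(\<Sum>i\<in>UNIV. x $ i * ?V i x) = w x * (\<Sum>i\<in>UNIV. x $ i * partial_deriv i p x)"
      by (simp add: sum_distrib_left mult_ac)
    then show ?thesis using euler_homogeneous[OF p hom] by simp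
  qed
  have "(\<lambda>x. grad w x \<bullet> grad p x) \<in> borel_measurable borel"
    unfolding D[symmetric] by (intro borel_measurable_continuous_onI continuous_on_sum smooth_continuous_on smooth_partial_deriv V)
  then show ?thesis using divergence_ball[of ?V, OF V] unfolding D S by (simp add: ball_integral)
qed

text \<open>Powers of \<open>x\<^sub>1 + \<i> * x\<^sub>2\<close> provide a solid harmonic of each degree that is explicit enough
  for its energy to be computed. One spherical harmonic of each degree suffices, since the
  eigenvalue is common to all of them.\<close>

definition zeta :: "real^3 \<Rightarrow> complex" where "zeta x = Complex (x $ 1) (x $ 2)"

lemma zeta_linear: "bounded_linear zeta"
proof -
  have "zeta = (\<lambda>x. complex_of_real (x $ 1) + \<i> * complex_of_real (x $ 2))"
    by (simp add: zeta_def complex_eq_iff fun_eq_iff)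
  moreover have "bounded_linear (\<lambda>x::real^3. complex_of_real (x $ 1) + \<i> * complex_of_real (x $ 2))"
    by (intro bounded_linear_add bounded_linear_compose[OF bounded_linear_mult_right]
      bounded_linear_compose[OF bounded_linear_of_real] bounded_linear_vec_nth)
  ultimately show ?thesis by (simp only:)
qed

text \<open>The coefficient \<open>c\<close> is there for the sake of derivatives: they multiply it by \<open>n\<close> and by
  the value of \<open>zeta\<close> on the coordinate vector, which is \<open>1\<close>, \<open>\<i>\<close> or \<open>0\<close>. The squares of these
  three numbers add up to \<open>0\<close>, whence harmonicity.\<close>

definition harmonic_power :: "complex \<Rightarrow> nat \<Rightarrow> real^3 \<Rightarrow> real" where
  "harmonic_power c n x = Re (c * zeta x ^ n)"

definition zeta_dir :: "3 \<Rightarrow> complex" where "zeta_dir i = zeta (axis i 1)"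

lemma zeta_dir: "zeta_dir 1 = 1" "zeta_dir 2 = \<i>" "zeta_dir 3 = 0"
  by (simp_all add: zeta_dir_def zeta_def complex_eq_iff axis_def)

lemma harmonic_power_derivative:
  "(harmonic_power c n has_derivative (\<lambda>h. Re (c * of_nat n * zeta x ^ (n - 1) * zeta h))) (at x)"
proof -
  have "((\<lambda>z. c * z ^ n) has_derivative (\<lambda>h. (c * of_nat n * zeta x ^ (n - 1)) * h)) (at (zeta x))"
    by (auto intro!: derivative_eq_intros simp: mult_ac)
  from has_derivative_compose[OF bounded_linear_imp_has_derivative[OF zeta_linear] this]
  have "((\<lambda>x. c * zeta x ^ n) has_derivative (\<lambda>h. c * of_nat n * zeta x ^ (n - 1) * zeta h)) (at x)" .
  from bounded_linear.has_derivative[OF bounded_linear_Re this] show ?thesis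
    by (simp add: harmonic_power_def[abs_def])
qed

lemma harmonic_power_partial:
  "partial_deriv i (harmonic_power c n) = harmonic_power (c * of_nat n * zeta_dir i) (n - 1)"
  using partial_deriv_eq[OF harmonic_power_derivative]
  by (auto simp: fun_eq_iff harmonic_power_def zeta_dir_def mult_ac)

lemma harmonic_power_smooth: "smooth (harmonic_power c n)"
proof (rule smooth_coinduct[where S="{harmonic_power c n | c n. True}"])
  fix f :: "real^3 \<Rightarrow> real" and x assume "f \<in> {harmonic_power c n | c n. True}"
  then show "f differentiable at x" using harmonic_power_derivative differentiableI by blast
next
  fix f :: "real^3 \<Rightarrow> real" and i assume "f \<in> {harmonic_power c n | c n. True}"
  then show "partial_deriv i f \<in> {harmonic_power c n | c n. True}" using harmonic_power_partial by blast
qed blast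

lemma harmonic_power_laplacian: "laplacian (harmonic_power c n) x = 0"
proof -
  have "laplacian (harmonic_power c n) x = (\<Sum>i\<in>UNIV. Re (c * of_nat n * of_nat (n - 1) * (zeta_dir i)\<^sup>2 * zeta x ^ (n - 1 - 1)))"
    unfolding laplacian_def by (simp add: harmonic_power_partial harmonic_power_def power2_eq_square mult_ac)
  also have "\<dots> = 0" by (simp add: sum_3 zeta_dir)
  finally show ?thesis .
qed

lemma zeta_scale: "zeta (t *\<^sub>R x) = of_real t * zeta x"
  by (simp add: zeta_def complex_eq_iff)

lemma harmonic_power_homogeneous: "harmonic_power c n (t *\<^sub>R x) = t ^ n * harmonic_power c n x"
proof -
  have "harmonic_power c n (t *\<^sub>R x) = Re (of_real (t ^ n) * (c * zeta x ^ n))"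
    unfolding harmonic_power_def zeta_scale by (simp add: power_mult_distrib mult_ac)
  then show ?thesis by (simp only: harmonic_power_def Re_complex_of_real Im_complex_of_real times_complex.sel)
qed

lemma harmonic_power_polynomial: "real_polynomial_function (harmonic_power 1 n)"
proof -
  have l: "real_polynomial_function (\<lambda>x. Re (zeta x))" "real_polynomial_function (\<lambda>x. Im (zeta x))"
    by (intro real_polynomial_function.intros(1) bounded_linear_compose[OF bounded_linear_Re zeta_linear]
        bounded_linear_compose[OF bounded_linear_Im zeta_linear])+
  have "real_polynomial_function (\<lambda>x. Re (zeta x ^ n)) \<and> real_polynomial_function (\<lambda>x. Im (zeta x ^ n))"
  proof (induction n)
    case (Suc n)
    then show ?case using l
      by (auto intro!: real_polynomial_function_diff real_polynomial_function.intros(3,4))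
  qed (auto intro: real_polynomial_function.intros(2))
  then show ?thesis by (simp add: harmonic_power_def[abs_def])
qed

lemma spherical_harmonic_power: "spherical_harmonic k (harmonic_power 1 k)"
  unfolding spherical_harmonic_def
  by (intro exI[of _ "harmonic_power 1 k"] conjI allI ballI refl harmonic_power_polynomial
      harmonic_power_homogeneous harmonic_power_laplacian)

lemma harmonic_power_grad_norm:
  "grad (harmonic_power 1 k) x \<bullet> grad (harmonic_power 1 k) x = (real k)\<^sup>2 * norm (zeta x) ^ (2 * (k - 1))"
proof -
  let ?w = "zeta x ^ (k - 1)"
  have "grad (harmonic_power 1 k) x \<bullet> grad (harmonic_power 1 k) x = (real k)\<^sup>2 * ((Re ?w)\<^sup>2 + (Im ?w)\<^sup>2)"
    by (simp add: inner_vec_def sum_3 harmonic_power_partial harmonic_power_def zeta_dir power2_eq_square algebra_simps)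
  also have "(Re ?w)\<^sup>2 + (Im ?w)\<^sup>2 = norm (zeta x) ^ (2 * (k - 1))"
    by (simp only: cmod_power2[symmetric] norm_power power_mult[symmetric] mult.commute)
  finally show ?thesis .
qed

text \<open>The ball of radius \<open>1/4\<close> around \<open>(1/2, 0, 0)\<close> lies in the unit ball, and
  \<open>norm (zeta x) \<ge> 1/4\<close> on it.\<close>

lemma harmonic_energy_positive:
  "0 < (LINT x|lborel. indicator unit_ball x * norm (zeta x) ^ n)"
proof -
  let ?A = "ball ((1/2) *\<^sub>R axis 1 1) (1/4) :: (real^3) set"
  have fin: "emeasure lborel (ball x r) < top" for x :: "real^3" and r
    using emeasure_lborel_ball_finite[of x r] by simp
  have A: "norm x < 1 \<and> 1/4 \<le> norm (zeta x)" if "x \<in> ?A" for x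
  proof -
    have d: "norm (x - (1/2) *\<^sub>R axis 1 1) < 1/4" using that by (simp add: dist_norm norm_minus_commute)
    have "norm ((1/2) *\<^sub>R axis 1 1 :: real^3) = 1/2" by simp
    with d have "norm x < 1" using norm_triangle_sub[of x "(1/2) *\<^sub>R axis 1 1"] by linarith
    moreover have "\<bar>x $ 1 - 1/2\<bar> < 1/4" using component_le_norm_cart[of "x - (1/2) *\<^sub>R axis 1 1" 1] d by (simp add: axis_def)
    moreover have "x $ 1 \<le> norm (zeta x)" using complex_Re_le_cmod[of "zeta x"] by (simp add: zeta_def)
    ultimately show ?thesis by linarith
  qed
  have "0 < (1/4) ^ n * measure lborel ?A" by simp
  also have "\<dots> = (LINT x|lborel. (1/4) ^ n * indicator ?A x)" by simp
  also have "\<dots> \<le> (LINT x|lborel. indicator unit_ball x * norm (zeta x) ^ n)"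
  proof (rule integral_mono)
    show "integrable lborel (\<lambda>x. (1/4) ^ n * indicator ?A x :: real)"
      using fin by (intro integrable_mult_right integrable_real_indicator) auto
    show "integrable lborel (\<lambda>x. indicator unit_ball x * norm (zeta x) ^ n)"
    proof (rule Bochner_Integration.integrable_bound[of _ "indicator unit_ball :: real^3 \<Rightarrow> real"])
      show "integrable lborel (indicator unit_ball :: real^3 \<Rightarrow> real)" using fin by (intro integrable_real_indicator) auto
      show "AE x in lborel. norm (indicator unit_ball x * norm (zeta x) ^ n) \<le> norm (indicator unit_ball x :: real)"
      proof (rule AE_I2)
        fix x :: "real^3"
        have "norm (zeta x) \<le> norm x"
          by (simp add: zeta_def cmod_def norm_eq_sqrt_inner inner_vec_def sum_3 power2_eq_square)
        then show "norm (indicator unit_ball x * norm (zeta x) ^ n) \<le> norm (indicator unit_ball x :: real)"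
          by (auto simp: indicator_def power_le_one)
      qed
      have "continuous_on UNIV (\<lambda>x. norm (zeta x) ^ n)"
        by (intro continuous_intros linear_continuous_on zeta_linear)
      from borel_measurable_continuous_onI[OF this]
      have "(\<lambda>x. indicator unit_ball x * norm (zeta x) ^ n) \<in> borel_measurable borel"
        by (intro borel_measurable_times borel_measurable_indicator) simp_all
      then show "(\<lambda>x. indicator unit_ball x * norm (zeta x) ^ n) \<in> borel_measurable lborel" by simp
    qed
    fix x
    show "(1/4) ^ n * indicator ?A x \<le> indicator unit_ball x * norm (zeta x) ^ n"
      using A[of x] power_mono[of "1/4" "norm (zeta x)" n] by (auto simp: indicator_def)
  qed
  finally show ?thesis .
qed

text \<open>A dilation by \<open>a\<close> contributes \<open>a ^ n\<close> by homogeneity and \<open>a ^ 3\<close> from the volume. For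
  \<open>n = 2 * (k - 1)\<close>, the energy density of the solid harmonic of degree \<open>k\<close>, the exponent is
  \<open>2 * k + 1\<close>.\<close>

lemma harmonic_energy_scaling:
  assumes a: "0 < a" "a \<le> 1"
  shows "(LINT x|lborel. indicator unit_ball x * (indicator (cball 0 a) x * norm (zeta x) ^ n))
    \<le> a ^ (n + 3) * (LINT x|lborel. indicator unit_ball x * norm (zeta x) ^ n)"
proof -
  let ?f = "\<lambda>x. norm (zeta x) ^ n"
  have c: "continuous_on UNIV ?f" by (intro continuous_intros linear_continuous_on zeta_linear)
  have fm: "?f \<in> borel_measurable borel" by (rule borel_measurable_continuous_onI[OF c])
  have m: "(\<lambda>x. indicator A x * ?f x) \<in> borel_measurable borel" if "A \<in> sets borel" for A
    using that by (intro borel_measurable_times borel_measurable_indicator fm) auto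
  have int: "integrable lborel (\<lambda>x. indicator (cball 0 r) x * ?f x)" for r
    using borel_integrable_compact[OF compact_cball continuous_on_subset[OF c]] by simp
  have "(LINT x|lborel. indicator unit_ball x * (indicator (cball 0 a) x * ?f x)) \<le>
     (LINT x|lborel. indicator (cball 0 a) x * ?f x)"
  proof (rule integral_mono[OF _ int])
    show "integrable lborel (\<lambda>x. indicator unit_ball x * (indicator (cball 0 a) x * ?f x))"
      using integrable_mult_indicator[OF _ int, of unit_ball a] by simp
  qed (auto simp: indicator_def)
  also have "\<dots> = a ^ 3 *\<^sub>R (LINT x|lborel. indicator (cball 0 a) (a *\<^sub>R x) * ?f (a *\<^sub>R x))"
    by (rule integral_scale[OF m a(1)]) simp
  also have "(\<lambda>x::real^3. indicator (cball 0 a) (a *\<^sub>R x) * ?f (a *\<^sub>R x)) = (\<lambda>x. a ^ n * (indicator (cball 0 1) x * ?f x))"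
    using a by (auto simp: fun_eq_iff indicator_def zeta_scale norm_mult power_mult_distrib)
  also have "a ^ 3 *\<^sub>R (LINT x|lborel. a ^ n * (indicator (cball 0 1) x * ?f x)) = a ^ (n + 3) * (LINT x|lborel. indicator (cball 0 1) x * ?f x)"
    by (simp only: integral_mult_right_zero) (simp add: power_add)
  also have "(LINT x|lborel. indicator (cball 0 1) x * ?f x) = (LINT x|lborel. indicator unit_ball x * ?f x)"
  proof (rule integral_cong_AE)
    have "AE x in lborel. x \<notin> sphere (0::real^3) 1" by (rule AE_not_in[OF sphere_null])
    then show "AE x in lborel. indicator (cball 0 1) x * ?f x = indicator unit_ball x * ?f x"
      by eventually_elim (auto simp: indicator_def)
  qed (auto intro!: borel_measurable_times borel_measurable_indicator fm)
  finally show ?thesis .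
qed

lemma square_integrable_mult:
  assumes "square_integrable M f" "square_integrable M g"
  shows "integrable M (\<lambda>x. f x * g x)"
proof (rule Bochner_Integration.integrable_bound[of _ "\<lambda>x. (f x)\<^sup>2 + (g x)\<^sup>2"])
  have "\<bar>a * b\<bar> \<le> a\<^sup>2 + b\<^sup>2" for a b :: real
  proof -
    have "0 \<le> \<bar>a\<bar> * \<bar>b\<bar>" by simp
    moreover have "2 * (\<bar>a\<bar> * \<bar>b\<bar>) \<le> a\<^sup>2 + b\<^sup>2" using sum_squares_bound[of "\<bar>a\<bar>" "\<bar>b\<bar>"] by simp
    ultimately show ?thesis unfolding abs_mult by linarith
  qed
  then show "AE x in M. norm (f x * g x) \<le> norm ((f x)\<^sup>2 + (g x)\<^sup>2)" by simp
qed (use assms in \<open>auto simp: square_integrable_def\<close>)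

lemma square_integrable_diff:
  assumes "square_integrable M f" "square_integrable M g"
  shows "square_integrable M (\<lambda>x. f x - g x)"
proof -
  have "(\<lambda>x. (f x - g x)\<^sup>2) = (\<lambda>x. (f x)\<^sup>2 - 2 * (f x * g x) + (g x)\<^sup>2)"
    by (simp add: power2_diff mult.assoc fun_eq_iff)
  moreover have "integrable M (\<lambda>x. (f x)\<^sup>2 - 2 * (f x * g x) + (g x)\<^sup>2)"
    using square_integrable_mult[OF assms] assms
    by (intro Bochner_Integration.integrable_add Bochner_Integration.integrable_diff integrable_mult_right) (auto simp: square_integrable_def)
  ultimately show ?thesis using assms by (auto simp: square_integrable_def intro!: borel_measurable_diff)
qed

lemma square_integrable_inner:
  fixes V W :: "'a \<Rightarrow> real^3"
  assumes "\<And>i. square_integrable M (\<lambda>x. V x $ i)" "\<And>i. square_integrable M (\<lambda>x. W x $ i)"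
  shows "integrable M (\<lambda>x. V x \<bullet> W x)"
  unfolding inner_vec_def inner_real_def by (intro Bochner_Integration.integrable_sum square_integrable_mult assms)

section \<open>The eigenvalues of the Dirichlet to Neumann map\<close>

text \<open>Let \<open>p\<close> be the solid harmonic of degree \<open>k\<close> with gradient \<open>P\<close>, \<open>G\<close> the gradient of the
  solution with boundary values \<open>p\<close>, \<open>D = G - P\<close> and \<open>N = \<integral> p\<^sup>2\<close> over the sphere. Testing the
  weak conormal derivative with \<open>D\<close>, whose trace is \<open>0\<close>, shows \<open>\<integral> \<gamma> G \<bullet> D = 0\<close>, and Green's
  formula shows \<open>\<integral> P \<bullet> D = 0\<close>. Subtracting, \<open>\<integral> \<gamma> \<bar>D\<bar>\<^sup>2 = - \<integral> (\<gamma> - 1) P \<bullet> D\<close>, so that the energy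
  of \<open>D\<close> is bounded by the energy \<open>q\<close> of \<open>p\<close> on the ball of radius \<open>\<alpha>\<close>. Likewise
  \<open>(l - k) * N = \<integral> (\<gamma> - 1) G \<bullet> P\<close>, which is again bounded by a constant times \<open>q\<close>; and \<open>q\<close> is at
  most \<open>\<alpha> ^ (2 * k + 1)\<close> times the full energy \<open>k * N\<close> of \<open>p\<close>.\<close>

lemma DN_eigenvalue_close:
  assumes gm: "\<gamma> \<in> borel_measurable ball_measure" and gM: "AE x in ball_measure. \<bar>\<gamma> x\<bar> \<le> M"
    and c: "0 < c" "AE x in ball_measure. c \<le> \<gamma> x"
    and g1: "AE x in ball_measure. x \<notin> cball 0 \<alpha> \<longrightarrow> \<gamma> x - 1 = 0" and a: "0 < \<alpha>" "\<alpha> \<le> 1"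
    and DN: "DN_eigenvalue \<gamma> k l" and k: "1 \<le> k"
  shows "\<bar>l - real k\<bar> \<le> ((\<bar>M\<bar> + 1)\<^sup>2 / c + (\<bar>M\<bar> + 1)) * real k * \<alpha> ^ (2 * k + 1)"
proof -
  define p where "p = harmonic_power 1 k"
  define P where "P = grad p"
  have ps: "smooth p" by (simp add: p_def harmonic_power_smooth)
  obtain u G where sol: "conductivity_solution \<gamma> p u G"
    and L: "\<And>v H g. has_trace v H g \<Longrightarrow> (LINT x|sphere_measure. (l * p x) * g x) = (LINT x|ball_measure. \<gamma> x * (G x \<bullet> H x))"
  proof -
    have "DN_map \<gamma> p (\<lambda>g. LINT x|sphere_measure. (l * p x) * g x)"
      using DN[unfolded DN_eigenvalue_def, rule_format, OF spherical_harmonic_power[of k]] by (simp add: p_def)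
    then show ?thesis using that unfolding DN_map_def by (elim exE conjE) blast
  qed
  have tr: "has_trace u G p" using sol by (simp add: conductivity_solution_def)
  obtain w where w: "\<And>n. smooth (w n)"
    "(\<lambda>n. LINT x|ball_measure. (norm (grad (w n) x - G x))\<^sup>2) \<longlonglongrightarrow> 0"
    "(\<lambda>n. LINT x|sphere_measure. (w n x - p x)\<^sup>2) \<longlonglongrightarrow> 0"
    using tr unfolding has_trace_def by blast
  have G: "square_integrable ball_measure (\<lambda>x. G x $ i)" for i using tr by (simp add: has_trace_def H1_def)
  have gradsq: "square_integrable ball_measure (\<lambda>x. grad v x $ i)" if "smooth v" for v i
    using has_trace_smooth[OF that] unfolding has_trace_def H1_def by blast
  note Psq = gradsq[OF ps, folded P_def]
  define D where "D x = G x - P x" for x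
  have Dsq: "square_integrable ball_measure (\<lambda>x. D x $ i)" for i
    using square_integrable_diff[OF G Psq] by (simp add: D_def)
  define N where "N = (LINT x|sphere_measure. p x * p x)"
  have pc: "continuous_on UNIV p" by (rule smooth_continuous_on[OF ps])
  \<comment> \<open>Green's formula needs a smooth function, so it is applied to the sequence \<open>w\<close> that
    defines the trace; both sides converge in the mean square.\<close>
  have GP: "(LINT x|ball_measure. G x \<bullet> P x) = real k * N"
  proof -
    have wP: "(LINT x|ball_measure. grad (w n) x \<bullet> P x) = real k * (LINT x|sphere_measure. w n x * p x)" for n
      unfolding P_def p_def by (rule green_ball[OF w(1) harmonic_power_smooth harmonic_power_homogeneous harmonic_power_laplacian])
    have dsq: "square_integrable ball_measure (\<lambda>x. (grad (w n) x - G x) $ i)" for n i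
      using square_integrable_diff[OF gradsq[OF w(1)] G] by simp
    have "(\<lambda>n. LINT x|ball_measure. (grad (w n) x - G x) \<bullet> P x) \<longlonglongrightarrow> 0"
    proof (rule L2_limit[OF _ w(2)])
      show "integrable ball_measure (\<lambda>x. (norm (grad (w n) x - G x))\<^sup>2)" for n
        unfolding power2_norm_eq_inner by (rule square_integrable_inner[OF dsq dsq])
      show "integrable ball_measure (\<lambda>x. (norm (P x))\<^sup>2)"
        unfolding power2_norm_eq_inner by (rule square_integrable_inner[OF Psq Psq])
      show "integrable ball_measure (\<lambda>x. (grad (w n) x - G x) \<bullet> P x)" for n
        by (rule square_integrable_inner[OF dsq Psq])
    qed (simp add: Cauchy_Schwarz_ineq2)
    moreover have "(LINT x|ball_measure. (grad (w n) x - G x) \<bullet> P x) =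
       (LINT x|ball_measure. grad (w n) x \<bullet> P x) - (LINT x|ball_measure. G x \<bullet> P x)" for n
      unfolding inner_diff_left
      by (intro Bochner_Integration.integral_diff square_integrable_inner gradsq w(1) G Psq)
    ultimately have 1: "(\<lambda>n. real k * (LINT x|sphere_measure. w n x * p x)) \<longlonglongrightarrow> (LINT x|ball_measure. G x \<bullet> P x)"
      unfolding wP by (simp add: LIM_zero_iff)
    have wc: "continuous_on UNIV (w n)" for n by (rule smooth_continuous_on[OF w(1)])
    have "(\<lambda>n. LINT x|sphere_measure. (w n x - p x) * p x) \<longlonglongrightarrow> 0"
      by (rule L2_limit[OF _ w(3)])
         (auto intro!: sphere_integrable continuous_intros wc pc simp: abs_mult)
    moreover have "(LINT x|sphere_measure. (w n x - p x) * p x) = (LINT x|sphere_measure. w n x * p x) - N" for n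
      unfolding N_def left_diff_distrib
      by (intro Bochner_Integration.integral_diff sphere_integrable continuous_intros wc pc)
    ultimately have "(\<lambda>n. LINT x|sphere_measure. w n x * p x) \<longlonglongrightarrow> N" by (simp add: LIM_zero_iff)
    then have "(\<lambda>n. real k * (LINT x|sphere_measure. w n x * p x)) \<longlonglongrightarrow> real k * N" by (intro tendsto_intros)
    then show ?thesis using 1 LIMSEQ_unique by blast
  qed
  have PP: "(LINT x|ball_measure. P x \<bullet> P x) = real k * N"
    unfolding P_def p_def N_def by (rule green_ball[OF harmonic_power_smooth harmonic_power_smooth harmonic_power_homogeneous harmonic_power_laplacian])
  have lN: "(LINT x|sphere_measure. (l * p x) * p x) = l * N"
    unfolding N_def mult.assoc by (rule integral_mult_right_zero)
  \<comment> \<open>The functional given by the eigenvalue, applied to the two extensions of \<open>p\<close> at hand: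
    the solution and \<open>p\<close> itself.\<close>
  have GG: "(LINT x|ball_measure. \<gamma> x * (G x \<bullet> G x)) = l * N" using L[OF tr] lN by simp
  have gGP: "(LINT x|ball_measure. \<gamma> x * (G x \<bullet> P x)) = l * N"
    using L[OF has_trace_smooth[OF ps]] lN by (simp add: P_def)
  have gint: "integrable ball_measure (\<lambda>x. \<gamma> x * f x)" if "integrable ball_measure f" for f
  proof (rule Bochner_Integration.integrable_bound[of _ "\<lambda>x. \<bar>M\<bar> * f x"])
    show "AE x in ball_measure. norm (\<gamma> x * f x) \<le> norm (\<bar>M\<bar> * f x)"
      using gM by eventually_elim (auto simp: abs_mult intro!: mult_right_mono)
  qed (use that gm in auto)
  note ii = square_integrable_inner[OF G G] square_integrable_inner[OF G Psq] square_integrable_inner[OF Psq Psq]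
    square_integrable_inner[OF Dsq Dsq] square_integrable_inner[OF Psq Dsq]
  note gi = ii[THEN gint]
  have en: "(LINT x|ball_measure. \<gamma> x * (D x \<bullet> D x)) = - (LINT x|ball_measure. (\<gamma> x - 1) * (P x \<bullet> D x))"
  proof -
    have "(\<lambda>x. \<gamma> x * (D x \<bullet> D x)) = (\<lambda>x. \<gamma> x * (G x \<bullet> G x) - 2 * (\<gamma> x * (G x \<bullet> P x)) + \<gamma> x * (P x \<bullet> P x))"
      by (simp add: D_def inner_diff_left inner_diff_right inner_commute algebra_simps fun_eq_iff)
    then have 1: "(LINT x|ball_measure. \<gamma> x * (D x \<bullet> D x)) = - (l * N) + (LINT x|ball_measure. \<gamma> x * (P x \<bullet> P x))"
      using gi GG gGP by simp
    have "(\<lambda>x. (\<gamma> x - 1) * (P x \<bullet> D x)) = (\<lambda>x. \<gamma> x * (G x \<bullet> P x) - \<gamma> x * (P x \<bullet> P x) - G x \<bullet> P x + P x \<bullet> P x)"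
      by (simp add: D_def inner_diff_left inner_diff_right inner_commute algebra_simps fun_eq_iff)
    then have 2: "(LINT x|ball_measure. (\<gamma> x - 1) * (P x \<bullet> D x)) = l * N - (LINT x|ball_measure. \<gamma> x * (P x \<bullet> P x))"
      using gi ii GP PP gGP by simp
    show ?thesis using 1 2 by simp
  qed
  define K where "K = \<bar>M\<bar> + 1"
  have K: "0 < K" by (simp add: K_def)
  have gK: "AE x in ball_measure. \<bar>\<gamma> x - 1\<bar> \<le> K * indicator (cball 0 \<alpha>) x"
    using gM g1 by eventually_elim (auto simp: K_def indicator_def)
  define q where "q = (LINT x|ball_measure. indicator (cball 0 \<alpha>) x * (P x \<bullet> P x))"
  have ind: "(indicator (cball 0 \<alpha>) :: real^3 \<Rightarrow> real) \<in> borel_measurable ball_measure"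
    by (intro ball_measurable borel_measurable_indicator) simp
  have qi: "integrable ball_measure (\<lambda>x. indicator (cball 0 \<alpha>) x * (P x \<bullet> P x))"
  proof (rule Bochner_Integration.integrable_bound[OF ii(3)])
    show "(\<lambda>x. indicator (cball 0 \<alpha>) x * (P x \<bullet> P x)) \<in> borel_measurable ball_measure"
      by (intro borel_measurable_times ind borel_measurable_integrable[OF ii(3)])
  qed (auto simp: indicator_def)
  define E where "E = (LINT x|ball_measure. D x \<bullet> D x)"
  have pdi: "integrable ball_measure (\<lambda>x. (\<gamma> x - 1) * (P x \<bullet> D x))"
    using gi(5) ii(5) by (simp add: left_diff_distrib)
  have cross: "\<bar>LINT x|ball_measure. (\<gamma> x - 1) * (P x \<bullet> D x)\<bar> \<le> c / 2 * E + K\<^sup>2 / (2 * c) * q"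
  proof -
    have "\<bar>LINT x|ball_measure. (\<gamma> x - 1) * (P x \<bullet> D x)\<bar> \<le> (LINT x|ball_measure. \<bar>(\<gamma> x - 1) * (P x \<bullet> D x)\<bar>)"
      by (rule integral_abs_bound)
    also have "\<dots> \<le> (LINT x|ball_measure. c / 2 * (D x \<bullet> D x) + K\<^sup>2 / (2 * c) * (indicator (cball 0 \<alpha>) x * (P x \<bullet> P x)))"
    proof (rule integral_mono_AE)
      show "integrable ball_measure (\<lambda>x. \<bar>(\<gamma> x - 1) * (P x \<bullet> D x)\<bar>)" using pdi by simp
      show "integrable ball_measure (\<lambda>x. c / 2 * (D x \<bullet> D x) + K\<^sup>2 / (2 * c) * (indicator (cball 0 \<alpha>) x * (P x \<bullet> P x)))"
        using ii(4) qi by (intro Bochner_Integration.integrable_add integrable_mult_right)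
      show "AE x in ball_measure. \<bar>(\<gamma> x - 1) * (P x \<bullet> D x)\<bar> \<le> c / 2 * (D x \<bullet> D x) + K\<^sup>2 / (2 * c) * (indicator (cball 0 \<alpha>) x * (P x \<bullet> P x))"
        using gK
      proof eventually_elim
        case (elim x)
        let ?i = "indicator (cball 0 \<alpha>) x :: real"
        have "\<bar>(\<gamma> x - 1) * (P x \<bullet> D x)\<bar> \<le> (K * ?i) * (norm (P x) * norm (D x))"
          unfolding abs_mult using elim by (intro mult_mono Cauchy_Schwarz_ineq2) auto
        also have "\<dots> \<le> c / 2 * (norm (D x))\<^sup>2 + K\<^sup>2 / (2 * c) * (?i * (norm (P x))\<^sup>2)"
        proof -
          \<comment> \<open>The weights are chosen so that half of \<open>c * E\<close> is left after absorbing the term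
            in \<open>D\<close>.\<close>
          have "0 \<le> (c * norm (D x) - K * (?i * norm (P x)))\<^sup>2 / (2 * c)" using c by simp
          also have "\<dots> = c / 2 * (norm (D x))\<^sup>2 + K\<^sup>2 / (2 * c) * (?i * (norm (P x))\<^sup>2) - (K * ?i) * (norm (P x) * norm (D x))"
            using c(1) by (simp add: power2_diff power_mult_distrib field_simps power2_eq_square indicator_def)
          finally show ?thesis by simp
        qed
        finally show ?case by (simp add: power2_norm_eq_inner)
      qed
    qed
    also have "\<dots> = c / 2 * E + K\<^sup>2 / (2 * c) * q"
      unfolding E_def q_def
      by (subst Bochner_Integration.integral_add) (use ii(4) qi in \<open>auto simp only: integral_mult_right_zero intro!: integrable_mult_right\<close>)
    finally show ?thesis .
  qed
  have "c * E \<le> (LINT x|ball_measure. \<gamma> x * (D x \<bullet> D x))"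
  proof -
    have "c * E = (LINT x|ball_measure. c * (D x \<bullet> D x))" by (simp add: E_def)
    also have "\<dots> \<le> (LINT x|ball_measure. \<gamma> x * (D x \<bullet> D x))"
    proof (rule integral_mono_AE[OF _ gi(4)])
      show "AE x in ball_measure. c * (D x \<bullet> D x) \<le> \<gamma> x * (D x \<bullet> D x)"
        using c(2) by eventually_elim (intro mult_right_mono, auto)
    qed (use ii(4) in auto)
    finally show ?thesis .
  qed
  with en cross have cE: "c / 2 * E \<le> K\<^sup>2 / (2 * c) * q" by linarith
  have "(l - real k) * N = (LINT x|ball_measure. (\<gamma> x - 1) * (P x \<bullet> D x)) + (LINT x|ball_measure. (\<gamma> x - 1) * (P x \<bullet> P x))"
  proof -
    have "(\<lambda>x. (\<gamma> x - 1) * (P x \<bullet> D x)) = (\<lambda>x. \<gamma> x * (G x \<bullet> P x) - \<gamma> x * (P x \<bullet> P x) - G x \<bullet> P x + P x \<bullet> P x)"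
      by (simp add: D_def inner_diff_left inner_diff_right inner_commute algebra_simps fun_eq_iff)
    then have "(LINT x|ball_measure. (\<gamma> x - 1) * (P x \<bullet> D x)) = l * N - (LINT x|ball_measure. \<gamma> x * (P x \<bullet> P x))"
      using gi ii GP PP gGP by simp
    moreover have "(LINT x|ball_measure. (\<gamma> x - 1) * (P x \<bullet> P x)) = (LINT x|ball_measure. \<gamma> x * (P x \<bullet> P x)) - real k * N"
      unfolding left_diff_distrib using gi ii PP by simp
    ultimately show ?thesis by (simp add: algebra_simps)
  qed
  moreover have "\<bar>LINT x|ball_measure. (\<gamma> x - 1) * (P x \<bullet> P x)\<bar> \<le> K * q"
  proof -
    have "\<bar>LINT x|ball_measure. (\<gamma> x - 1) * (P x \<bullet> P x)\<bar> \<le> (LINT x|ball_measure. \<bar>(\<gamma> x - 1) * (P x \<bullet> P x)\<bar>)"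
      by (rule integral_abs_bound)
    also have "\<dots> \<le> (LINT x|ball_measure. K * (indicator (cball 0 \<alpha>) x * (P x \<bullet> P x)))"
    proof (rule integral_mono_AE)
      show "integrable ball_measure (\<lambda>x. \<bar>(\<gamma> x - 1) * (P x \<bullet> P x)\<bar>)" using gi(3) ii(3) by (simp add: left_diff_distrib)
      show "AE x in ball_measure. \<bar>(\<gamma> x - 1) * (P x \<bullet> P x)\<bar> \<le> K * (indicator (cball 0 \<alpha>) x * (P x \<bullet> P x))"
        using gK
      proof eventually_elim
        case (elim x)
        from mult_right_mono[OF this, of "P x \<bullet> P x"] show ?case by (simp add: abs_mult)
      qed
    qed (use qi in auto)
    finally show ?thesis by (simp add: q_def)
  qed
  ultimately have main: "\<bar>l - real k\<bar> * \<bar>N\<bar> \<le> (K\<^sup>2 / c + K) * q"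
  proof -
    assume e: "(l - real k) * N = (LINT x|ball_measure. (\<gamma> x - 1) * (P x \<bullet> D x)) + (LINT x|ball_measure. (\<gamma> x - 1) * (P x \<bullet> P x))"
      and b: "\<bar>LINT x|ball_measure. (\<gamma> x - 1) * (P x \<bullet> P x)\<bar> \<le> K * q"
    have "\<bar>l - real k\<bar> * \<bar>N\<bar> = \<bar>(l - real k) * N\<bar>" by (simp add: abs_mult)
    also have "\<dots> \<le> (K\<^sup>2 / (2 * c) * q + K\<^sup>2 / (2 * c) * q) + K * q" unfolding e using b cross cE by linarith
    also have "\<dots> = (K\<^sup>2 / c + K) * q" using c(1) by (simp add: field_simps)
    finally show ?thesis .
  qed
  have PPz: "P x \<bullet> P x = (real k)\<^sup>2 * norm (zeta x) ^ (2 * (k - 1))" for x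
    unfolding P_def p_def by (rule harmonic_power_grad_norm)
  define Z where "Z = (LINT x|lborel. indicator unit_ball x * norm (zeta x) ^ (2 * (k - 1)))"
  have zm: "(\<lambda>x. norm (zeta x) ^ n) \<in> borel_measurable borel" for n
    by (intro borel_measurable_continuous_onI continuous_intros linear_continuous_on zeta_linear)
  have kN: "real k * N = (real k)\<^sup>2 * Z"
  proof -
    have "real k * N = (LINT x|ball_measure. (real k)\<^sup>2 * norm (zeta x) ^ (2 * (k - 1)))" using PP by (simp add: PPz)
    also have "\<dots> = (real k)\<^sup>2 * (LINT x|ball_measure. norm (zeta x) ^ (2 * (k - 1)))" by simp
    finally show ?thesis by (simp only: ball_integral[OF zm] Z_def)
  qed
  then have N: "N = real k * Z" using k by (simp add: power2_eq_square)
  have Z: "0 < Z" unfolding Z_def by (rule harmonic_energy_positive)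
  have qle: "q \<le> (real k)\<^sup>2 * (\<alpha> ^ (2 * k + 1) * Z)"
  proof -
    have "q = (LINT x|ball_measure. (real k)\<^sup>2 * (indicator (cball 0 \<alpha>) x * norm (zeta x) ^ (2 * (k - 1))))"
      unfolding q_def PPz by (simp only: mult.left_commute)
    also have "\<dots> = (real k)\<^sup>2 * (LINT x|ball_measure. indicator (cball 0 \<alpha>) x * norm (zeta x) ^ (2 * (k - 1)))"
      by (simp only: integral_mult_right_zero)
    also have "(LINT x|ball_measure. indicator (cball 0 \<alpha>) x * norm (zeta x) ^ (2 * (k - 1))) =
       (LINT x|lborel. indicator unit_ball x * (indicator (cball 0 \<alpha>) x * norm (zeta x) ^ (2 * (k - 1))))"
      by (rule ball_integral) (intro borel_measurable_times borel_measurable_indicator zm, simp)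
    also have "\<dots> \<le> \<alpha> ^ (2 * (k - 1) + 3) * Z" unfolding Z_def by (rule harmonic_energy_scaling[OF a])
    also have "2 * (k - 1) + 3 = 2 * k + 1" using k by simp
    finally show ?thesis by (simp add: mult_left_mono)
  qed
  have "\<bar>l - real k\<bar> * (real k * Z) \<le> (K\<^sup>2 / c + K) * q" using main Z by (simp add: N)
  also have "\<dots> \<le> (K\<^sup>2 / c + K) * ((real k)\<^sup>2 * (\<alpha> ^ (2 * k + 1) * Z))"
    using K c(1) by (intro mult_left_mono qle) auto
  also have "\<dots> = ((K\<^sup>2 / c + K) * real k * \<alpha> ^ (2 * k + 1)) * (real k * Z)" by (simp add: power2_eq_square mult_ac)
  finally have "\<bar>l - real k\<bar> * (real k * Z) \<le> ((K\<^sup>2 / c + K) * real k * \<alpha> ^ (2 * k + 1)) * (real k * Z)" .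
  moreover have "0 < real k * Z" using Z k by simp
  ultimately show ?thesis unfolding K_def by (rule mult_right_le_imp_le)
qed

section \<open>Laplace and Borel transforms of even series\<close>

lemma exp_moment:
  assumes s: "0 < s"
  shows "has_bochner_integral lborel (\<lambda>r::real. indicator {0..} r * (r ^ n * exp (- s * r))) (fact n / s ^ (n + 1))"
proof -
  have "(\<integral>\<^sup>+t. ennreal (indicator {0..} t * t ^ n * exp (- t)) \<partial>lborel) =
      (\<integral>\<^sup>+t. ennreal (indicator {0..} t * t powr (real (n + 1) - 1) / exp t) \<partial>lborel)"
  proof (rule nn_integral_cong_AE)
    have "AE t in lborel. t \<noteq> (0::real)" by (rule AE_lborel_singleton)
    then show "AE t in lborel. ennreal (indicator {0..} t * t ^ n * exp (- t)) =
       ennreal (indicator {0..} t * t powr (real (n + 1) - 1) / exp t)"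
      by eventually_elim (auto simp: indicator_def powr_realpow exp_minus divide_inverse)
  qed
  also have "\<dots> = ennreal (fact n)"
    using Gamma_conv_nn_integral_real[of "real (n + 1)"] Gamma_fact[of n, where 'a=real] by (simp add: add.commute)
  finally have "has_bochner_integral lborel (\<lambda>t::real. indicator {0..} t * t ^ n * exp (- t)) (fact n)"
    by (intro has_bochner_integral_nn_integral) (auto simp: indicator_def)
  then have "has_bochner_integral lborel (\<lambda>r::real. indicator {0..} (0 + s * r) * (0 + s * r) ^ n * exp (- (0 + s * r))) (fact n /\<^sub>R \<bar>s\<bar>)"
    using s by (subst lborel_has_bochner_integral_real_affine_iff[symmetric]) auto
  then have "has_bochner_integral lborel (\<lambda>r::real. (1 / s ^ n) * (indicator {0..} (0 + s * r) * (0 + s * r) ^ n * exp (- (0 + s * r)))) ((1 / s ^ n) * (fact n /\<^sub>R \<bar>s\<bar>))"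
    by (rule has_bochner_integral_mult_right)
  moreover have "(\<lambda>r::real. (1 / s ^ n) * (indicator {0..} (0 + s * r) * (0 + s * r) ^ n * exp (- (0 + s * r)))) =
     (\<lambda>r. indicator {0..} r * (r ^ n * exp (- s * r)))"
    using s by (auto simp: fun_eq_iff indicator_def power_mult_distrib zero_le_mult_iff)
  ultimately show ?thesis using s by (simp add: field_simps)
qed

lemma poly_exp_integrable:
  assumes s: "0 < s"
  shows "integrable lborel (\<lambda>r::real. indicator {0..} r * ((1 + r) ^ n * exp (- s * r)))"
proof -
  have "(\<lambda>r::real. indicator {0..} r * ((1 + r) ^ n * exp (- s * r))) =
     (\<lambda>r. \<Sum>i\<le>n. of_nat (n choose i) * (indicator {0..} r * (r ^ i * exp (- s * r))))"
  proof
    fix r :: real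
    have "(1 + r) ^ n = (\<Sum>i\<le>n. of_nat (n choose i) * r ^ i)"
      using binomial_ring[of r 1 n] by (simp add: add.commute)
    then show "indicator {0..} r * ((1 + r) ^ n * exp (- s * r)) =
      (\<Sum>i\<le>n. of_nat (n choose i) * (indicator {0..} r * (r ^ i * exp (- s * r))))"
      by (simp add: sum_distrib_left sum_distrib_right mult_ac)
  qed
  then show ?thesis
    using has_bochner_integral_integrable exp_moment[OF s]
    by (auto intro!: Bochner_Integration.integrable_sum integrable_mult_right simp: has_bochner_integral_iff simp del: minus_mult_left[symmetric])
qed

definition laplace :: "(real \<Rightarrow> real) \<Rightarrow> complex \<Rightarrow> complex" where
  "laplace k z = (LINT r|lborel. indicator {0..} r *\<^sub>R (of_real (k r) * exp (- z * of_real r)))"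

lemma laplace_integrable:
  assumes k[measurable]: "k \<in> borel_measurable borel" and bd: "\<And>r. 0 \<le> r \<Longrightarrow> \<bar>k r\<bar> \<le> C * (1 + r) ^ n" and z: "0 < Re z"
  shows "integrable lborel (\<lambda>r. indicator {0..} r *\<^sub>R (of_real (k r) * exp (- z * of_real r)))"
proof (rule Bochner_Integration.integrable_bound[OF integrable_mult_right[OF poly_exp_integrable[OF z], of C n]])
  show "AE r in lborel. norm (indicator {0..} r *\<^sub>R (of_real (k r) * exp (- z * of_real r))) \<le>
     norm (C * (indicator {0..} r * ((1 + r) ^ n * exp (- Re z * r))))"
  proof (rule AE_I2)
    fix r :: real
    show "norm (indicator {0..} r *\<^sub>R (of_real (k r) * exp (- z * of_real r))) \<le>
     norm (C * (indicator {0..} r * ((1 + r) ^ n * exp (- Re z * r))))"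
    proof (cases "0 \<le> r")
      case True
      have "\<bar>k r\<bar> * exp (- Re z * r) \<le> \<bar>C\<bar> * (1 + r) ^ n * exp (- Re z * r)"
        using order_trans[OF bd[OF True] mult_right_mono[OF abs_ge_self]] True by (intro mult_right_mono) auto
      then show ?thesis using True by (simp add: norm_mult abs_mult mult.assoc)
    qed simp
  qed
qed measurable

text \<open>As for the Fourier transform, the derivative is found from the second order remainder of
  the exponential. Within distance \<open>Re z / 2\<close> of \<open>z\<close>, half of the exponential decay is left to
  make the remainder integrable.\<close>

lemma laplace_holomorphic:
  assumes k[measurable]: "k \<in> borel_measurable borel" and bd: "\<And>r. 0 \<le> r \<Longrightarrow> \<bar>k r\<bar> \<le> C * (1 + r) ^ n"
  shows "laplace k holomorphic_on {z. 0 < Re z}"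
proof (rule holomorphic_onI)
  fix z :: complex assume "z \<in> {z. 0 < Re z}"
  then have z: "0 < Re z" by simp
  define x where "x = Re z"
  let ?e = "\<lambda>z r. indicator {0..} r *\<^sub>R (of_real (k r) * exp (- z * of_real r)) :: complex"
  let ?d = "\<lambda>r. indicator {0..} r *\<^sub>R (of_real (- r * k r) * exp (- z * of_real r)) :: complex"
  have C0: "0 \<le> C" using bd[of 0] by auto
  have bd1: "\<bar>- r * k r\<bar> \<le> C * (1 + r) ^ Suc n" if "0 \<le> r" for r
  proof -
    have "\<bar>- r * k r\<bar> = r * \<bar>k r\<bar>" using that by (simp add: abs_mult)
    also have "\<dots> \<le> (1 + r) * (C * (1 + r) ^ n)" using bd[OF that] that by (intro mult_mono) auto
    finally show ?thesis by (simp add: mult_ac)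
  qed
  have di: "integrable lborel ?d" by (rule laplace_integrable[OF _ bd1 z]) measurable
  have ei: "integrable lborel (?e w)" if "0 < Re w" for w by (rule laplace_integrable[OF k bd that])
  have mi: "integrable lborel (\<lambda>r. C * (indicator {0..} r * ((1 + r) ^ (n + 2) * exp (- (x / 2) * r))))"
    by (intro integrable_mult_right poly_exp_integrable) (use z in \<open>simp add: x_def\<close>)
  define M where "M = (LINT r|lborel. C * (indicator {0..} r * ((1 + r) ^ (n + 2) * exp (- (x / 2) * r))))"
  have "(laplace k has_field_derivative (LINT r|lborel. ?d r)) (at z)"
    unfolding has_field_derivative_def
  proof (rule has_derivativeI_sandwich[where e="x / 2" and H="\<lambda>y. norm (y - z) * M"])
    show "0 < x / 2" using z by (simp add: x_def)
    show "bounded_linear ((*) (LINT r|lborel. ?d r))" by (rule bounded_linear_mult_right)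
    show "((\<lambda>y. norm (y - z) * M) \<longlongrightarrow> 0) (at z)" by (auto intro!: tendsto_eq_intros)
    fix y assume y: "y \<noteq> z" "dist y z < x / 2"
    let ?h = "y - z"
    have nh: "norm ?h < x / 2" using y by (simp add: dist_norm)
    have rey: "0 < Re y" using nh abs_Re_le_cmod[of ?h] by (auto simp: x_def abs_le_iff)
    have eq: "laplace k y - laplace k z - (LINT r|lborel. ?d r) * ?h = (LINT r|lborel. ?e y r - ?e z r - ?d r * ?h)"
      unfolding laplace_def
      by (simp only: Bochner_Integration.integral_diff[OF Bochner_Integration.integrable_diff[OF ei[OF rey] ei[OF z]] integrable_mult_left[OF di]]
          Bochner_Integration.integral_diff[OF ei[OF rey] ei[OF z]] integral_mult_left_zero)
    have "norm (LINT r|lborel. ?e y r - ?e z r - ?d r * ?h) \<le> (LINT r|lborel. (norm ?h)\<^sup>2 * (C * (indicator {0..} r * ((1 + r) ^ (n + 2) * exp (- (x / 2) * r)))))"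
    proof (rule integral_norm_le)
      show "integrable lborel (\<lambda>r. ?e y r - ?e z r - ?d r * ?h)"
        using ei[OF rey] ei[OF z] di by (intro Bochner_Integration.integrable_diff integrable_mult_left) auto
      show "integrable lborel (\<lambda>r. (norm ?h)\<^sup>2 * (C * (indicator {0..} r * ((1 + r) ^ (n + 2) * exp (- (x / 2) * r)))))"
        by (intro integrable_mult_right mi)
      fix r :: real
      show "norm (?e y r - ?e z r - ?d r * ?h) \<le> (norm ?h)\<^sup>2 * (C * (indicator {0..} r * ((1 + r) ^ (n + 2) * exp (- (x / 2) * r))))"
      proof (cases "0 \<le> r")
        case True
        let ?t = "- ?h * of_real r"
        have ey: "exp (- y * of_real r) = exp (- z * of_real r) * exp ?t"
          by (simp flip: exp_add add: algebra_simps)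
        have "?e y r - ?e z r - ?d r * ?h = of_real (k r) * exp (- y * of_real r) - of_real (k r) * exp (- z * of_real r)
            - of_real (- r * k r) * exp (- z * of_real r) * ?h" using True by simp
        also have "\<dots> = of_real (k r) * exp (- z * of_real r) * (exp ?t - 1 - ?t)"
          unfolding ey by (simp add: algebra_simps)
        finally have "?e y r - ?e z r - ?d r * ?h = of_real (k r) * exp (- z * of_real r) * (exp ?t - 1 - ?t)" .
        then have "norm (?e y r - ?e z r - ?d r * ?h) = \<bar>k r\<bar> * exp (- x * r) * norm (exp ?t - 1 - ?t)"
          by (simp add: norm_mult x_def)
        also have "\<dots> \<le> (C * (1 + r) ^ n) * exp (- x * r) * (exp (x / 2 * r) * (norm ?h * r)\<^sup>2)"
        proof (intro mult_mono)
          have "norm (exp ?t - 1 - ?t) \<le> exp \<bar>Re ?t\<bar> * (norm ?t)\<^sup>2"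
            using Taylor_exp[of ?t 1] by (simp add: diff_diff_eq power2_eq_square)
          also have "\<dots> \<le> exp (x / 2 * r) * (norm ?h * r)\<^sup>2"
          proof (intro mult_mono)
            have "\<bar>Re ?t\<bar> \<le> norm ?t" by (rule abs_Re_le_cmod)
            also have "\<dots> = norm ?h * r" using True by (simp add: norm_mult norm_minus_commute)
            also have "\<dots> \<le> x / 2 * r" using nh True by (intro mult_right_mono) auto
            finally show "exp \<bar>Re ?t\<bar> \<le> exp (x / 2 * r)" by simp
            show "(norm ?t)\<^sup>2 \<le> (norm ?h * r)\<^sup>2" using True by (simp add: norm_mult norm_minus_commute)
          qed auto
          finally show "norm (exp ?t - 1 - ?t) \<le> exp (x / 2 * r) * (norm ?h * r)\<^sup>2" .
        qed (use bd[OF True] C0 True in auto)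
        also have "\<dots> = (norm ?h)\<^sup>2 * (C * ((1 + r) ^ n * r\<^sup>2 * exp (- (x / 2) * r)))"
        proof -
          have "exp (- x * r) * exp (x / 2 * r) = exp (- (x / 2) * r)" by (simp flip: exp_add)
          then show ?thesis by (simp add: power_mult_distrib algebra_simps)
        qed
        also have "\<dots> \<le> (norm ?h)\<^sup>2 * (C * ((1 + r) ^ n * (1 + r)\<^sup>2 * exp (- (x / 2) * r)))"
          using True C0 by (intro mult_left_mono mult_right_mono power_mono) auto
        also have "(1 + r) ^ n * (1 + r)\<^sup>2 = (1 + r) ^ (n + 2)" by (simp only: power_add)
        finally show ?thesis using True by simp
      qed simp
    qed
    also have "\<dots> = (norm ?h)\<^sup>2 * M" unfolding M_def by (simp only: integral_mult_right_zero)
    finally have le: "norm (laplace k y - laplace k z - (LINT r|lborel. ?d r) * ?h) \<le> (norm ?h)\<^sup>2 * M"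
      unfolding eq .
    have "N / t \<le> t * M" if "N \<le> t\<^sup>2 * M" "0 < t" for N t M :: real
      using that by (simp add: pos_divide_le_eq power2_eq_square mult_ac)
    from this[OF le] y show "norm (laplace k y - laplace k z - (LINT r|lborel. ?d r) * ?h) / norm ?h \<le> norm (y - z) * M"
      by simp
  qed
  then have "laplace k field_differentiable at z" unfolding field_differentiable_def by (rule exI)
  then show "laplace k field_differentiable at z within {z. 0 < Re z}"
    by (rule field_differentiable_at_within)
qed

text \<open>The coefficient bound says that the sum is an even entire function of exponential type
  \<open>\<beta>\<close>, dominated by \<open>A * cosh (\<beta> * r)\<close>.\<close>

locale even_series =
  fixes a :: "nat \<Rightarrow> real" and A \<beta> :: real
  assumes coeff: "\<And>j. \<bar>a j\<bar> \<le> A * \<beta> ^ (2 * j) / fact (2 * j)" and beta: "0 < \<beta>"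
begin

definition f :: "real \<Rightarrow> real" where "f r = (\<Sum>j. a j * r ^ (2 * j))"

text \<open>Termwise Laplace transform of \<open>r * f r\<close>, the function whose sine transform occurs in the
  radial Fourier integral.\<close>

definition borel_transform :: "complex \<Rightarrow> complex" where
  "borel_transform z = (\<Sum>j. of_real (fact (2 * j + 1) * a j) / z ^ (2 * j + 2))"

lemma A_nonneg: "0 \<le> A" using coeff[of 0] by auto

lemma term_bound: "\<bar>a j * r ^ (2 * j)\<bar> \<le> A * (\<bar>\<beta> * r\<bar> ^ (2 * j) / fact (2 * j))"
proof -
  have "\<bar>a j * r ^ (2 * j)\<bar> \<le> (A * \<beta> ^ (2 * j) / fact (2 * j)) * \<bar>r\<bar> ^ (2 * j)"
    unfolding abs_mult power_abs by (intro mult_right_mono coeff) auto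
  also have "\<dots> = A * (\<bar>\<beta> * r\<bar> ^ (2 * j) / fact (2 * j))"
    using beta by (simp add: abs_mult power_mult_distrib)
  finally show ?thesis .
qed

lemma even_exp_summable: "summable (\<lambda>j. \<bar>x::real\<bar> ^ (2 * j) / fact (2 * j))"
  and even_exp_le: "(\<Sum>j. \<bar>x\<bar> ^ (2 * j) / fact (2 * j)) \<le> exp \<bar>x\<bar>"
proof -
  let ?e = "\<lambda>n. \<bar>x\<bar> ^ n / fact n"
  have s: "summable ?e" using summable_exp_generic[of "\<bar>x\<bar>"] by (simp add: divide_inverse mult.commute)
  show "summable (\<lambda>j. \<bar>x\<bar> ^ (2 * j) / fact (2 * j))"
    using summable_reindex[OF s, of "\<lambda>j. 2 * j"] by (simp add: o_def inj_def)
  have "(\<Sum>j. \<bar>x\<bar> ^ (2 * j) / fact (2 * j)) \<le> suminf ?e"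
    using suminf_reindex_mono[OF s, of "\<lambda>j. 2 * j"] by (simp add: o_def inj_def)
  also have "\<dots> = exp \<bar>x\<bar>" by (simp add: exp_def divide_inverse mult.commute)
  finally show "(\<Sum>j. \<bar>x\<bar> ^ (2 * j) / fact (2 * j)) \<le> exp \<bar>x\<bar>" .
qed

lemma f_abs_summable: "summable (\<lambda>j. \<bar>a j * r ^ (2 * j)\<bar>)"
  by (rule summable_comparison_test'[OF summable_mult[OF even_exp_summable, of A "\<beta> * r"]])
     (use term_bound in simp)

lemma f_summable: "summable (\<lambda>j. a j * r ^ (2 * j))"
  using summable_rabs_cancel[OF f_abs_summable] .

lemma f_bound: "(\<Sum>j. \<bar>a j * r ^ (2 * j)\<bar>) \<le> A * exp (\<bar>\<beta> * r\<bar>)"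
proof -
  have "(\<Sum>j. \<bar>a j * r ^ (2 * j)\<bar>) \<le> (\<Sum>j. A * (\<bar>\<beta> * r\<bar> ^ (2 * j) / fact (2 * j)))"
    by (rule suminf_le[OF term_bound f_abs_summable summable_mult[OF even_exp_summable]])
  also have "\<dots> = A * (\<Sum>j. \<bar>\<beta> * r\<bar> ^ (2 * j) / fact (2 * j))" by (rule suminf_mult[OF even_exp_summable])
  also have "\<dots> \<le> A * exp \<bar>\<beta> * r\<bar>" by (intro mult_left_mono even_exp_le A_nonneg)
  finally show ?thesis .
qed

text \<open>\<open>f r\<close> is an everywhere convergent power series in \<open>r\<^sup>2\<close>.\<close>

lemma f_continuous: "continuous_on UNIV f"
proof -
  have sm: "summable (\<lambda>j. a j * v ^ j)" for v :: real
  proof -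
    have "summable (\<lambda>j. \<bar>a j * (sqrt \<bar>v\<bar>) ^ (2 * j)\<bar>)" by (rule f_abs_summable)
    then have "summable (\<lambda>j. \<bar>a j * v ^ j\<bar>)" by (simp add: power_mult abs_mult power_abs)
    then show ?thesis by (rule summable_rabs_cancel)
  qed
  have "isCont (\<lambda>v. \<Sum>j. a j * v ^ j) v" for v by (rule isCont_powser_converges_everywhere[OF sm])
  then have c: "continuous_on UNIV (\<lambda>v. \<Sum>j. a j * v ^ j)" by (simp add: continuous_at_imp_continuous_on)
  have "continuous_on UNIV (\<lambda>r::real. \<Sum>j. a j * (r\<^sup>2) ^ j)"
    by (rule continuous_on_compose2[OF c]) (auto intro!: continuous_intros)
  then show ?thesis by (simp add: f_def[abs_def] power_mult)
qed

text \<open>The quotient of the factorials in \<open>(2 * j + 1)! * \<bar>a j\<bar>\<close> leaves the factor \<open>2 * j + 1\<close>, so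
  that the Borel transform is dominated by the derivative of a geometric series.\<close>

lemma borel_term_bound:
  assumes "\<beta> < x"
  shows "fact (2 * j + 1) * \<bar>a j\<bar> / x ^ (2 * j + 2) \<le> (2 * A / x\<^sup>2) * (real (Suc j) * ((\<beta> / x)\<^sup>2) ^ j)"
proof -
  have x: "0 < x" using assms beta by simp
  have "fact (2 * j + 1) * \<bar>a j\<bar> / x ^ (2 * j + 2) \<le> fact (2 * j + 1) * (A * \<beta> ^ (2 * j) / fact (2 * j)) / x ^ (2 * j + 2)"
    using x by (intro divide_right_mono mult_left_mono coeff) auto
  also have "\<dots> = real (2 * j + 1) * (A / x\<^sup>2 * ((\<beta> / x)\<^sup>2) ^ j)"
  proof -
    have p: "((\<beta> / x)\<^sup>2) ^ j = \<beta> ^ (2 * j) / x ^ (2 * j)" by (simp add: power_mult[symmetric] power_divide)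
    have q: "x ^ (2 * j + 2) = x ^ (2 * j) * x\<^sup>2" by (simp add: power_add power2_eq_square)
    have f: "(fact (2 * j + 1) :: real) = real (2 * j + 1) * fact (2 * j)" by simp
    have alg: "n * F * (A * b / F) / (X * Y) = n * (A / Y * (b / X))" if "F \<noteq> 0" for n F b X Y :: real
      using that by simp
    show ?thesis unfolding p q f by (rule alg) simp
  qed
  also have "\<dots> \<le> real (2 * Suc j) * (A / x\<^sup>2 * ((\<beta> / x)\<^sup>2) ^ j)"
    using x A_nonneg by (intro mult_right_mono) auto
  also have "\<dots> = (2 * A / x\<^sup>2) * (real (Suc j) * ((\<beta> / x)\<^sup>2) ^ j)"
    unfolding of_nat_mult by (simp only: of_nat_numeral times_divide_eq_left times_divide_eq_right mult_ac)
  finally show ?thesis .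
qed

lemma borel_summable:
  assumes "\<beta> < x"
  shows "summable (\<lambda>j. fact (2 * j + 1) * \<bar>a j\<bar> / x ^ (2 * j + 2))"
proof (rule summable_comparison_test')
  have x: "0 < x" using assms beta by simp
  have "norm ((\<beta> / x)\<^sup>2) < 1" using assms beta by (simp add: power_divide divide_less_eq power_strict_mono)
  from sums_summable[OF geometric_deriv_sums[OF this]]
  show "summable (\<lambda>j. (2 * A / x\<^sup>2) * (real (Suc j) * ((\<beta> / x)\<^sup>2) ^ j))" by (intro summable_mult) simp
  show "norm (fact (2 * j + 1) * \<bar>a j\<bar> / x ^ (2 * j + 2)) \<le> (2 * A / x\<^sup>2) * (real (Suc j) * ((\<beta> / x)\<^sup>2) ^ j)" for j
    using borel_term_bound[OF assms, of j] x by simp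
qed

lemma borel_transform_norm:
  assumes "\<beta> < x" "x \<le> norm z"
  shows "norm (borel_transform z) \<le> (\<Sum>j. fact (2 * j + 1) * \<bar>a j\<bar> / x ^ (2 * j + 2))"
    and "summable (\<lambda>j. norm (of_real (fact (2 * j + 1) * a j) / z ^ (2 * j + 2)))"
proof -
  have x: "0 < x" using assms beta by simp
  have le: "norm (of_real (fact (2 * j + 1) * a j) / z ^ (2 * j + 2)) \<le> fact (2 * j + 1) * \<bar>a j\<bar> / x ^ (2 * j + 2)" for j
    unfolding norm_divide norm_power norm_of_real abs_mult using assms x
    by (intro frac_le power_mono) auto
  show s: "summable (\<lambda>j. norm (of_real (fact (2 * j + 1) * a j) / z ^ (2 * j + 2)))"
    by (rule summable_comparison_test'[OF borel_summable[OF assms(1)]]) (use le in simp)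
  show "norm (borel_transform z) \<le> (\<Sum>j. fact (2 * j + 1) * \<bar>a j\<bar> / x ^ (2 * j + 2))"
    unfolding borel_transform_def
    by (rule order_trans[OF summable_norm[OF s] suminf_le[OF le s borel_summable[OF assms(1)]]])
qed

text \<open>Up to the factor \<open>1 / z\<^sup>2\<close> the Borel transform is a power series in \<open>v = 1 / z\<^sup>2\<close>,
  convergent for \<open>\<bar>v\<bar> < 1 / \<beta>\<^sup>2\<close>.\<close>

lemma borel_transform_holomorphic: "borel_transform holomorphic_on {z. \<beta> < norm z}"
proof -
  define g where "g v = (\<Sum>j. of_real (fact (2 * j + 1) * a j) * (v::complex) ^ j)" for v
  have inv: "norm (inverse (z\<^sup>2)) < 1 / \<beta>\<^sup>2" if "\<beta> < norm z" for z :: complex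
  proof -
    have "\<beta>\<^sup>2 < (norm z)\<^sup>2" using that beta by (intro power_strict_mono) auto
    then have "inverse ((norm z)\<^sup>2) < inverse (\<beta>\<^sup>2)" using beta by (intro less_imp_inverse_less) auto
    then show ?thesis by (simp add: norm_inverse norm_power divide_inverse)
  qed
  have "g holomorphic_on ball 0 (1 / \<beta>\<^sup>2)"
  proof (rule power_series_holomorphic)
    fix v :: complex assume v: "v \<in> ball 0 (1 / \<beta>\<^sup>2)"
    show "(\<lambda>j. of_real (fact (2 * j + 1) * a j) * (v - 0) ^ j) sums g v"
    proof (cases "v = 0")
      case True
      then show ?thesis by (simp add: g_def powser_sums_zero powser_zero)
    next
      case False
      define z where "z = csqrt (inverse v)"
      have z2: "z\<^sup>2 = inverse v" by (simp add: z_def)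
      have "\<beta>\<^sup>2 < inverse (norm v)" using v False beta by (simp add: field_simps)
      also have "inverse (norm v) = (norm z)\<^sup>2" using z2 by (metis norm_inverse norm_power)
      finally have bz: "\<beta> < norm z" using beta by (simp add: power_less_imp_less_base)
      obtain x where x: "\<beta> < x" "x < norm z" using dense[OF bz] by blast
      have zn: "z \<noteq> 0" using bz beta by auto
      have "summable (\<lambda>j. of_real (fact (2 * j + 1) * a j) / z ^ (2 * j + 2))"
        using summable_norm_cancel[OF borel_transform_norm(2)[OF x(1) less_imp_le[OF x(2)]]] .
      then have "summable (\<lambda>j. z\<^sup>2 * (of_real (fact (2 * j + 1) * a j) / z ^ (2 * j + 2)))" by (rule summable_mult)
      moreover have "z\<^sup>2 * (of_real (fact (2 * j + 1) * a j) / z ^ (2 * j + 2)) = of_real (fact (2 * j + 1) * a j) * v ^ j" for j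
      proof -
        have "v ^ j = 1 / z ^ (2 * j)" using z2 zn by (metis inverse_inverse_eq power_inverse power_mult inverse_eq_divide)
        moreover have "z ^ (2 * j + 2) = z ^ (2 * j) * z\<^sup>2" by (simp add: power_add power2_eq_square)
        moreover have "Y * (F / (X * Y)) = F * (1 / X)" if "Y \<noteq> 0" for X Y F :: complex using that by simp
        ultimately show ?thesis using zn by (simp only: power_eq_0_iff not_False_eq_True simp_thms)
      qed
      ultimately show ?thesis by (simp add: g_def summable_sums)
    qed
  qed
  moreover have "(\<lambda>z. inverse (z\<^sup>2)) holomorphic_on {z. \<beta> < norm z}"
    using beta by (intro holomorphic_intros) auto
  moreover have "(\<lambda>z. inverse (z\<^sup>2)) ` {z. \<beta> < norm z} \<subseteq> ball (0::complex) (1 / \<beta>\<^sup>2)" using inv by auto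
  ultimately have "(\<lambda>z. inverse (z\<^sup>2) * g (inverse (z\<^sup>2))) holomorphic_on {z. \<beta> < norm z}"
    using holomorphic_on_compose_gen[of "\<lambda>z. inverse (z\<^sup>2)" "{z. \<beta> < norm z}" g "ball 0 (1 / \<beta>\<^sup>2)"]
    by (intro holomorphic_on_mult) (auto simp: o_def)
  then show ?thesis
  proof (rule holomorphic_transform)
    fix z :: complex assume z: "z \<in> {z. \<beta> < norm z}"
    then have zn: "z \<noteq> 0" using beta by auto
    obtain x where x: "\<beta> < x" "x < norm z" using dense[of \<beta> "norm z"] z by auto
    have s: "summable (\<lambda>j. of_real (fact (2 * j + 1) * a j) / z ^ (2 * j + 2))"
      using summable_norm_cancel[OF borel_transform_norm(2)[OF x(1) less_imp_le[OF x(2)]]] .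
    have eq: "of_real (fact (2 * j + 1) * a j) * inverse (z\<^sup>2) ^ j = z\<^sup>2 * (of_real (fact (2 * j + 1) * a j) / z ^ (2 * j + 2))" for j
    proof -
      have "inverse (z\<^sup>2) ^ j = 1 / z ^ (2 * j)" by (simp only: power_inverse power_mult inverse_eq_divide[of "(z\<^sup>2) ^ j"])
      moreover have "z ^ (2 * j + 2) = z ^ (2 * j) * z\<^sup>2" by (simp add: power_add power2_eq_square)
      moreover have "Y * (F / (X * Y)) = F * (1 / X)" if "Y \<noteq> 0" for X Y F :: complex using that by simp
      ultimately show ?thesis using zn by (simp only: power_eq_0_iff not_False_eq_True simp_thms)
    qed
    show "inverse (z\<^sup>2) * g (inverse (z\<^sup>2)) = borel_transform z"
      unfolding g_def eq borel_transform_def using zn by (subst suminf_mult[OF s]) simp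
  qed
qed

lemma times_f_measurable: "(\<lambda>r. r * f r) \<in> borel_measurable borel"
  by (intro borel_measurable_continuous_onI continuous_intros f_continuous)

lemma laplace_eq_borel_real:
  assumes x: "\<beta> < x"
  shows "laplace (\<lambda>r. r * f r) (of_real x) = borel_transform (of_real x)"
proof -
  have x0: "0 < x" using x beta by simp
  let ?g = "\<lambda>j r. a j * (indicator {0..} r * (r ^ (2 * j + 1) * exp (- x * r)))"
  note em = exp_moment[OF x0]
  have gi: "integrable lborel (?g j)" for j
    using em[of "2 * j + 1"] unfolding has_bochner_integral_iff by (intro integrable_mult_right) blast
  have ge: "(LINT r|lborel. ?g j r) = a j * (fact (2 * j + 1) / x ^ (2 * j + 2))" for j
    using em[of "2 * j + 1"] unfolding has_bochner_integral_iff integral_mult_right_zero by simp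
  have gn: "(LINT r|lborel. norm (?g j r)) = fact (2 * j + 1) * \<bar>a j\<bar> / x ^ (2 * j + 2)" for j
  proof -
    have "(LINT r|lborel. norm (?g j r)) = (LINT r|lborel. \<bar>a j\<bar> * (indicator {0..} r * (r ^ (2 * j + 1) * exp (- x * r))))"
      by (intro Bochner_Integration.integral_cong) (auto simp: indicator_def abs_mult)
    also have "\<dots> = \<bar>a j\<bar> * (fact (2 * j + 1) / x ^ (2 * j + 2))"
      using em[of "2 * j + 1"] unfolding has_bochner_integral_iff integral_mult_right_zero by simp
    finally show ?thesis by (simp add: mult_ac)
  qed
  have gs: "(\<Sum>j. ?g j r) = indicator {0..} r * (r * f r * exp (- x * r))"
    and ga: "summable (\<lambda>j. norm (?g j r))" for r
  proof -
    let ?c = "indicator {0..} r * (r * exp (- x * r)) :: real"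
    have eq: "?g j r = ?c * (a j * r ^ (2 * j))" for j by simp
    show "(\<Sum>j. ?g j r) = indicator {0..} r * (r * f r * exp (- x * r))"
      unfolding eq by (subst suminf_mult[OF f_summable]) (simp add: f_def)
    show "summable (\<lambda>j. norm (?g j r))"
      unfolding eq norm_mult[of ?c] real_norm_def[of "a _ * _"] by (rule summable_mult[OF f_abs_summable])
  qed
  have sn: "summable (\<lambda>j. LINT r|lborel. norm (?g j r))" unfolding gn by (rule borel_summable[OF x])
  have "(LINT r|lborel. indicator {0..} r * (r * f r * exp (- x * r))) = (\<Sum>j. a j * (fact (2 * j + 1) / x ^ (2 * j + 2)))"
    using integral_suminf[OF gi _ sn] ga unfolding gs ge by simp
  also have "\<dots> = (\<Sum>j. fact (2 * j + 1) * a j / x ^ (2 * j + 2))" by (simp only: times_divide_eq_right mult.commute)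
  finally have r: "(LINT r|lborel. indicator {0..} r * (r * f r * exp (- x * r))) = \<dots>" .
  have "laplace (\<lambda>r. r * f r) (of_real x) = (LINT r|lborel. complex_of_real (indicator {0..} r * (r * f r * exp (- x * r))))"
    unfolding laplace_def
    by (intro Bochner_Integration.integral_cong) (auto simp: scaleR_conv_of_real exp_of_real[symmetric])
  also have "\<dots> = complex_of_real (\<Sum>j. fact (2 * j + 1) * a j / x ^ (2 * j + 2))"
    by (simp only: integral_complex_of_real r)
  also have "\<dots> = (\<Sum>j. complex_of_real (fact (2 * j + 1) * a j / x ^ (2 * j + 2)))"
  proof (rule suminf_of_real)
    have "summable (\<lambda>j. \<bar>fact (2 * j + 1) * a j / x ^ (2 * j + 2)\<bar>)"
      using borel_summable[OF x] x0 by (simp add: abs_mult)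
    then show "summable (\<lambda>j. fact (2 * j + 1) * a j / x ^ (2 * j + 2))" by (rule summable_rabs_cancel)
  qed
  finally show ?thesis by (simp add: borel_transform_def)
qed

text \<open>Both sides are holomorphic in the open right half plane outside the disc of radius \<open>\<beta>\<close> and
  agree on a real half line; polynomial growth is what makes the Laplace transform exist on the
  whole half plane rather than for \<open>Re z > \<beta>\<close> only.\<close>

lemma laplace_eq_borel:
  assumes bd: "\<And>r. 0 \<le> r \<Longrightarrow> \<bar>f r\<bar> \<le> C * (1 + r) ^ n" and z: "0 < Re z" "\<beta> < norm z"
  shows "laplace (\<lambda>r. r * f r) z = borel_transform z"
proof -
  have C0: "0 \<le> C" using bd[of 0] by auto
  have bd1: "\<bar>r * f r\<bar> \<le> C * (1 + r) ^ Suc n" if "0 \<le> r" for r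
  proof -
    have "\<bar>r * f r\<bar> = r * \<bar>f r\<bar>" using that by (simp add: abs_mult)
    also have "\<dots> \<le> (1 + r) * (C * (1 + r) ^ n)" using bd[OF that] that by (intro mult_mono) auto
    finally show ?thesis by (simp add: mult_ac)
  qed
  define U where "U = {z::complex. 0 < Re z \<and> \<beta> < norm z}"
  have U: "U = {z. 0 < Re z} \<inter> {z. \<beta> < norm z}" by (auto simp: U_def)
  have open_U: "open U" unfolding U
    by (intro open_Int open_halfspace_Re_gt open_Collect_less continuous_intros)
  \<comment> \<open>In logarithmic coordinates the region is a half strip, which is convex.\<close>
  have conn: "connected U"
  proof -
    let ?S = "{u::complex. ln \<beta> < Re u} \<inter> {u. Im u < pi / 2} \<inter> {u. - (pi / 2) < Im u}"
    have "convex ?S" by (intro convex_Int convex_halfspace_Re_gt convex_halfspace_Im_lt convex_halfspace_Im_gt)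
    then have "connected (exp ` ?S)"
      by (intro connected_continuous_image convex_connected continuous_intros)
    moreover have "exp ` ?S = U"
    proof (intro equalityI subsetI)
      fix w assume "w \<in> exp ` ?S"
      then obtain u where u: "u \<in> ?S" "w = exp u" by auto
      have "exp (ln \<beta>) < exp (Re u)" using u(1) by simp
      then have "\<beta> < exp (Re u)" using beta by simp
      moreover have "0 < cos (Im u)" using u(1) by (intro cos_gt_zero_pi) auto
      ultimately show "w \<in> U" using u(2) by (simp add: U_def Re_exp)
    next
      fix w assume w: "w \<in> U"
      then have w0: "w \<noteq> 0" by (auto simp: U_def)
      have "ln \<beta> < ln (norm w)" using w w0 beta by (subst ln_less_cancel_iff) (auto simp: U_def)
      moreover have "\<bar>Im (Ln w)\<bar> < pi / 2" using Re_Ln_pos_lt[OF w0] w by (simp add: U_def)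
      ultimately have "Ln w \<in> ?S" using w0 by (auto simp: abs_less_iff)
      then show "w \<in> exp ` ?S" using exp_Ln[OF w0] by (metis imageI)
    qed
    ultimately show ?thesis by simp
  qed
  let ?d = "\<lambda>z. laplace (\<lambda>r. r * f r) z - borel_transform z"
  have hol: "?d holomorphic_on U"
  proof (intro holomorphic_intros)
    show "laplace (\<lambda>r. r * f r) holomorphic_on U"
      by (rule holomorphic_on_subset[OF laplace_holomorphic[OF times_f_measurable bd1]]) (auto simp: U)
    show "borel_transform holomorphic_on U"
      by (rule holomorphic_on_subset[OF borel_transform_holomorphic]) (auto simp: U)
  qed
  have "?d z = 0"
  proof (rule analytic_continuation[OF hol open_U conn])
    let ?V = "complex_of_real ` {\<beta><..}"
    show "?V \<subseteq> U" using beta by (auto simp: U_def)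
    show "complex_of_real (\<beta> + 1) \<in> U" using beta by (auto simp: U_def)
    show "complex_of_real (\<beta> + 1) islimpt ?V"
      unfolding islimpt_approachable
    proof (intro allI impI)
      fix e :: real assume "0 < e"
      then show "\<exists>x'\<in>?V. x' \<noteq> complex_of_real (\<beta> + 1) \<and> dist x' (complex_of_real (\<beta> + 1)) < e"
        by (intro bexI[of _ "complex_of_real (\<beta> + 1 + e / 2)"]) (auto simp: dist_of_real dist_real_def intro!: imageI simp del: of_real_add)
    qed
    show "?d w = 0" if "w \<in> ?V" for w using that laplace_eq_borel_real by auto
    show "z \<in> U" using z by (simp add: U_def)
  qed
  then show ?thesis by simp
qed

text \<open>Even powers of \<open>- \<i> * s\<close> are real, and so are the coefficients.\<close>

lemma borel_transform_imaginary:
  assumes s: "\<beta> < s"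
  shows "Im (borel_transform (- \<i> * of_real s)) = 0"
proof -
  have s0: "0 < s" using s beta by simp
  have p: "(- \<i> * complex_of_real s) ^ (2 * j + 2) = complex_of_real ((- (s\<^sup>2)) ^ (j + 1))" for j
  proof -
    have "(- \<i> * complex_of_real s) ^ (2 * (j + 1)) = ((- \<i> * complex_of_real s)\<^sup>2) ^ (j + 1)" by (rule power_mult)
    also have "(- \<i> * complex_of_real s)\<^sup>2 = complex_of_real (- (s\<^sup>2))" by (simp add: power_mult_distrib)
    finally have "(- \<i> * complex_of_real s) ^ (2 * (j + 1)) = complex_of_real (- (s\<^sup>2)) ^ (j + 1)" .
    moreover have "2 * j + 2 = 2 * (j + 1)" by simp
    ultimately show ?thesis by (simp only: of_real_power)
  qed
  have "borel_transform (- \<i> * of_real s) = (\<Sum>j. complex_of_real (fact (2 * j + 1) * a j / (- (s\<^sup>2)) ^ (j + 1)))"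
    unfolding borel_transform_def p by (simp only: of_real_divide)
  also have "\<dots> = complex_of_real (\<Sum>j. fact (2 * j + 1) * a j / (- (s\<^sup>2)) ^ (j + 1))"
  proof (rule suminf_of_real[symmetric])
    have "\<bar>fact (2 * j + 1) * a j / (- (s\<^sup>2)) ^ (j + 1)\<bar> = fact (2 * j + 1) * \<bar>a j\<bar> / s ^ (2 * j + 2)" for j
    proof -
      have "\<bar>(- (s\<^sup>2)) ^ (j + 1)\<bar> = s ^ (2 * (j + 1))"
        by (simp only: power_abs abs_minus_cancel power2_abs power_mult)
      then show ?thesis unfolding abs_divide abs_mult by simp
    qed
    then have "summable (\<lambda>j. \<bar>fact (2 * j + 1) * a j / (- (s\<^sup>2)) ^ (j + 1)\<bar>)" using borel_summable[OF s] by simp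
    then show "summable (\<lambda>j. fact (2 * j + 1) * a j / (- (s\<^sup>2)) ^ (j + 1))" by (rule summable_rabs_cancel)
  qed
  finally show ?thesis by simp
qed

text \<open>The sine is the imaginary part of the exponential in the Laplace integral at \<open>e - \<i> * s\<close>.\<close>

lemma sine_transform:
  assumes bd: "\<And>r. 0 \<le> r \<Longrightarrow> \<bar>f r\<bar> \<le> C * (1 + r) ^ n" and e: "0 < e" and s: "\<beta> < s"
  shows "(LINT r|lborel. indicator {0..} r * (f r * exp (- e * r) * r * sin (s * r))) =
    Im (borel_transform (of_real e - \<i> * of_real s))"
proof -
  let ?z = "complex_of_real e - \<i> * of_real s"
  have "s \<le> norm ?z" using abs_Im_le_cmod[of ?z] by simp
  then have z: "0 < Re ?z" "\<beta> < norm ?z" using e s by auto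
  have C0: "0 \<le> C" using bd[of 0] by auto
  have bd1: "\<bar>r * f r\<bar> \<le> C * (1 + r) ^ Suc n" if "0 \<le> r" for r
  proof -
    have "\<bar>r * f r\<bar> = r * \<bar>f r\<bar>" using that by (simp add: abs_mult)
    also have "\<dots> \<le> (1 + r) * (C * (1 + r) ^ n)" using bd[OF that] that by (intro mult_mono) auto
    finally show ?thesis by (simp add: mult_ac)
  qed
  have "Im (laplace (\<lambda>r. r * f r) ?z) = (LINT r|lborel. Im (indicator {0..} r *\<^sub>R (of_real (r * f r) * exp (- ?z * of_real r))))"
    unfolding laplace_def by (rule integral_Im[symmetric], rule laplace_integrable[OF times_f_measurable bd1 z(1)])
  also have "\<dots> = (LINT r|lborel. indicator {0..} r * (f r * exp (- e * r) * r * sin (s * r)))"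
    by (intro Bochner_Integration.integral_cong) (auto simp: Im_exp algebra_simps)
  finally show ?thesis using laplace_eq_borel[OF bd z] by simp
qed

text \<open>The factor \<open>exp (- e m * \<bar>\<xi>\<bar>)\<close> makes \<open>f \<bar>\<xi>\<bar>\<close> integrable, so that Fubini's theorem moves
  the Fourier transform to the other factor. There it is \<open>4 * pi / norm x\<close> times the imaginary
  part of the Borel transform at \<open>e m - \<i> * norm x\<close>, which is bounded for \<open>norm x \<ge> \<kappa>\<close> and tends
  to \<open>0\<close> as \<open>e m\<close> does.\<close>

lemma paley_wiener_radial:
  assumes bd: "\<And>r. 0 \<le> r \<Longrightarrow> \<bar>f r\<bar> \<le> C * (1 + r) ^ n"
    and phi: "schwartz \<phi>" and supp: "\<And>x. norm x < \<kappa> \<Longrightarrow> \<phi> x = 0" and kappa: "\<beta> < \<kappa>"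
  shows "(LINT \<xi>|lborel. of_real (f (norm \<xi>)) * inverse_fourier \<phi> \<xi>) = 0"
proof -
  have C0: "0 \<le> C" using bd[of 0] by auto
  have k0: "0 < \<kappa>" using kappa beta by simp
  note fm = borel_measurable_continuous_onI[OF f_continuous]
  have [measurable]: "f \<in> borel_measurable borel" by (rule fm)
  note IFs = schwartz_opD[OF schwartz_op_inverse_fourier phi]
  have [measurable]: "inverse_fourier \<phi> \<in> borel_measurable borel" "\<phi> \<in> borel_measurable borel"
    by (intro schwartz_measurable IFs phi)+
  define e where "e m = 1 / real (Suc m)" for m
  have e: "0 < e m" for m by (simp add: e_def)
  have e0: "e \<longlonglongrightarrow> 0" unfolding e_def[abs_def] by (rule LIMSEQ_Suc[OF lim_1_over_n])
  define k where "k m r = f r * exp (- e m * \<bar>r\<bar>)" for m r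
  have km[measurable]: "k m \<in> borel_measurable borel" for m unfolding k_def[abs_def] by measurable
  have ki: "integrable lborel (\<lambda>\<xi>::real^3. k m (norm \<xi>))" for m
  proof -
    obtain B where B: "\<And>r. 0 \<le> r \<Longrightarrow> (1 + r) ^ (n + 4) * exp (- e m * r) \<le> B"
    proof -
      have "((\<lambda>r::real. (1 + r) ^ (n + 4) * exp (- e m * r)) \<longlongrightarrow> 0) at_top"
      proof -
        have "((\<lambda>r::real. \<Sum>i\<le>n+4. of_nat ((n+4) choose i) * (r ^ i * exp (- e m * r))) \<longlongrightarrow> (\<Sum>i\<le>n+4. of_nat ((n+4) choose i) * 0)) at_top"
        proof (intro tendsto_intros)
          fix i
          have "((\<lambda>r. (1 / e m) ^ i * ((e m * r) ^ i / exp (e m * r))) \<longlongrightarrow> (1 / e m) ^ i * 0) at_top"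
            by (intro tendsto_intros filterlim_compose[OF tendsto_power_div_exp_0]
               filterlim_tendsto_pos_mult_at_top[OF tendsto_const e filterlim_ident])
          then show "((\<lambda>r. r ^ i * exp (- e m * r)) \<longlongrightarrow> 0) at_top"
          proof (rule Lim_transform_eventually[OF _ always_eventually, rule_format, THEN tendsto_eq_rhs])
            fix r
            have "(1 / e m) ^ i * (e m * r) ^ i = r ^ i" using e[of m] by (simp flip: power_mult_distrib)
            then show "(1 / e m) ^ i * ((e m * r) ^ i / exp (e m * r)) = r ^ i * exp (- e m * r)"
              by (simp add: exp_minus divide_inverse mult.assoc[symmetric])
          qed simp
        qed
        moreover have "(\<Sum>i\<le>n+4. of_nat ((n+4) choose i) * (r ^ i * exp (- e m * r))) = (1 + r) ^ (n + 4) * exp (- e m * r)" for r :: real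
          using binomial_ring[of r 1 "n + 4"] by (simp add: add.commute sum_distrib_right mult.assoc)
        ultimately show ?thesis by simp
      qed
      then have "\<forall>\<^sub>F r in at_top. (1 + r) ^ (n + 4) * exp (- e m * r) < 1" by (rule order_tendstoD) simp
      then obtain R where R: "\<And>r. R \<le> r \<Longrightarrow> (1 + r) ^ (n + 4) * exp (- e m * r) < 1" by (auto simp: eventually_at_top_linorder)
      have "(1 + r) ^ (n + 4) * exp (- e m * r) \<le> max 1 ((1 + \<bar>R\<bar>) ^ (n + 4))" if "0 \<le> r" for r
      proof (cases "R \<le> r")
        case True then show ?thesis using R[of r] by linarith
      next
        case False
        then have "(1 + r) ^ (n + 4) * exp (- e m * r) \<le> (1 + \<bar>R\<bar>) ^ (n + 4) * 1"
          using that e[of m] by (intro mult_mono power_mono) auto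
        then show ?thesis by linarith
      qed
      then show ?thesis using that by blast
    qed
    show ?thesis
    proof (rule Bochner_Integration.integrable_bound[OF integrable_mult_right[OF integrable_inverse_power, of "C * B"]])
      show "AE x in lborel. norm (k m (norm x)) \<le> norm (C * B * (1 / (1 + norm (x::real^3)) ^ 4))"
      proof (rule AE_I2)
        fix x :: "real^3"
        let ?r = "norm x"
        have "\<bar>k m ?r\<bar> \<le> C * (1 + ?r) ^ n * exp (- e m * ?r)"
          unfolding k_def abs_mult using bd[of ?r] by (intro mult_mono) auto
        also have "\<dots> = C * ((1 + ?r) ^ (n + 4) * exp (- e m * ?r)) * (1 / (1 + ?r) ^ 4)"
        proof -
          have "(1 + ?r) ^ 4 \<noteq> 0" by (simp add: add_nonneg_eq_0_iff)
          then show ?thesis unfolding power_add by (simp del: power_eq_0_iff)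
        qed
        also have "\<dots> \<le> C * B * (1 / (1 + ?r) ^ 4)"
          using B[of ?r] C0 by (intro mult_right_mono mult_left_mono) auto
        finally show "norm (k m ?r) \<le> norm (C * B * (1 / (1 + ?r) ^ 4))"
          unfolding real_norm_def by (rule order_trans[OF _ abs_ge_self])
      qed
    qed measurable
  qed
  let ?I = "\<lambda>m. LINT \<xi>|lborel. of_real (k m (norm \<xi>)) * inverse_fourier \<phi> \<xi>"
  have lim1: "?I \<longlonglongrightarrow> (LINT \<xi>|lborel. of_real (f (norm \<xi>)) * inverse_fourier \<phi> \<xi>)"
  proof (rule integral_dominated_convergence)
    let ?S = "schwartz_norm (n + 4) (inverse_fourier \<phi>)"
    show "integrable lborel (\<lambda>\<xi>::real^3. C * ?S * (1 / (1 + norm \<xi>) ^ 4))"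
      by (intro integrable_mult_right integrable_inverse_power)
    show "AE \<xi> in lborel. (\<lambda>m. of_real (k m (norm \<xi>)) * inverse_fourier \<phi> \<xi>) \<longlonglongrightarrow> of_real (f (norm \<xi>)) * inverse_fourier \<phi> \<xi>"
    proof (rule AE_I2)
      fix \<xi> :: "real^3"
      have "(\<lambda>m. f (norm \<xi>) * exp (- e m * \<bar>norm \<xi>\<bar>)) \<longlonglongrightarrow> f (norm \<xi>) * exp (- 0 * \<bar>norm \<xi>\<bar>)"
        by (intro tendsto_intros e0)
      then show "(\<lambda>m. of_real (k m (norm \<xi>)) * inverse_fourier \<phi> \<xi>) \<longlonglongrightarrow> of_real (f (norm \<xi>)) * inverse_fourier \<phi> \<xi>"
        unfolding k_def by (intro tendsto_mult tendsto_of_real tendsto_const) simp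
    qed
    show "AE \<xi> in lborel. norm (of_real (k m (norm \<xi>)) * inverse_fourier \<phi> \<xi>) \<le> C * ?S * (1 / (1 + norm \<xi>) ^ 4)" for m
    proof (rule AE_I2)
      fix \<xi> :: "real^3"
      let ?r = "norm \<xi>"
      have "\<bar>k m ?r\<bar> \<le> (C * (1 + ?r) ^ n) * 1"
        unfolding k_def abs_mult using bd[of ?r] e[of m] C0 by (intro mult_mono) auto
      then have "norm (of_real (k m ?r) * inverse_fourier \<phi> \<xi>) \<le> C * (1 + ?r) ^ n * (?S / (1 + ?r) ^ (n + 4))"
        unfolding norm_mult norm_of_real using schwartz_bound(1)[OF IFs, of \<xi> "n + 4"] C0 by (intro mult_mono) auto
      also have "\<dots> = C * ?S * (1 / (1 + ?r) ^ 4)"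
      proof -
        have "(1 + ?r) ^ n \<noteq> 0" by (simp add: add_nonneg_eq_0_iff)
        then show ?thesis unfolding power_add by (simp del: power_eq_0_iff)
      qed
      finally show "norm (of_real (k m ?r) * inverse_fourier \<phi> \<xi>) \<le> C * ?S * (1 / (1 + ?r) ^ 4)" .
    qed
  qed measurable
  have inner: "(LINT \<xi>|lborel. complex_of_real (k m (norm \<xi>)) * cis (x \<bullet> \<xi>)) =
      of_real (4 * pi / norm x * Im (borel_transform (of_real (e m) - \<i> * of_real (norm x))))"
    if x: "\<kappa> \<le> norm x" for m and x :: "real^3"
  proof -
    have xn: "x \<noteq> 0" using x k0 by auto
    have "(LINT r|lborel. indicator {0..} r * (k m r * r * sin (norm x * r))) =
       (LINT r|lborel. indicator {0..} r * (f r * exp (- e m * r) * r * sin (norm x * r)))"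
      by (intro Bochner_Integration.integral_cong) (auto simp: k_def indicator_def)
    then show ?thesis
      unfolding radial_fourier[OF km ki xn] using sine_transform[OF bd e, of "norm x" m] x kappa by simp
  qed
  have Ieq: "?I m = fourier_const * (LINT x|lborel. \<phi> x * (LINT \<xi>|lborel. complex_of_real (k m (norm \<xi>)) * cis (x \<bullet> \<xi>)))" for m
  proof -
    let ?F = "\<lambda>\<xi> x. of_real (k m (norm \<xi>)) * (cis (\<xi> \<bullet> x) * \<phi> x)"
    have pint: "integrable (lborel \<Otimes>\<^sub>M lborel) (\<lambda>p::(real^3)\<times>(real^3). ?F (fst p) (snd p))"
    proof (rule Bochner_Integration.integrable_bound)
      show "integrable (lborel \<Otimes>\<^sub>M lborel) (\<lambda>p::(real^3)\<times>(real^3). of_real (k m (norm (fst p))) * \<phi> (snd p))"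
      proof (rule lborel_pair.Fubini_integrable)
        show "integrable lborel (\<lambda>\<xi>::real^3. LINT y|lborel. norm (of_real (k m (norm (fst (\<xi>, y)))) * \<phi> (snd (\<xi>, y))))"
          using integrable_mult_left[OF integrable_norm[OF ki[of m]], of "LINT y|lborel. norm (\<phi> y)"] by (simp add: norm_mult)
        show "AE \<xi> in lborel. integrable lborel (\<lambda>y. of_real (k m (norm (fst (\<xi>, y)))) * \<phi> (snd (\<xi>, y)))"
          using schwartz_integrable[OF phi] by simp
      qed measurable
      show "AE p in lborel \<Otimes>\<^sub>M lborel. norm (?F (fst p) (snd p)) \<le> norm (of_real (k m (norm (fst p))) * \<phi> (snd p))"
        by (simp add: norm_mult)
    qed measurable
    have "?I m = (LINT \<xi>|lborel. LINT x|lborel. fourier_const * ?F \<xi> x)"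
    proof (intro Bochner_Integration.integral_cong refl)
      fix \<xi> :: "real^3"
      have "(LINT x|lborel. fourier_const * ?F \<xi> x) = fourier_const * (of_real (k m (norm \<xi>)) * (LINT x|lborel. cis (\<xi> \<bullet> x) * \<phi> x))"
        by (simp only: integral_mult_right_zero)
      then show "of_real (k m (norm \<xi>)) * inverse_fourier \<phi> \<xi> = (LINT x|lborel. fourier_const * ?F \<xi> x)"
        by (simp add: inverse_fourier_lborel)
    qed
    also have "\<dots> = fourier_const * (LINT \<xi>|lborel. LINT x|lborel. ?F \<xi> x)" by (simp only: integral_mult_right_zero)
    also have "(LINT \<xi>|lborel. LINT x|lborel. ?F \<xi> x) = (LINT x|lborel. LINT \<xi>|lborel. ?F \<xi> x)"
      by (rule lborel_pair.Fubini_integral[symmetric]) (use pint in \<open>simp add: case_prod_unfold\<close>)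
    also have "\<dots> = (LINT x|lborel. \<phi> x * (LINT \<xi>|lborel. complex_of_real (k m (norm \<xi>)) * cis (x \<bullet> \<xi>)))"
    proof (intro Bochner_Integration.integral_cong refl)
      fix x :: "real^3"
      have "(\<lambda>\<xi>. ?F \<xi> x) = (\<lambda>\<xi>. \<phi> x * (complex_of_real (k m (norm \<xi>)) * cis (x \<bullet> \<xi>)))"
        by (simp add: fun_eq_iff inner_commute mult_ac)
      then show "(LINT \<xi>|lborel. ?F \<xi> x) = \<phi> x * (LINT \<xi>|lborel. complex_of_real (k m (norm \<xi>)) * cis (x \<bullet> \<xi>))"
        by (simp only: integral_mult_right_zero)
    qed
    finally show ?thesis .
  qed
  define J where "J m x = \<phi> x * of_real (4 * pi / norm x * Im (borel_transform (of_real (e m) - \<i> * of_real (norm x))))" for m x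
  have J: "\<phi> x * (LINT \<xi>|lborel. complex_of_real (k m (norm \<xi>)) * cis (x \<bullet> \<xi>)) = J m x" for m x
    using inner[of x m] supp[of x] by (cases "norm x < \<kappa>") (auto simp: J_def)
  have Jm: "J m \<in> borel_measurable borel" for m
  proof -
    have "(\<lambda>x. (LINT \<xi>|lborel. complex_of_real (k m (norm \<xi>)) * cis (x \<bullet> \<xi>))) \<in> borel_measurable (borel :: (real^3) measure)"
      by measurable
    then have "(\<lambda>x. \<phi> x * (LINT \<xi>|lborel. complex_of_real (k m (norm \<xi>)) * cis (x \<bullet> \<xi>))) \<in> borel_measurable borel"
      by measurable
    then show ?thesis unfolding J by simp
  qed
  have "(\<lambda>m. LINT x|lborel. J m x) \<longlonglongrightarrow> integral\<^sup>L lborel (\<lambda>x::real^3. 0)"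
  proof (rule integral_dominated_convergence)
    let ?B = "\<Sum>j. fact (2 * j + 1) * \<bar>a j\<bar> / \<kappa> ^ (2 * j + 2)"
    show "integrable lborel (\<lambda>x. norm (\<phi> x) * (4 * pi / \<kappa> * ?B))"
      by (intro integrable_mult_left integrable_norm schwartz_integrable phi)
    show "AE x in lborel. norm (J m x) \<le> norm (\<phi> x) * (4 * pi / \<kappa> * ?B)" for m
    proof (rule AE_I2)
      fix x
      show "norm (J m x) \<le> norm (\<phi> x) * (4 * pi / \<kappa> * ?B)"
      proof (cases "norm x < \<kappa>")
        case True then show ?thesis using supp[OF True] by (simp add: J_def)
      next
        case False
        let ?z = "complex_of_real (e m) - \<i> * of_real (norm x)"
        have "norm x \<le> norm ?z" using abs_Im_le_cmod[of ?z] by simp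
        then have "\<bar>Im (borel_transform ?z)\<bar> \<le> ?B"
          using False borel_transform_norm(1)[OF kappa, of ?z] abs_Im_le_cmod[of "borel_transform ?z"] by simp
        then have "4 * pi / norm x * \<bar>Im (borel_transform ?z)\<bar> \<le> 4 * pi / \<kappa> * ?B"
          using False k0 by (intro mult_mono frac_le) auto
        from mult_left_mono[OF this, of "norm (\<phi> x)"] show ?thesis
          by (simp add: J_def norm_mult abs_mult del: of_real_mult of_real_divide)
      qed
    qed
    show "AE x in lborel. (\<lambda>m. J m x) \<longlonglongrightarrow> 0"
    proof (rule AE_I2)
      fix x
      show "(\<lambda>m. J m x) \<longlonglongrightarrow> 0"
      proof (cases "norm x < \<kappa>")
        case True then show ?thesis using supp[OF True] by (simp add: J_def)
      next
        case False
        let ?z0 = "- \<i> * complex_of_real (norm x)"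
        have "open {z::complex. \<beta> < norm z}" by (intro open_Collect_less continuous_intros)
        moreover have "?z0 \<in> {z. \<beta> < norm z}" using False kappa by (simp add: norm_mult)
        ultimately have "isCont borel_transform ?z0"
          using borel_transform_holomorphic holomorphic_on_imp_continuous_on continuous_on_interior interior_open by metis
        moreover have "(\<lambda>m. complex_of_real (e m) - \<i> * of_real (norm x)) \<longlonglongrightarrow> complex_of_real 0 - \<i> * of_real (norm x)"
          by (intro tendsto_intros e0)
        ultimately have "(\<lambda>m. borel_transform (complex_of_real (e m) - \<i> * of_real (norm x))) \<longlonglongrightarrow> borel_transform ?z0"
          using isCont_tendsto_compose by fastforce
        then have "(\<lambda>m. Im (borel_transform (complex_of_real (e m) - \<i> * of_real (norm x)))) \<longlonglongrightarrow> Im (borel_transform ?z0)"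
          by (rule tendsto_Im)
        moreover have "Im (borel_transform ?z0) = 0" using borel_transform_imaginary[of "norm x"] False kappa by simp
        ultimately have "(\<lambda>m. Im (borel_transform (complex_of_real (e m) - \<i> * of_real (norm x)))) \<longlonglongrightarrow> 0" by simp
        then have "(\<lambda>m. J m x) \<longlonglongrightarrow> \<phi> x * of_real (4 * pi / norm x * 0)"
          unfolding J_def by (intro tendsto_mult tendsto_of_real tendsto_const)
        then show ?thesis by simp
      qed
    qed
  qed (use Jm in auto)
  then have "?I \<longlonglongrightarrow> fourier_const * 0" unfolding Ieq J by (intro tendsto_intros) simp
  then show ?thesis using lim1 LIMSEQ_unique by fastforce
qed

end

section \<open>Support of the inverse Fourier transform of an even series\<close>

text \<open>The function \<open>(\<bar>y\<bar>\<^sup>2 - 1) * (b\<^sup>2 - \<bar>y\<bar>\<^sup>2)\<close> is positive exactly in the open shell.\<close>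

lemma exists_shell_bump:
  fixes b :: real
  assumes b: "1 < b"
  obtains W :: "real^3 \<Rightarrow> real" where "smooth W" "\<And>y. 0 \<le> W y" "\<And>y. W y \<noteq> 0 \<Longrightarrow> 1 \<le> norm y \<and> norm y \<le> b"
    "(LINT y|lborel. W y) = 1"
proof -
  let ?q = "\<lambda>y::real^3. ((norm y)\<^sup>2 - 1) * (b\<^sup>2 - (norm y)\<^sup>2)"
  let ?W = "\<lambda>y. bump 1 (?q y)"
  have sm: "smooth ?W" by (intro smooth_bump smooth_mult smooth_diff smooth_const smooth_norm_sq)
  have supp: "1 < norm y \<and> norm y < b" if "?W y \<noteq> 0" for y
  proof -
    have q: "0 < ?q y" using that bump_zero[of "?q y" 1] by force
    have "norm y < b"
    proof (rule ccontr)
      assume "\<not> norm y < b"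
      then have "b\<^sup>2 \<le> (norm y)\<^sup>2" "1\<^sup>2 \<le> (norm y)\<^sup>2" using b by (auto intro!: power_mono)
      then have "?q y \<le> 0" by (intro mult_nonneg_nonpos) auto
      then show False using q by simp
    qed
    moreover have "1 < norm y"
    proof (rule ccontr)
      assume "\<not> 1 < norm y"
      then have "(norm y)\<^sup>2 \<le> 1\<^sup>2" "(norm y)\<^sup>2 \<le> b\<^sup>2" using b by (intro power_mono; simp)+
      then have "?q y \<le> 0" by (intro mult_nonpos_nonneg) auto
      then show False using q by simp
    qed
    ultimately show ?thesis by simp
  qed
  have c: "continuous_on UNIV ?W" by (rule smooth_continuous_on[OF sm])
  have int: "integrable lborel ?W"
  proof -
    have "integrable lborel (\<lambda>y. indicator (cball 0 b) y *\<^sub>R ?W y)"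
      by (rule borel_integrable_compact[OF compact_cball continuous_on_subset[OF c]]) simp
    moreover have "(\<lambda>y. indicator (cball 0 b) y *\<^sub>R ?W y) = ?W" using supp by (fastforce simp: indicator_def fun_eq_iff)
    ultimately show ?thesis by simp
  qed
  have pos: "0 < (LINT y|lborel. ?W y)"
  proof (rule ccontr)
    assume "\<not> 0 < (LINT y|lborel. ?W y)"
    moreover have "0 \<le> (LINT y|lborel. ?W y)" by (intro integral_nonneg_AE) (simp add: bump_nonneg)
    ultimately have "(LINT y|lborel. ?W y) = 0" by linarith
    then have "AE y in lborel. ?W y = 0"
      using integral_nonneg_eq_0_iff_AE[OF int] by (simp add: bump_nonneg)
    then have "AE y in lborel. y \<notin> ball 0 b - cball (0::real^3) 1"
    proof eventually_elim
      case (elim y)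
      show ?case
      proof
        assume y: "y \<in> ball 0 b - cball 0 1"
        then have "1\<^sup>2 < (norm y)\<^sup>2" "(norm y)\<^sup>2 < b\<^sup>2" by (intro power_strict_mono; simp)+
        then have "0 < ?q y" by (intro mult_pos_pos) auto
        then show False using elim bump_pos[of "?q y"] by simp
      qed
    qed
    then have "ball 0 b - cball (0::real^3) 1 \<in> null_sets lborel" by (subst (asm) AE_iff_null_sets[symmetric]) auto
    then have "negligible (ball 0 b - cball (0::real^3) 1)"
      unfolding negligible_iff_null_sets by (rule null_sets_completionI)
    moreover have "open (ball 0 b - cball (0::real^3) 1)" by (intro open_Diff) auto
    moreover have "((1 + b) / 2) *\<^sub>R axis 1 1 \<in> ball 0 b - cball (0::real^3) 1" using b by simp
    ultimately show False using open_not_negligible by blast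
  qed
  show ?thesis
  proof (rule that[of "\<lambda>y. (1 / (LINT y|lborel. ?W y)) * ?W y"])
    show "smooth (\<lambda>y. (1 / (LINT y|lborel. ?W y)) * ?W y)" by (rule smooth_cmult[OF sm])
    show "0 \<le> (1 / (LINT y|lborel. ?W y)) * ?W y" for y using pos by (simp add: bump_nonneg)
    show "1 \<le> norm y \<and> norm y \<le> b" if "(1 / (LINT y|lborel. ?W y)) * ?W y \<noteq> 0" for y
      using supp[of y] that by auto
    show "(LINT y|lborel. (1 / (LINT y|lborel. ?W y)) * ?W y) = 1" using pos by (subst integral_mult_right_zero) simp
  qed
qed

lemma compact_support_integrable:
  fixes g :: "'a::euclidean_space \<Rightarrow> 'b::{banach, second_countable_topology}"
  assumes "continuous_on UNIV g" "compact K" "\<And>x. x \<notin> K \<Longrightarrow> g x = 0"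
  shows "integrable lborel g"
proof -
  have "integrable lborel (\<lambda>y. indicator K y *\<^sub>R g y)"
    by (rule borel_integrable_compact[OF assms(2) continuous_on_subset[OF assms(1)]]) simp
  moreover have "(\<lambda>y. indicator K y *\<^sub>R g y) = g" using assms(3) by (auto simp: indicator_def fun_eq_iff)
  ultimately show ?thesis by simp
qed

context even_series begin

text \<open>Averaging over dilations multiplies the coefficient \<open>a j\<close> by the moment \<open>\<omega> j\<close> of the
  weight, which is at most \<open>b ^ (2 * j)\<close>: the type grows by a factor \<open>b\<close>, with the same \<open>A\<close>.\<close>

lemma averaged_series:
  assumes W: "smooth W" "\<And>y. 0 \<le> W y" "\<And>y. W y \<noteq> 0 \<Longrightarrow> 1 \<le> norm y \<and> norm y \<le> b" "(LINT y|lborel. W y) = 1" and b: "1 < b"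
  defines "\<omega> \<equiv> \<lambda>j. LINT y|lborel. W y * norm (y::real^3) ^ (2 * j)"
  shows "even_series (\<lambda>j. a j * \<omega> j) A (\<beta> * b)"
    and "even_series.f (\<lambda>j. a j * \<omega> j) r = (LINT y|lborel. W y * f (r * norm y))"
proof -
  have Wc: "continuous_on UNIV W" by (rule smooth_continuous_on[OF W(1)])
  have W0: "W y = 0" if "y \<notin> cball 0 b" for y using W(3)[of y] that by auto
  have int: "integrable lborel (\<lambda>y. W y * g (norm y))" if "continuous_on UNIV g" for g :: "real \<Rightarrow> real"
    by (rule compact_support_integrable[OF _ compact_cball[of 0 b]])
       (auto intro!: continuous_intros Wc continuous_on_compose2[OF that] simp: W0)
  have Wi: "integrable lborel W" by (rule compact_support_integrable[OF Wc compact_cball W0])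
  have \<omega>0: "0 \<le> \<omega> j" for j unfolding \<omega>_def using W(2) by (intro integral_nonneg_AE) auto
  have \<omega>b: "\<omega> j \<le> b ^ (2 * j)" for j
  proof -
    have "\<omega> j \<le> (LINT y|lborel. W y * b ^ (2 * j))" unfolding \<omega>_def
    proof (rule integral_mono)
      show "integrable lborel (\<lambda>y. W y * norm y ^ (2 * j))" by (rule int) (intro continuous_intros)
      show "integrable lborel (\<lambda>y. W y * b ^ (2 * j))" using Wi by simp
      fix y show "W y * norm y ^ (2 * j) \<le> W y * b ^ (2 * j)"
        using W(3)[of y] W(2)[of y] by (cases "W y = 0") (auto intro!: mult_left_mono power_mono)
    qed
    then show ?thesis using W(4) by simp
  qed
  show es: "even_series (\<lambda>j. a j * \<omega> j) A (\<beta> * b)"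
  proof
    show "0 < \<beta> * b" using beta b by simp
    fix j
    have "\<bar>a j * \<omega> j\<bar> \<le> (A * \<beta> ^ (2 * j) / fact (2 * j)) * b ^ (2 * j)"
      unfolding abs_mult using \<omega>0 \<omega>b by (intro mult_mono coeff) (auto intro: order_trans[OF abs_ge_zero coeff])
    then show "\<bar>a j * \<omega> j\<bar> \<le> A * (\<beta> * b) ^ (2 * j) / fact (2 * j)"
      by (simp add: power_mult_distrib mult_ac)
  qed
  let ?g = "\<lambda>j y. W y * (a j * (r * norm y) ^ (2 * j))"
  have gi: "integrable lborel (?g j)" for j by (rule int) (intro continuous_intros)
  have gs: "summable (\<lambda>j. norm (?g j y))" for y
    unfolding norm_mult[of "W y"] real_norm_def[of "a _ * _"] by (rule summable_mult[OF f_abs_summable])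
  have gn: "summable (\<lambda>j. LINT y|lborel. norm (?g j y))"
  proof (rule summable_comparison_test'[OF f_abs_summable[of "r * b"]])
    fix j
    have "(LINT y|lborel. norm (?g j y)) \<le> (LINT y|lborel. W y * \<bar>a j * (r * b) ^ (2 * j)\<bar>)"
    proof (rule integral_mono)
      show "integrable lborel (\<lambda>y. norm (?g j y))" using gi by (rule integrable_norm)
      show "integrable lborel (\<lambda>y. W y * \<bar>a j * (r * b) ^ (2 * j)\<bar>)" using Wi by (rule integrable_mult_left)
      fix y show "norm (?g j y) \<le> W y * \<bar>a j * (r * b) ^ (2 * j)\<bar>"
      proof (cases "W y = 0")
        case False
        have "\<bar>a j * (r * norm y) ^ (2 * j)\<bar> \<le> \<bar>a j * (r * b) ^ (2 * j)\<bar>"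
          unfolding abs_mult power_abs using W(3)[OF False] b by (intro mult_left_mono power_mono mult_mono) auto
        from mult_left_mono[OF this W(2)[of y]] W(2)[of y] show ?thesis by (simp add: abs_mult)
      qed simp
    qed
    also have "\<dots> = \<bar>a j * (r * b) ^ (2 * j)\<bar>" using W(4) by (simp only: integral_mult_left_zero mult_1)
    finally show "norm (LINT y|lborel. norm (?g j y)) \<le> \<bar>a j * (r * b) ^ (2 * j)\<bar>"
      by (simp add: abs_of_nonneg[OF integral_nonneg_AE])
  qed
  have "(LINT y|lborel. W y * f (r * norm y)) = (LINT y|lborel. (\<Sum>j. ?g j y))"
    unfolding f_def by (simp add: suminf_mult[OF f_summable])
  also have "\<dots> = (\<Sum>j. LINT y|lborel. ?g j y)"
    by (rule integral_suminf[OF gi _ gn]) (use gs in simp)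
  also have "(\<lambda>j. LINT y|lborel. ?g j y) = (\<lambda>j. a j * \<omega> j * r ^ (2 * j))"
  proof
    fix j
    have "(LINT y|lborel. ?g j y) = (LINT y|lborel. (a j * r ^ (2 * j)) * (W y * norm y ^ (2 * j)))"
      by (intro Bochner_Integration.integral_cong) (auto simp: power_mult_distrib)
    also have "\<dots> = (a j * r ^ (2 * j)) * \<omega> j" by (simp only: integral_mult_right_zero \<omega>_def)
    finally show "(LINT y|lborel. ?g j y) = a j * \<omega> j * r ^ (2 * j)" by (simp add: mult_ac)
  qed
  finally show "even_series.f (\<lambda>j. a j * \<omega> j) r = (LINT y|lborel. W y * f (r * norm y))"
    by (simp add: even_series.f_def[OF es])
qed

text \<open>\<open>\<psi>\<close>, the inverse transform of \<open>\<phi>\<close>, does not have compact support, so \<open>T \<psi>\<close> is approached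
  by \<open>T (P n)\<close> with cutoffs \<open>P n\<close> of \<open>\<psi>\<close>. The averaged series \<open>E.f\<close> pairs with \<open>P n\<close> as an
  average over \<open>y\<close> of values of \<open>T\<close> at dilations of \<open>P n\<close>, all of which differ from \<open>T \<psi>\<close> by at
  most \<open>O(1 / n) + O(1 - 1 / b)\<close>. On the other hand that pairing tends to \<open>0\<close>, as \<open>E.f\<close> grows
  polynomially and has type \<open>\<beta> * b < \<kappa>\<close>. Hence \<open>T \<psi> = O(1 - 1 / b)\<close> for all \<open>b > 1\<close> near \<open>1\<close>.\<close>

lemma series_distribution_support:
  assumes T: "tempered_distribution T" and FT: "distribution_of (\<lambda>\<xi>. complex_of_real (f (norm \<xi>))) T"
    and phi: "schwartz \<phi>" and supp: "\<And>x. norm x < \<kappa> \<Longrightarrow> \<phi> x = 0" and kappa: "\<beta> < \<kappa>"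
  shows "T (inverse_fourier \<phi>) = 0"
proof -
  define \<psi> where "\<psi> = inverse_fourier \<phi>"
  have psi: "schwartz \<psi>" unfolding \<psi>_def by (rule schwartz_opD[OF schwartz_op_inverse_fourier phi])
  obtain N C where C: "0 \<le> C" "\<And>\<phi>. schwartz \<phi> \<Longrightarrow> norm (T \<phi>) \<le> C * schwartz_norm N \<phi>"
    using tempered_distribution_bound[OF T] by metis
  have Fc: "continuous_on UNIV (\<lambda>\<xi>::real^3. complex_of_real (f (r * norm \<xi>)))" for r
    by (intro continuous_intros continuous_on_compose2[OF f_continuous]) auto
  have Tint: "T h = (LINT \<xi>|lborel. of_real (f (norm \<xi>)) * h \<xi>)" if h: "test_function UNIV h" for h
  proof -
    have "T h = (LINT \<xi>|lebesgue. of_real (f (norm \<xi>)) * h \<xi>)" using FT h by (simp add: distribution_of_def)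
    also have "\<dots> = (LINT \<xi>|lborel. of_real (f (norm \<xi>)) * h \<xi>)"
    proof (rule integral_completion)
      have "h \<in> borel_measurable borel"
        using h by (intro borel_measurable_continuous_onI smooth_continuous_on) (simp add: test_function_def)
      then show "(\<lambda>\<xi>. of_real (f (norm \<xi>)) * h \<xi>) \<in> borel_measurable lborel"
        using borel_measurable_continuous_onI[OF Fc[of 1]] by simp
    qed
    finally show ?thesis .
  qed
  obtain C1 where C1: "\<And>c. 1/2 \<le> c \<Longrightarrow> c \<le> 1 \<Longrightarrow>
      schwartz_norm N (\<lambda>x. of_real (c ^ 3) * \<psi> (c *\<^sub>R x) - \<psi> x) \<le> C1 * (1 - c)"
    using schwartz_dilation_continuous[OF psi, of N] by blast
  obtain \<eta> :: "real^3 \<Rightarrow> complex" where eta: "smooth \<eta>" "\<eta> 0 = 1" "\<And>x. x \<notin> cball 0 1 \<Longrightarrow> \<eta> x = 0"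
    using exists_cutoff by blast
  obtain C2 where C2: "\<And>c. 0 < c \<Longrightarrow> c \<le> 1 \<Longrightarrow> schwartz_norm N (\<lambda>x. \<eta> (c *\<^sub>R x) * \<psi> x - \<psi> x) \<le> C2 * c"
    using schwartz_cutoff[OF eta psi, of N] by blast
  obtain B where B: "\<And>x. norm (\<eta> x) \<le> B"
    using compactly_supported_bounded[OF eta(1) compact_cball[of 0 1] eta(3), where js="[]"] by auto
  define t where "t n = 1 / real (Suc n)" for n
  have t: "0 < t n" "t n \<le> 1" for n by (auto simp: t_def)
  have t0: "t \<longlonglongrightarrow> 0" unfolding t_def[abs_def] by (rule LIMSEQ_Suc[OF lim_1_over_n])
  define P where "P n \<xi> = \<eta> (t n *\<^sub>R \<xi>) * \<psi> \<xi>" for n \<xi>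
  have Psm: "smooth (P n)" for n unfolding P_def[abs_def] by (intro smooth_mult smooth_scale eta schwartz_smooth psi)
  have P0: "P n \<xi> = 0" if "\<xi> \<notin> cball 0 (1 / t n)" for n \<xi>
    using that t[of n] eta(3)[of "t n *\<^sub>R \<xi>"] by (simp add: P_def field_simps)
  have Pt: "test_function UNIV (P n)" for n by (rule test_functionI[OF Psm compact_cball[of 0 "1 / t n"] _ P0]) auto
  note Ps = test_function_schwartz[OF Pt]
  have Pc: "continuous_on UNIV (P n)" for n by (rule smooth_continuous_on[OF Psm])
  \<comment> \<open>Dilating \<open>f\<close> by \<open>norm y\<close> amounts to dilating the test function by \<open>c = 1 / norm y\<close>. The
    first error term is the cutoff, the second one the dilation of \<open>\<psi>\<close>; neither depends on \<open>y\<close>.\<close>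
  have dil: "norm ((LINT \<xi>|lborel. of_real (f (norm y * norm \<xi>)) * P n \<xi>) - T \<psi>) \<le> C * (2 ^ N * (C2 * t n)) + C * (C1 * (1 - 1 / b))"
    if y: "1 \<le> norm y" "norm y \<le> b" and b: "1 < b" "b \<le> 2" for y :: "real^3" and n b
  proof -
    define c where "c = 1 / norm y"
    have c: "1/2 \<le> c" "c \<le> 1" "1 / b \<le> c" "0 < c"
    proof -
      have "0 < norm y" using y by linarith
      with y b show "1/2 \<le> c" "c \<le> 1" "1 / b \<le> c" "0 < c"
        unfolding c_def by (simp_all add: pos_le_divide_eq pos_divide_le_eq del: zero_less_norm_iff)
    qed
    have cc: "norm y * (c * r) = r" for r using y by (cases "y = 0") (auto simp: c_def)
    let ?D = "\<lambda>x. of_real (c ^ 3) * P n (c *\<^sub>R x)"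
    have Ds: "smooth ?D" by (intro smooth_cmult smooth_scale Psm)
    have Dt: "test_function UNIV ?D"
    proof (rule test_functionI[OF Ds compact_cball[of 0 "1 / (c * t n)"]])
      show "?D x = 0" if "x \<notin> cball 0 (1 / (c * t n))" for x
        using P0[of "c *\<^sub>R x" n] that c t[of n] by (simp add: field_simps)
    qed auto
    have "(LINT \<xi>|lborel. of_real (f (norm y * norm \<xi>)) * P n \<xi>) =
        c ^ 3 *\<^sub>R (LINT \<xi>|lborel. of_real (f (norm y * norm (c *\<^sub>R \<xi>))) * P n (c *\<^sub>R \<xi>))"
      by (rule integral_scale[OF _ c(4)])
         (intro borel_measurable_continuous_onI continuous_on_mult Fc Pc)
    also have "\<dots> = (LINT \<xi>|lborel. of_real (f (norm \<xi>)) * ?D \<xi>)"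
    proof -
      have "c ^ 3 *\<^sub>R (of_real (f (norm y * norm (c *\<^sub>R \<xi>))) * P n (c *\<^sub>R \<xi>)) = of_real (f (norm \<xi>)) * ?D \<xi>" for \<xi>
        using c(4) by (simp add: cc scaleR_conv_of_real[where 'a=complex])
      then show ?thesis by (simp only: integral_scaleR_right[symmetric])
    qed
    finally have eq: "(LINT \<xi>|lborel. of_real (f (norm y * norm \<xi>)) * P n \<xi>) = T ?D" using Tint[OF Dt] by simp
    let ?Q = "\<lambda>x. of_real (c ^ 3) * \<psi> (c *\<^sub>R x)"
    have Qs: "schwartz ?Q" by (intro schwartz_cmult schwartz_dilation(1) psi c)
    let ?R = "\<lambda>x. P n x - \<psi> x"
    have Rs: "schwartz ?R" by (rule schwartz_diff[OF Ps psi])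
    have "T (\<lambda>x. ?D x - ?Q x) = T (\<lambda>x. of_real (c ^ 3) * ?R (c *\<^sub>R x))"
      by (simp add: right_diff_distrib)
    also have "\<dots> = of_real (c ^ 3) * T (\<lambda>x. ?R (c *\<^sub>R x))"
      using T schwartz_dilation(1)[OF Rs c(4,2)] unfolding tempered_distribution_def by blast
    finally have "norm (T (\<lambda>x. ?D x - ?Q x)) = c ^ 3 * norm (T (\<lambda>x. ?R (c *\<^sub>R x)))"
      using c by (simp add: norm_mult norm_power)
    also have "\<dots> \<le> 1 * (C * schwartz_norm N (\<lambda>x. ?R (c *\<^sub>R x)))"
      using c C schwartz_norm_nonneg[OF schwartz_dilation(1)[OF Rs c(4,2)]]
      by (intro mult_mono C schwartz_dilation(1)[OF Rs c(4,2)] power_le_one) auto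
    also have "\<dots> \<le> C * ((1 / c) ^ N * schwartz_norm N ?R)"
      using C(1) schwartz_dilation(2)[OF Rs c(4,2), of N] by (simp add: mult_left_mono)
    also have "\<dots> \<le> C * (2 ^ N * (C2 * t n))"
    proof -
      have "1 / c \<le> 2" using c by (simp add: field_simps)
      then have "(1 / c) ^ N \<le> 2 ^ N" using c by (intro power_mono) auto
      moreover have "schwartz_norm N ?R \<le> C2 * t n" unfolding P_def by (rule C2[OF t])
      ultimately show ?thesis
        using C(1) schwartz_norm_nonneg[OF Rs, of N] by (intro mult_left_mono mult_mono) auto
    qed
    finally have 1: "norm (T (\<lambda>x. ?D x - ?Q x)) \<le> C * (2 ^ N * (C2 * t n))" .
    have C10: "0 \<le> C1" using order_trans[OF schwartz_norm_nonneg[OF schwartz_diff[OF schwartz_cmult[OF schwartz_dilation(1)[OF psi, of "1/2"]] psi]] C1[of "1/2"]]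
      by simp
    have "norm (T (\<lambda>x. ?Q x - \<psi> x)) \<le> C * (C1 * (1 - c))"
      using order_trans[OF C(2)[OF schwartz_diff[OF Qs psi]] mult_left_mono[OF C1[OF c(1,2)] C(1)]] .
    also have "\<dots> \<le> C * (C1 * (1 - 1 / b))" using C(1) C10 c by (intro mult_left_mono) auto
    finally have 2: "norm (T (\<lambda>x. ?Q x - \<psi> x)) \<le> C * (C1 * (1 - 1 / b))" .
    have "T ?D - T \<psi> = T (\<lambda>x. ?D x - ?Q x) + T (\<lambda>x. ?Q x - \<psi> x)"
      unfolding tempered_distribution_diff[OF T test_function_schwartz[OF Dt] Qs] tempered_distribution_diff[OF T Qs psi] by simp
    then show ?thesis unfolding eq using 1 2 norm_triangle_ineq[of "T (\<lambda>x. ?D x - ?Q x)" "T (\<lambda>x. ?Q x - \<psi> x)"] by simp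
  qed
  have main: "norm (T \<psi>) \<le> C * (C1 * (1 - 1 / b))" if b: "1 < b" "b \<le> 2" "\<beta> * b < \<kappa>" for b
  proof -
    obtain W :: "real^3 \<Rightarrow> real" where W: "smooth W" "\<And>y. 0 \<le> W y" "\<And>y. W y \<noteq> 0 \<Longrightarrow> 1 \<le> norm y \<and> norm y \<le> b"
      "(LINT y|lborel. W y) = 1" using exists_shell_bump[OF b(1)] by metis
    define \<omega> where "\<omega> j = (LINT y|lborel. W y * norm y ^ (2 * j))" for j
    note av = averaged_series[OF W b(1), folded \<omega>_def]
    interpret E: even_series "\<lambda>j. a j * \<omega> j" A "\<beta> * b" by (rule av(1))
    have Ef: "E.f r = (LINT y|lborel. W y * f (r * norm y))" for r by (rule av(2))
    have Wc: "continuous_on UNIV W" by (rule smooth_continuous_on[OF W(1)])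
    have W0: "W y = 0" if "y \<notin> cball 0 b" for y using W(3)[of y] that by auto
    have Wi: "integrable lborel W" by (rule compact_support_integrable[OF Wc compact_cball W0])
    let ?Wc = "\<lambda>y. complex_of_real (W y)"
    have Ws: "smooth ?Wc" by (rule smooth_of_real[OF W(1)])
    have Wt: "test_function UNIV ?Wc" by (rule test_functionI[OF Ws compact_cball[of 0 b]]) (use W0 in auto)
    note Wsch = test_function_schwartz[OF Wt]
    \<comment> \<open>For \<open>r \<ge> 1\<close>, the average at \<open>r\<close> is a value of \<open>T\<close> at a dilated copy of \<open>W\<close>, whose
      Schwartz norm grows polynomially in \<open>r\<close>. For \<open>r < 1\<close> the series itself is bounded.\<close>
    define S where "S = schwartz_norm N ?Wc"
    have S0: "0 \<le> S" unfolding S_def by (rule schwartz_norm_nonneg[OF Wsch])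
    have big: "\<bar>E.f r\<bar> \<le> C * S * (1 + r) ^ N" if r: "1 \<le> r" for r
    proof -
      have c: "0 < 1 / r" "1 / r \<le> 1" using r by auto
      let ?D = "\<lambda>y. ?Wc ((1 / r) *\<^sub>R y)"
      have Dt: "test_function UNIV ?D"
      proof (rule test_functionI[OF smooth_scale[OF Ws] compact_cball[of 0 "b * r"]])
        show "?D x = 0" if "x \<notin> cball 0 (b * r)" for x using W0[of "(1 / r) *\<^sub>R x"] that r by (simp add: field_simps)
      qed auto
      have "T ?D = (LINT y|lborel. of_real (f (norm y)) * ?D y)" by (rule Tint[OF Dt])
      also have "\<dots> = r ^ 3 *\<^sub>R (LINT y|lborel. of_real (f (norm (r *\<^sub>R y))) * ?D (r *\<^sub>R y))"
        using Fc[of 1] smooth_continuous_on[OF smooth_scale[OF Ws]] r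
        by (intro integral_scale borel_measurable_continuous_onI continuous_on_mult) auto
      also have "(LINT y|lborel. of_real (f (norm (r *\<^sub>R y))) * ?D (r *\<^sub>R y)) = (LINT y|lborel. complex_of_real (W y * f (r * norm y)))"
        using r by (intro Bochner_Integration.integral_cong) auto
      also have "\<dots> = of_real (E.f r)" by (simp only: integral_complex_of_real Ef)
      finally have "norm (T ?D) = r ^ 3 * \<bar>E.f r\<bar>" using r by (simp add: norm_mult norm_power)
      moreover have "1 * \<bar>E.f r\<bar> \<le> r ^ 3 * \<bar>E.f r\<bar>" using r by (intro mult_right_mono one_le_power) auto
      ultimately have "\<bar>E.f r\<bar> \<le> norm (T ?D)" by simp
      also have "\<dots> \<le> C * schwartz_norm N ?D" by (rule C(2)[OF test_function_schwartz[OF Dt]])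
      also have "\<dots> \<le> C * ((1 / (1 / r)) ^ N * S)"
        unfolding S_def using C(1) by (intro mult_left_mono schwartz_dilation(2)[OF Wsch c])
      also have "\<dots> = C * S * r ^ N" by simp
      also have "\<dots> \<le> C * S * (1 + r) ^ N" using C(1) S0 r by (intro mult_left_mono power_mono) auto
      finally show ?thesis .
    qed
    define G where "G = C * S + A * exp (\<beta> * b)"
    have Efb: "\<bar>E.f r\<bar> \<le> G * (1 + r) ^ N" if r: "0 \<le> r" for r
    proof (cases "1 \<le> r")
      case True
      have "C * S * (1 + r) ^ N \<le> G * (1 + r) ^ N" unfolding G_def using A_nonneg r by (intro mult_right_mono) auto
      with big[OF True] show ?thesis by linarith
    next
      case False
      have "\<bar>E.f r\<bar> \<le> (\<Sum>j. \<bar>a j * \<omega> j * r ^ (2 * j)\<bar>)"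
        unfolding E.f_def by (rule summable_rabs[OF E.f_abs_summable])
      also have "\<dots> \<le> A * exp \<bar>\<beta> * b * r\<bar>" by (rule E.f_bound)
      also have "\<dots> \<le> A * exp (\<beta> * b)"
      proof -
        have "\<bar>\<beta> * b * r\<bar> = \<beta> * b * r" using beta b(1) r by (intro abs_of_nonneg mult_nonneg_nonneg) auto
        also have "\<dots> \<le> \<beta> * b * 1" using E.beta r False by (intro mult_left_mono) auto
        finally show ?thesis using A_nonneg by (intro mult_left_mono) auto
      qed
      also have "\<dots> \<le> G * 1" using C(1) S0 by (simp add: G_def)
      also have "\<dots> \<le> G * (1 + r) ^ N"
        using r C(1) S0 A_nonneg by (intro mult_left_mono one_le_power) (auto simp: G_def)
      finally show ?thesis .
    qed
    have G0: "0 \<le> G" using Efb[of 0] by auto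
    have zero: "(LINT \<xi>|lborel. of_real (E.f (norm \<xi>)) * \<psi> \<xi>) = 0"
      unfolding \<psi>_def by (rule E.paley_wiener_radial[OF Efb phi supp b(3)])
    have Efc: "continuous_on UNIV (\<lambda>\<xi>::real^3. complex_of_real (E.f (norm \<xi>)))"
      by (intro continuous_intros continuous_on_compose2[OF E.f_continuous]) auto
    have lim: "(\<lambda>n. LINT \<xi>|lborel. of_real (E.f (norm \<xi>)) * P n \<xi>) \<longlonglongrightarrow> 0"
      unfolding zero[symmetric]
    proof (rule integral_dominated_convergence)
      let ?S = "schwartz_norm (N + 4) \<psi>"
      show "integrable lborel (\<lambda>\<xi>::real^3. G * B * ?S * (1 / (1 + norm \<xi>) ^ 4))"
        by (intro integrable_mult_right integrable_inverse_power)
      show "(\<lambda>\<xi>. of_real (E.f (norm \<xi>)) * \<psi> \<xi>) \<in> borel_measurable lborel"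
        using schwartz_measurable[OF psi] borel_measurable_continuous_onI[OF Efc] by simp
      show "(\<lambda>\<xi>. of_real (E.f (norm \<xi>)) * P n \<xi>) \<in> borel_measurable lborel" for n
        using borel_measurable_continuous_onI[OF Pc] borel_measurable_continuous_onI[OF Efc] by simp
      show "AE \<xi> in lborel. (\<lambda>n. of_real (E.f (norm \<xi>)) * P n \<xi>) \<longlonglongrightarrow> of_real (E.f (norm \<xi>)) * \<psi> \<xi>"
      proof (rule AE_I2)
        fix \<xi> :: "real^3"
        have "isCont \<eta> (0 *\<^sub>R \<xi>)" using smooth_continuous_on[OF eta(1), of UNIV] by (simp add: continuous_on_eq_continuous_at)
        moreover have "(\<lambda>n. t n *\<^sub>R \<xi>) \<longlonglongrightarrow> 0 *\<^sub>R \<xi>" by (intro tendsto_intros t0)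
        ultimately have "(\<lambda>n. \<eta> (t n *\<^sub>R \<xi>)) \<longlonglongrightarrow> \<eta> (0 *\<^sub>R \<xi>)" by (rule isCont_tendsto_compose)
        then have "(\<lambda>n. of_real (E.f (norm \<xi>)) * (\<eta> (t n *\<^sub>R \<xi>) * \<psi> \<xi>)) \<longlonglongrightarrow> of_real (E.f (norm \<xi>)) * (\<eta> (0 *\<^sub>R \<xi>) * \<psi> \<xi>)"
          by (intro tendsto_intros)
        then show "(\<lambda>n. of_real (E.f (norm \<xi>)) * P n \<xi>) \<longlonglongrightarrow> of_real (E.f (norm \<xi>)) * \<psi> \<xi>"
          by (simp add: P_def eta(2))
      qed
      show "AE \<xi> in lborel. norm (of_real (E.f (norm \<xi>)) * P n \<xi>) \<le> G * B * ?S * (1 / (1 + norm \<xi>) ^ 4)" for n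
      proof (rule AE_I2)
        fix \<xi> :: "real^3"
        let ?r = "norm \<xi>"
        have B0: "0 \<le> B" using B[of 0] by (auto intro: order_trans[OF norm_ge_zero])
        have "norm (of_real (E.f ?r) * P n \<xi>) \<le> (G * (1 + ?r) ^ N) * (B * (?S / (1 + ?r) ^ (N + 4)))"
          unfolding P_def norm_mult norm_of_real
          using Efb[of ?r] B schwartz_bound(1)[OF psi, of \<xi> "N + 4"] G0 B0 by (intro mult_mono) auto
        also have "\<dots> = G * B * ?S * (1 / (1 + ?r) ^ 4)"
        proof -
          have "(1 + ?r) ^ N \<noteq> 0" by (simp add: add_nonneg_eq_0_iff)
          then show ?thesis unfolding power_add by (simp del: power_eq_0_iff)
        qed
        finally show "norm (of_real (E.f ?r) * P n \<xi>) \<le> G * B * ?S * (1 / (1 + ?r) ^ 4)" .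
      qed
    qed
    have est: "norm ((LINT \<xi>|lborel. of_real (E.f (norm \<xi>)) * P n \<xi>) - T \<psi>) \<le> C * (2 ^ N * (C2 * t n)) + C * (C1 * (1 - 1 / b))" for n
    proof -
      let ?H = "\<lambda>y \<xi>. of_real (W y) * (of_real (f (norm y * norm \<xi>)) * P n \<xi>)"
      have Hi: "integrable (lborel \<Otimes>\<^sub>M lborel) (\<lambda>(y::real^3, \<xi>::real^3). ?H y \<xi>)"
        unfolding lborel_prod case_prod_unfold
      proof (rule compact_support_integrable[OF _ compact_Times[OF compact_cball[of 0 b] compact_cball[of 0 "1 / t n"]]])
        show "continuous_on UNIV (\<lambda>p::(real^3)\<times>(real^3). ?H (fst p) (snd p))"
          by (intro continuous_intros continuous_on_compose2[OF Wc] continuous_on_compose2[OF f_continuous] continuous_on_compose2[OF Pc]) auto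
        show "?H (fst p) (snd p) = 0" if "p \<notin> cball 0 b \<times> cball 0 (1 / t n)" for p
          using that W0[of "fst p"] P0[of "snd p" n] by (cases p) auto
      qed
      let ?h = "\<lambda>y. LINT \<xi>|lborel. of_real (f (norm y * norm \<xi>)) * P n \<xi>"
      have hi: "integrable lborel (\<lambda>y. of_real (W y) * ?h y)"
        using lborel_pair.integrable_fst[OF Hi] by simp
      have "(LINT \<xi>|lborel. of_real (E.f (norm \<xi>)) * P n \<xi>) = (LINT \<xi>|lborel. LINT y|lborel. ?H y \<xi>)"
      proof (intro Bochner_Integration.integral_cong refl)
        fix \<xi> :: "real^3"
        have "(LINT y|lborel. ?H y \<xi>) = (LINT y|lborel. complex_of_real (W y * f (norm \<xi> * norm y)) * P n \<xi>)"
          by (intro Bochner_Integration.integral_cong) (auto simp: mult.commute)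
        also have "\<dots> = (LINT y|lborel. complex_of_real (W y * f (norm \<xi> * norm y))) * P n \<xi>"
          by (rule integral_mult_left_zero)
        finally show "of_real (E.f (norm \<xi>)) * P n \<xi> = (LINT y|lborel. ?H y \<xi>)"
          by (simp only: integral_complex_of_real Ef)
      qed
      also have "\<dots> = (LINT y|lborel. LINT \<xi>|lborel. ?H y \<xi>)"
        by (rule lborel_pair.Fubini_integral[OF Hi])
      also have "\<dots> = (LINT y|lborel. of_real (W y) * ?h y)" by (simp only: integral_mult_right_zero)
      finally have 1: "(LINT \<xi>|lborel. of_real (E.f (norm \<xi>)) * P n \<xi>) = (LINT y|lborel. of_real (W y) * ?h y)" .
      have 2: "T \<psi> = (LINT y|lborel. of_real (W y) * T \<psi>)"
      proof -
        have "(LINT y|lborel. of_real (W y) * T \<psi>) = (LINT y|lborel. complex_of_real (W y)) * T \<psi>" by (rule integral_mult_left_zero)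
        then show ?thesis by (simp only: integral_complex_of_real W(4)) simp
      qed
      have Wti: "integrable lborel (\<lambda>y. of_real (W y) * T \<psi>)" using Wi by simp
      have "(LINT \<xi>|lborel. of_real (E.f (norm \<xi>)) * P n \<xi>) - T \<psi> = (LINT y|lborel. of_real (W y) * (?h y - T \<psi>))"
        unfolding 1 right_diff_distrib by (subst Bochner_Integration.integral_diff[OF hi Wti]) (simp only: 2[symmetric])
      moreover have "norm (LINT y|lborel. of_real (W y) * (?h y - T \<psi>)) \<le> (LINT y|lborel. W y * (C * (2 ^ N * (C2 * t n)) + C * (C1 * (1 - 1 / b))))"
      proof (rule integral_norm_le)
        show "integrable lborel (\<lambda>y. of_real (W y) * (?h y - T \<psi>))"
          unfolding right_diff_distrib by (rule Bochner_Integration.integrable_diff[OF hi Wti])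
        show "integrable lborel (\<lambda>y. W y * (C * (2 ^ N * (C2 * t n)) + C * (C1 * (1 - 1 / b))))"
          using Wi by (rule integrable_mult_left)
        fix y
        show "norm (of_real (W y) * (?h y - T \<psi>)) \<le> W y * (C * (2 ^ N * (C2 * t n)) + C * (C1 * (1 - 1 / b)))"
        proof (cases "W y = 0")
          case False
          have "norm (?h y - T \<psi>) \<le> C * (2 ^ N * (C2 * t n)) + C * (C1 * (1 - 1 / b))"
            using W(3)[OF False] by (intro dil b(1,2)) auto
          from mult_left_mono[OF this W(2)[of y]] W(2)[of y] show ?thesis by (simp add: norm_mult)
        qed simp
      qed
      moreover have "(LINT y|lborel. W y * (C * (2 ^ N * (C2 * t n)) + C * (C1 * (1 - 1 / b)))) = C * (2 ^ N * (C2 * t n)) + C * (C1 * (1 - 1 / b))"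
        by (simp only: integral_mult_left_zero W(4)) simp
      ultimately show ?thesis using W(4) by simp
    qed
    have "(\<lambda>n. norm ((LINT \<xi>|lborel. of_real (E.f (norm \<xi>)) * P n \<xi>) - T \<psi>)) \<longlonglongrightarrow> norm (0 - T \<psi>)"
      by (intro tendsto_intros lim)
    moreover have "(\<lambda>n. C * (2 ^ N * (C2 * t n)) + C * (C1 * (1 - 1 / b))) \<longlonglongrightarrow> C * (2 ^ N * (C2 * 0)) + C * (C1 * (1 - 1 / b))"
      by (intro tendsto_intros t0)
    ultimately have "norm (0 - T \<psi>) \<le> C * (2 ^ N * (C2 * 0)) + C * (C1 * (1 - 1 / b))"
      by (rule LIMSEQ_le) (use est in blast)
    then show ?thesis by simp
  qed
  have "\<forall>\<^sub>F b in at_right 1. norm (T \<psi>) \<le> C * (C1 * (1 - 1 / b))"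
  proof -
    have "((\<lambda>b. \<beta> * b) \<longlongrightarrow> \<beta> * 1) (at_right 1)" by (intro tendsto_intros)
    then have "\<forall>\<^sub>F b in at_right 1. \<beta> * b < \<kappa>" by (rule order_tendstoD) (use kappa in simp)
    moreover have "\<forall>\<^sub>F b in at_right 1. b < (2::real)"
      by (rule eventually_mono[OF eventually_at_right_real[of 1 2]]) auto
    ultimately show ?thesis using eventually_at_right_less[of 1] by eventually_elim (use main in auto)
  qed
  moreover have "((\<lambda>b. C * (C1 * (1 - 1 / b))) \<longlongrightarrow> C * (C1 * (1 - 1 / 1))) (at_right 1)"
    by (intro tendsto_intros) auto
  ultimately have "norm (T \<psi>) \<le> C * (C1 * (1 - 1 / 1))"
    by (intro tendsto_le[OF trivial_limit_at_right_real _ tendsto_const])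
  then show ?thesis by (simp add: \<psi>_def)
qed

end

section \<open>The Born approximation\<close>

text \<open>In the step from \<open>j\<close> to \<open>j + 1\<close> the left side is multiplied by \<open>(2 * j + 1) * (2 * j + 2)\<close>
  and the right side by \<open>(2 * j + 2) * (2 * j + 5)\<close>.\<close>

lemma fact_Gamma_lower: "Gamma (5/2) * fact (2 * j) \<le> fact j * Gamma (real j + 5/2) * 4 ^ j"
proof (induction j)
  case (Suc j)
  have g: "Gamma (real (Suc j) + 5/2) = (real j + 5/2) * Gamma (real j + 5/2)"
    using Gamma_plus1[of "real j + 5/2"] by (simp add: add_ac nonpos_Ints_def)
  have G: "0 < Gamma (real j + 5/2)" by (intro Gamma_real_pos) simp
  have "Gamma (5/2) * fact (2 * Suc j) = (real (2 * j + 1) * real (2 * j + 2)) * (Gamma (5/2) * fact (2 * j))"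
    by (simp add: algebra_simps)
  also have "\<dots> \<le> (real (2 * j + 1) * real (2 * j + 2)) * (fact j * Gamma (real j + 5/2) * 4 ^ j)"
    by (intro mult_left_mono Suc) auto
  also have "\<dots> \<le> ((real j + 1) * (real j + 5/2) * 4) * (fact j * Gamma (real j + 5/2) * 4 ^ j)"
    using G by (intro mult_right_mono) (auto simp: algebra_simps)
  also have "\<dots> = fact (Suc j) * Gamma (real (Suc j) + 5/2) * 4 ^ Suc j" unfolding g by (simp add: algebra_simps)
  finally show ?case .
qed simp

text \<open>A compact set that misses a closed ball misses a slightly larger one.\<close>

lemma test_function_outside_ball:
  assumes "test_function (- cball 0 \<alpha>) \<phi>"
  obtains \<kappa> where "\<alpha> < \<kappa>" "\<And>x. norm x < \<kappa> \<Longrightarrow> \<phi> x = 0"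
proof -
  obtain K where K: "compact K" "K \<subseteq> - cball 0 \<alpha>" "\<And>x. x \<notin> K \<Longrightarrow> \<phi> x = 0"
    using test_function_support[OF assms] by metis
  show ?thesis
  proof (cases "K = {}")
    case True
    then show ?thesis using that[of "\<alpha> + 1"] K(3) by auto
  next
    case False
    obtain m where m: "m \<in> K" "\<And>x. x \<in> K \<Longrightarrow> norm m \<le> norm x"
      using continuous_attains_inf[OF K(1) False, of norm] by (auto intro: continuous_intros)
    have "\<alpha> < norm m" using subsetD[OF K(2) m(1)] by simp
    moreover have "\<phi> x = 0" if "norm x < norm m" for x using K(3)[of x] m(2)[of x] that by fastforce
    ultimately show ?thesis by (rule that)
  qed
qed

theorem propositionA4:
  fixes \<gamma> :: "real^3 \<Rightarrow> real" and \<alpha> c :: real and lam :: "nat \<Rightarrow> real"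
    and T :: "(real^3 \<Rightarrow> complex) \<Rightarrow> complex"
  assumes "0 < \<alpha>" and "\<alpha> \<le> 1"
    and "sobolev_inf 2 unit_ball \<gamma>"
    and "AE x in lebesgue_on unit_ball. \<gamma> x > 0"
    and "\<exists>h :: real \<Rightarrow> real. AE x in lebesgue_on unit_ball. \<gamma> x = h (norm x)"
    and "c > 0" and "AE x in lebesgue_on unit_ball. \<gamma> x \<ge> c"
    and "AE x in lebesgue_on unit_ball. x \<notin> cball 0 \<alpha> \<longrightarrow> \<gamma> x - 1 = 0"
    and "\<And>k. DN_eigenvalue \<gamma> k (lam k)"
    and "tempered_distribution T" and "distribution_of (born_fourier lam) T"
  shows "tempered_distribution (inverse_fourier_distribution T) \<and>
         distribution_supported_in (cball 0 \<alpha>) (inverse_fourier_distribution T)"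
proof -
  have "L_inf unit_ball \<gamma>" using assms(3) by (simp add: numeral_2_eq_2)
  then obtain M where gm: "\<gamma> \<in> borel_measurable ball_measure" and gM: "AE x in ball_measure. \<bar>\<gamma> x\<bar> \<le> M"
    unfolding L_inf_def by blast
  define K where "K = (\<bar>M\<bar> + 1)\<^sup>2 / c + (\<bar>M\<bar> + 1)"
  have K0: "0 \<le> K" using assms(6) by (simp add: K_def)
  have lam: "\<bar>lam k - real k\<bar> \<le> K * real k * \<alpha> ^ (2 * k + 1)" if "1 \<le> k" for k
    unfolding K_def by (rule DN_eigenvalue_close[OF gm gM assms(6,7,8,1,2,9) that])
  \<comment> \<open>The series without its constant factor, the factor \<open>1 / 4 ^ j\<close> coming from the powers of
    \<open>\<bar>\<xi>\<bar> / 2\<close>.\<close>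
  define q where "q j = (-1) ^ Suc j / (fact (Suc j) * Gamma (real (Suc j) + 3/2)) * (lam (Suc j) - real (Suc j)) / 4 ^ j" for j
  define a where "a j = - (pi powr (3/2)) * q j" for j
  define A where "A = pi powr (3/2) * (K / Gamma (5/2))"
  have G5: "0 < Gamma (5/2 :: real)" by (intro Gamma_real_pos) simp
  have qb: "\<bar>q j\<bar> \<le> K / Gamma (5/2) * \<alpha> ^ (2 * j) / fact (2 * j)" for j
  proof -
    let ?g = "Gamma (real j + 5/2)"
    have g: "0 < ?g" by (intro Gamma_real_pos) simp
    have e: "real (Suc j) + 3/2 = real j + 5/2" by simp
    have "\<bar>q j\<bar> = \<bar>lam (Suc j) - real (Suc j)\<bar> / (real (Suc j) * (fact j * ?g * 4 ^ j))"
      unfolding q_def e using g by (simp add: abs_mult abs_divide power_abs mult_ac)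
    also have "\<dots> \<le> (K * real (Suc j) * \<alpha> ^ (2 * Suc j + 1)) / (real (Suc j) * (fact j * ?g * 4 ^ j))"
      using g by (intro divide_right_mono lam) auto
    also have "\<dots> = K * \<alpha> ^ (2 * Suc j + 1) / (fact j * ?g * 4 ^ j)"
    proof -
      have "K * n * x / (n * d) = K * x / d" if "n \<noteq> 0" for n x d :: real using that by simp
      then show ?thesis by simp
    qed
    also have "\<dots> \<le> K * \<alpha> ^ (2 * j) / (Gamma (5/2) * fact (2 * j))"
      using K0 assms(1,2) G5 fact_Gamma_lower[of j]
      by (intro frac_le mult_left_mono power_decreasing) auto
    finally show ?thesis by (simp add: mult_ac)
  qed
  have ab: "\<bar>a j\<bar> \<le> A * \<alpha> ^ (2 * j) / fact (2 * j)" for j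
  proof -
    have "\<bar>a j\<bar> = pi powr (3/2) * \<bar>q j\<bar>" by (simp add: a_def abs_mult)
    also have "\<dots> \<le> pi powr (3/2) * (K / Gamma (5/2) * \<alpha> ^ (2 * j) / fact (2 * j))"
      by (intro mult_left_mono qb) simp
    finally show ?thesis by (simp add: A_def mult.assoc)
  qed
  interpret even_series a A \<alpha> by standard (use ab assms(1) in auto)
  have born: "born_fourier lam = (\<lambda>\<xi>. complex_of_real (f (norm \<xi>)))"
  proof
    fix \<xi> :: "real^3"
    let ?t = "\<lambda>j. (-1) ^ Suc j / (fact (Suc j) * Gamma (real (Suc j) + 3/2)) * (norm \<xi> / 2) ^ (2 * j) * (lam (Suc j) - real (Suc j))"
    have t: "?t j = q j * norm \<xi> ^ (2 * j)" for j
      by (simp add: q_def power_divide power_mult)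
    have "pi powr (3/2) \<noteq> (0::real)" by simp
    then have "summable (\<lambda>j. (- 1 / (pi powr (3/2))) * (a j * norm \<xi> ^ (2 * j)))"
      by (intro summable_mult f_summable)
    then have s: "summable (\<lambda>j. q j * norm \<xi> ^ (2 * j))" by (simp add: a_def)
    have "- (pi powr (3/2)) * (\<Sum>j. q j * norm \<xi> ^ (2 * j)) = f (norm \<xi>)"
      unfolding f_def a_def mult.assoc by (rule suminf_mult[OF s, symmetric])
    then show "born_fourier lam \<xi> = complex_of_real (f (norm \<xi>))"
      unfolding born_fourier_def t by (simp only:)
  qed
  have "inverse_fourier_distribution T \<phi> = 0" if test: "test_function (- cball 0 \<alpha>) \<phi>" for \<phi>
  proof -
    obtain \<kappa> where "\<alpha> < \<kappa>" "\<And>x. norm x < \<kappa> \<Longrightarrow> \<phi> x = 0"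
      using test_function_outside_ball[OF test] by metis
    then show ?thesis
      unfolding inverse_fourier_distribution_def
      using series_distribution_support[OF assms(10) assms(11)[unfolded born] test_function_schwartz[OF test]] by blast
  qed
  then show ?thesis
    using tempered_inverse_fourier_distribution[OF assms(10)] by (simp add: distribution_supported_in_def)
qed

end
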